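(* Let $Q,n,m\ge 1$ be integers and let $\Omega$ be a bounded open subset of $\mathbb{R}^m$. Let $f : \Omega \to \mathcal{A}_Q(\mathbb{R}^n)$ be continuous. If $\Sigma \circ f \in C^{Q-1,1}(\overline \Omega,\mathbb{R}^r)$, then for each relatively compact open $\Omega' \subseteq \Omega$ we have $f \in W^{1,\infty}(\Omega',\mathcal{A}_Q(\mathbb{R}^n))$. Moreover, $$\|D f\|_{L^\infty(\Omega')} \le C \Big(1 + \max_{1 \le j \le r} \|\Sigma_j \circ f\|^{1/d_j}_{C^{Q-1,1}(\overline \Omega)}\Big),$$ where $C=C(Q,n,m,\Omega,\Omega')$ depends only on $Q,n,m,\Omega,\Omega'$ (and on the fixed choice of generators $\sigma_1,\dots,\sigma_r$ defining $\Sigma$).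
   Context: $\mathcal{A}_Q(\mathbb{R}^n)=\{\sum_{i=1}^Q\llbracket p_i\rrbracket: p_i\in\mathbb{R}^n\}$ is the space of unordered $Q$-tuples of points in $\mathbb{R}^n$, $\llbracket p\rrbracket$ being the Dirac mass at $p$, with the complete metric $d(\sum_i\llbracket p_i\rrbracket,\sum_i\llbracket q_i\rrbracket)=\min_{s\in \mathrm{S}_Q}(\sum_i|p_i-q_{s(i)}|^2)^{1/2}$. Sobolev functions: for $\Omega\subseteq\mathbb{R}^m$ bounded open, a measurable $f:\Omega\to\mathcal{A}_Q(\mathbb{R}^n)$ is in $W^{1,p}(\Omega,\mathcal{A}_Q(\mathbb{R}^n))$ ($1\le p\le\infty$) if (1) $x\mapsto d(f(x),P)\in W^{1,p}(\Omega)$ for all $P\in\mathcal{A}_Q(\mathbb{R}^n)$, and (2) there are $\varphi_1,\dots,\varphi_m\in L^p(\Omega,\mathbb{R}^+)$ with $|\partial_jd(f,P)|\le\varphi_j$ a.e. in $\Omega$ for all $P$ and all $j$. The minimal such $\varphi_j$ is denoted $|\partial_jf|$ (equal a.e. to $\sup_\ell|\partial_jd(f,P_\ell)|$ for any countable dense $\{P_\ell\}$), $|Df|=(\sum_j|\partial_jf|^2)^{1/2}$, and $\|Df\|_{L^p}$ is the $L^p$-norm of $|Df|$. Let $W=(\mathbb{R}^Q)^{\oplus n}\cong\mathbb{R}^{Q\times n}$ be the space of $Q\times n$ matrices on which $\mathrm{S}_Q$ acts by permuting rows, and let $\pi:W\to\mathcal{A}_Q(\mathbb{R}^n)$ send a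 matrix with rows $p_1,\dots,p_Q$ to $\sum_i\llbracket p_i\rrbracket$. Let $\sigma_1,\dots,\sigma_r$ be a fixed system of homogeneous generators of the algebra $\mathbb{R}[W]^{\mathrm{S}_Q}$ of invariant polynomials, with $d_j=\deg\sigma_j\le Q$ for all $j$, and $\sigma=(\sigma_1,\dots,\sigma_r):W\to\mathbb{R}^r$. Then $\Sigma=(\Sigma_1,\dots,\Sigma_r):\mathcal{A}_Q(\mathbb{R}^n)\to\sigma(W)\subseteq\mathbb{R}^r$ is the bijection with $\sigma=\Sigma\circ\pi$. $C^{k,1}(\overline\Omega)$: $C^k$ functions on $\Omega$ whose partial derivatives of order $\le k$ extend continuously to $\overline\Omega$ and are Lipschitz in $\Omega$, with norm $\max_{|\gamma|\le k}\sup_{\Omega}|\partial^\gamma f|+\max_{|\gamma|=k}\mathrm{Lip}_\Omega(\partial^\gamma f)$. *)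

theory Defs
  imports "HOL-Analysis.Analysis" "HOL-Combinatorics.Combinatorics"
    "HOL-Probability.Essential_Supremum"
begin

section \<open>Unordered tuples\<close>

text \<open>A formal sum of Dirac masses is encoded as the multiset of its points, and the number of
  points is the cardinality of the finite type \<open>'q\<close>, which also indexes the rows of the matrices
  representing such a sum.\<close>

typedef ('a, 'q) unordered_tuple = "{M :: 'a multiset. size M = CARD('q::finite)}"
  by (rule exI[of _ "replicate_mset CARD('q) undefined"]) simp

definition unordered :: "'a ^ 'q \<Rightarrow> ('a, 'q::finite) unordered_tuple" where
  "unordered p = Abs_unordered_tuple (image_mset (\<lambda>i. p $ i) (mset_set UNIV))"

definition permute_rows :: "('q \<Rightarrow> 'q) \<Rightarrow> 'a ^ 'q \<Rightarrow> 'a ^ 'q::finite" where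
  "permute_rows s p = (\<chi> i. p $ s i)"

lemma vec_nth_lambda: "($) (\<chi> i. g i) = g"
  by (rule ext) simp

lemma Rep_unordered: "Rep_unordered_tuple (unordered p) = image_mset (\<lambda>i. p $ i) (mset_set UNIV)"
  unfolding unordered_def by (rule Abs_unordered_tuple_inverse) simp

lemma unordered_eq_iff: "unordered p = unordered q \<longleftrightarrow> (\<exists>s. s permutes UNIV \<and> p = permute_rows s q)"
proof
  assume "unordered p = unordered q"
  then have "image_mset (\<lambda>i. p $ i) (mset_set UNIV) = image_mset (\<lambda>i. q $ i) (mset_set UNIV)"
    using Rep_unordered by metis
  then obtain s where "s permutes UNIV" "\<forall>x\<in>UNIV. p $ x = q $ s x"
    using image_mset_eq_implies_permutes[OF finite] by metis
  then show "\<exists>s. s permutes UNIV \<and> p = permute_rows s q"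
    by (auto simp: permute_rows_def vec_eq_iff)
next
  assume "\<exists>s. s permutes UNIV \<and> p = permute_rows s q"
  then obtain s where s: "s permutes UNIV" and p: "p = permute_rows s q" by blast
  have "image_mset s (mset_set UNIV) = mset_set UNIV"
    using s image_mset_mset_set[of s UNIV] by (simp add: permutes_inj permutes_surj)
  then have "image_mset (\<lambda>i. q $ i) (image_mset s (mset_set UNIV))
      = image_mset (\<lambda>i. q $ i) (mset_set UNIV)" by simp
  then show "unordered p = unordered q"
    unfolding unordered_def p permute_rows_def by (simp add: vec_nth_lambda multiset.map_comp comp_def)
qed

lemma unordered_surj: "\<exists>p. unordered p = S"
proof -
  obtain xs where xs: "mset xs = Rep_unordered_tuple S" using ex_mset by blast
  then have len: "length xs = CARD('b)"
    using Rep_unordered_tuple[of S] by (metis (mono_tags) mem_Collect_eq size_mset)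
  obtain h :: "'b \<Rightarrow> nat" where h: "bij_betw h UNIV {0..<CARD('b)}"
    using ex_bij_betw_finite_nat[OF finite] by blast
  have "image_mset h (mset_set UNIV) = mset_set {0..<CARD('b)}"
    using h image_mset_mset_set[of h UNIV] by (auto simp: bij_betw_def)
  then have "image_mset (\<lambda>i. xs ! h i) (mset_set UNIV) = image_mset ((!) xs) (mset_set {0..<length xs})"
    using len by (metis (no_types, lifting) ext multiset.map_comp comp_apply)
  also have "\<dots> = mset xs"
    by (metis map_nth mset_map mset_upt)
  finally have "unordered (\<chi> i. xs ! h i) = S"
    unfolding unordered_def by (simp add: vec_nth_lambda xs Rep_unordered_tuple_inverse)
  then show ?thesis ..
qed

definition representative :: "('a, 'q::finite) unordered_tuple \<Rightarrow> 'a ^ 'q" where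
  "representative S = (SOME p. unordered p = S)"

lemma unordered_representative [simp]: "unordered (representative S) = S"
  unfolding representative_def using someI_ex[OF unordered_surj] .

instantiation unordered_tuple :: (metric_space, finite) metric_space
begin

definition dist_unordered_tuple :: "('a, 'b) unordered_tuple \<Rightarrow> ('a, 'b) unordered_tuple \<Rightarrow> real" where
  "dist_unordered_tuple S T =
     Min {sqrt (\<Sum>i\<in>UNIV. (dist (representative S $ i) (representative T $ s i))\<^sup>2) |s. s permutes UNIV}"

definition uniformity_unordered_tuple ::
    "(('a, 'b) unordered_tuple \<times> ('a, 'b) unordered_tuple) filter" where
  "uniformity_unordered_tuple = (INF e\<in>{0<..}. principal {(x, y). dist x y < e})"

definition open_unordered_tuple :: "('a, 'b) unordered_tuple set \<Rightarrow> bool" where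
  "open_unordered_tuple U \<longleftrightarrow> (\<forall>x\<in>U. \<forall>\<^sub>F (x', y) in uniformity. x' = x \<longrightarrow> y \<in> U)"

lemma dist_permute_rows:
  fixes p q :: "'a ^ 'b"
  shows "sqrt (\<Sum>i\<in>UNIV. (dist (p $ i) (q $ s i))\<^sup>2) = dist p (permute_rows s q)"
  by (simp add: dist_vec_def L2_set_def permute_rows_def)

lemma dist_permute_both:
  fixes p q :: "'a ^ 'b"
  shows "s permutes UNIV \<Longrightarrow> dist (permute_rows s p) (permute_rows s q) = dist p q"
  unfolding dist_vec_def L2_set_def permute_rows_def
  using sum.permute[of s UNIV "\<lambda>i. (dist (p $ i) (q $ i))\<^sup>2"] by (simp add: comp_def)

lemma dist_unordered_tuple_eq:
  fixes S T :: "('a, 'b) unordered_tuple"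
  shows "dist S T = Min ((\<lambda>s. dist (representative S) (permute_rows s (representative T))) ` {s. s permutes UNIV})"
  unfolding dist_unordered_tuple_def dist_permute_rows by (rule arg_cong[of _ _ Min]) auto

lemma finite_perms: "finite {s. s permutes (UNIV :: 'b set)}" "{s. s permutes (UNIV :: 'b set)} \<noteq> {}"
  using finite_permutations[OF finite, of "UNIV :: 'b set"] permutes_id[of UNIV] by blast+

lemma dist_unordered_le:
  fixes p q :: "'a ^ 'b"
  shows "dist (unordered p) (unordered q) \<le> dist p q"
proof -
  let ?S = "representative (unordered p)" and ?T = "representative (unordered q)"
  obtain s where s: "s permutes UNIV" "p = permute_rows s ?S"
    using unordered_eq_iff[of p ?S] by auto
  obtain t where t: "t permutes UNIV" "q = permute_rows t ?T"
    using unordered_eq_iff[of q ?T] by auto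
  have inv_s: "inv s permutes UNIV" using s(1) by (rule permutes_inv)
  have "permute_rows (inv s) p = ?S"
    unfolding arg_cong[OF s(2), of "permute_rows (inv s)"]
    using s(1) by (simp add: permute_rows_def permutes_inverses)
  moreover have "permute_rows (inv s) q = permute_rows (t \<circ> inv s) ?T"
    unfolding arg_cong[OF t(2), of "permute_rows (inv s)"] by (simp add: permute_rows_def)
  ultimately have "dist p q = dist ?S (permute_rows (t \<circ> inv s) ?T)"
    using dist_permute_both[OF inv_s, of p q] by simp
  moreover have "t \<circ> inv s permutes UNIV" using inv_s t(1) by (rule permutes_compose)
  ultimately show ?thesis
    unfolding dist_unordered_tuple_eq using finite_perms(1) by (intro Min_le) auto
qed

lemma dist_unordered_attained:
  fixes p q :: "'a ^ 'b"
  obtains s where "s permutes UNIV" "dist (unordered p) (unordered q) = dist p (permute_rows s q)"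
proof -
  let ?S = "representative (unordered p)" and ?T = "representative (unordered q)"
  have "dist (unordered p) (unordered q) \<in>
      (\<lambda>s. dist ?S (permute_rows s ?T)) ` {s. s permutes UNIV}"
    unfolding dist_unordered_tuple_eq using finite_perms by (intro Min_in) auto
  then obtain u where u: "u permutes UNIV"
    "dist (unordered p) (unordered q) = dist ?S (permute_rows u ?T)" by auto
  obtain s where s: "s permutes UNIV" "p = permute_rows s ?S"
    using unordered_eq_iff[of p ?S] by auto
  obtain t where t: "t permutes UNIV" "?T = permute_rows t q"
    using unordered_eq_iff[of ?T q] by auto
  have "dist (unordered p) (unordered q) = dist p (permute_rows s (permute_rows u (permute_rows t q)))"
    using u(2) dist_permute_both[OF s(1)] s(2) t(2) by metis
  moreover have "permute_rows s (permute_rows u (permute_rows t q)) = permute_rows (t \<circ> u \<circ> s) q"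
    by (simp add: permute_rows_def)
  moreover have "t \<circ> u \<circ> s permutes UNIV" using s(1) t(1) u(1) by (intro permutes_compose)
  ultimately show ?thesis using that by simp
qed

instance
proof
  fix x y z :: "('a, 'b) unordered_tuple"
  show "dist x y = 0 \<longleftrightarrow> x = y"
  proof
    assume 0: "dist x y = 0"
    obtain p q where p: "x = unordered p" "y = unordered q" using unordered_surj by metis
    obtain s where "s permutes UNIV" "dist x y = dist p (permute_rows s q)"
      using dist_unordered_attained[of p q] p by metis
    then show "x = y" using 0 p unordered_eq_iff by auto
  next
    assume "x = y"
    obtain p where p: "x = unordered p" using unordered_surj by metis
    obtain s where "dist x y = dist p (permute_rows s p)"
      using dist_unordered_attained[of p p] p \<open>x = y\<close> by metis
    then have "0 \<le> dist x y" by simp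
    then show "dist x y = 0" using dist_unordered_le[of p p] p \<open>x = y\<close> by simp
  qed
  show "dist x y \<le> dist x z + dist y z"
  proof -
    obtain p q r where p: "x = unordered p" "y = unordered q" "z = unordered r"
      using unordered_surj by metis
    obtain s where s: "s permutes UNIV" "dist x z = dist p (permute_rows s r)"
      using dist_unordered_attained[of p r] p by metis
    obtain t where t: "t permutes UNIV" "dist y z = dist q (permute_rows t r)"
      using dist_unordered_attained[of q r] p by metis
    define u where "u = inv t \<circ> s"
    have u: "u permutes UNIV" unfolding u_def using s(1) permutes_inv[OF t(1)] by (rule permutes_compose)
    have "permute_rows u (permute_rows t r) = permute_rows s r"
      using t(1) by (simp add: u_def permute_rows_def permutes_inverses)
    then have "dist y z = dist (permute_rows u q) (permute_rows s r)"
      using t(2) dist_permute_both[OF u] by metis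
    moreover have "unordered (permute_rows u q) = y" using p(2) u unordered_eq_iff by blast
    then have "dist x y \<le> dist p (permute_rows u q)"
      using dist_unordered_le[of p "permute_rows u q"] p(1) by simp
    ultimately show ?thesis using s(2) dist_triangle2[of p "permute_rows u q" "permute_rows s r"] by simp
  qed
qed (fact uniformity_unordered_tuple_def open_unordered_tuple_def)+

end

text \<open>The metric does not depend on the chosen representatives.\<close>

lemma dist_unordered:
  fixes p q :: "'a::metric_space ^ 'q::finite"
  shows "dist (unordered p) (unordered q) =
    Min {sqrt (\<Sum>i\<in>UNIV. (dist (p $ i) (q $ s i))\<^sup>2) |s. s permutes UNIV}"
proof -
  have eq: "{sqrt (\<Sum>i\<in>UNIV. (dist (p $ i) (q $ s i))\<^sup>2) |s. s permutes UNIV}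
      = (\<lambda>s. dist p (permute_rows s q)) ` {s. s permutes UNIV}"
    unfolding dist_permute_rows by auto
  obtain s where s: "s permutes UNIV" "dist (unordered p) (unordered q) = dist p (permute_rows s q)"
    by (rule dist_unordered_attained)
  have "dist (unordered p) (unordered q) \<le> dist p (permute_rows t q)" if "t permutes UNIV" for t
    using dist_unordered_le[of p "permute_rows t q"] unordered_eq_iff that by metis
  then show ?thesis
    unfolding eq using s finite_perms(1)[where 'b='q] by (intro Min_eqI[symmetric]) auto
qed

section \<open>Invariant polynomials\<close>

inductive_set generated_algebra :: "('a \<Rightarrow> real) set \<Rightarrow> ('a \<Rightarrow> real) set" for G where
  generator: "g \<in> G \<Longrightarrow> g \<in> generated_algebra G"
| const: "(\<lambda>_. c) \<in> generated_algebra G"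
| add: "\<lbrakk>g \<in> generated_algebra G; h \<in> generated_algebra G\<rbrakk> \<Longrightarrow> (\<lambda>x. g x + h x) \<in> generated_algebra G"
| mult: "\<lbrakk>g \<in> generated_algebra G; h \<in> generated_algebra G\<rbrakk> \<Longrightarrow> (\<lambda>x. g x * h x) \<in> generated_algebra G"

text \<open>Polynomials on a real vector space are identified with polynomial functions, as the
  field is infinite.\<close>

definition invariant_polynomials :: "(real ^ 'n ^ 'q::finite \<Rightarrow> real) set" where
  "invariant_polynomials =
     {g. real_polynomial_function g \<and> (\<forall>s w. s permutes UNIV \<longrightarrow> g (permute_rows s w) = g w)}"

definition homogeneous_polynomial :: "nat \<Rightarrow> ('a::real_normed_vector \<Rightarrow> real) \<Rightarrow> bool" where
  "homogeneous_polynomial k g \<longleftrightarrow>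
     real_polynomial_function g \<and> (\<forall>t w. g (t *\<^sub>R w) = t ^ k * g w)"

definition homogeneous_generators :: "(real ^ 'n ^ 'q::finite \<Rightarrow> real ^ 'r) \<Rightarrow> ('r \<Rightarrow> nat) \<Rightarrow> bool" where
  "homogeneous_generators \<sigma> d \<longleftrightarrow>
     (\<forall>j. homogeneous_polynomial (d j) (\<lambda>w. \<sigma> w $ j)) \<and>
     generated_algebra (range (\<lambda>j w. \<sigma> w $ j)) = invariant_polynomials"

section \<open>Differentiability classes\<close>

definition partial :: "'m \<Rightarrow> (real ^ 'm::finite \<Rightarrow> real) \<Rightarrow> real ^ 'm \<Rightarrow> real" where
  "partial j u x = deriv (\<lambda>t. u (x + t *\<^sub>R axis j 1)) 0"

text \<open>Iterated partial derivatives are indexed by lists of directions. On functions of class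
  \<open>C\<^sup>k\<close> and lists of length at most \<open>k\<close> they only depend on the multi-index counting the
  occurrences of each direction.\<close>

definition partials :: "'m list \<Rightarrow> (real ^ 'm::finite \<Rightarrow> real) \<Rightarrow> real ^ 'm \<Rightarrow> real" where
  "partials js = foldr partial js"

definition Ck_on :: "nat \<Rightarrow> (real ^ 'm::finite) set \<Rightarrow> (real ^ 'm \<Rightarrow> real) \<Rightarrow> bool" where
  "Ck_on k \<Omega> u \<longleftrightarrow>
     (\<forall>js. length js < k \<longrightarrow>
        (\<forall>j. \<forall>x\<in>\<Omega>. (\<lambda>t. partials js u (x + t *\<^sub>R axis j 1)) differentiable at 0)) \<and>
     (\<forall>js. length js \<le> k \<longrightarrow> continuous_on \<Omega> (partials js u))"

definition Ck1_closure :: "nat \<Rightarrow> (real ^ 'm::finite) set \<Rightarrow> (real ^ 'm \<Rightarrow> real) \<Rightarrow> bool" where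
  "Ck1_closure k \<Omega> u \<longleftrightarrow> Ck_on k \<Omega> u \<and>
     (\<forall>js. length js \<le> k \<longrightarrow>
        (\<exists>v. continuous_on (closure \<Omega>) v \<and> (\<forall>x\<in>\<Omega>. v x = partials js u x)) \<and>
        (\<exists>L. L-lipschitz_on \<Omega> (partials js u)))"

text \<open>Inserting \<open>0\<close> only serves to give the suprema the value \<open>0\<close> when they range over the empty set.\<close>

definition sup_norm_on :: "(real ^ 'm::finite) set \<Rightarrow> (real ^ 'm \<Rightarrow> real) \<Rightarrow> real" where
  "sup_norm_on \<Omega> u = Sup (insert 0 ((\<lambda>x. \<bar>u x\<bar>) ` \<Omega>))"

definition Lip_on :: "(real ^ 'm::finite) set \<Rightarrow> (real ^ 'm \<Rightarrow> real) \<Rightarrow> real" where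
  "Lip_on \<Omega> u = Sup (insert 0 {dist (u x) (u y) / dist x y |x y. x \<in> \<Omega> \<and> y \<in> \<Omega> \<and> x \<noteq> y})"

definition Ck1_norm :: "nat \<Rightarrow> (real ^ 'm::finite) set \<Rightarrow> (real ^ 'm \<Rightarrow> real) \<Rightarrow> real" where
  "Ck1_norm k \<Omega> u =
     Max {sup_norm_on \<Omega> (partials js u) |js. length js \<le> k} +
     Max {Lip_on \<Omega> (partials js u) |js. length js = k}"

section \<open>Sobolev spaces\<close>

definition test_function :: "(real ^ 'm::finite) set \<Rightarrow> (real ^ 'm \<Rightarrow> real) \<Rightarrow> bool" where
  "test_function \<Omega> \<phi> \<longleftrightarrow> (\<forall>k. Ck_on k UNIV \<phi>) \<and>
     compact (closure {x. \<phi> x \<noteq> 0}) \<and> closure {x. \<phi> x \<noteq> 0} \<subseteq> \<Omega>"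

definition locally_integrable :: "(real ^ 'm::finite) set \<Rightarrow> (real ^ 'm \<Rightarrow> real) \<Rightarrow> bool" where
  "locally_integrable \<Omega> u \<longleftrightarrow> (\<forall>K. compact K \<and> K \<subseteq> \<Omega> \<longrightarrow> integrable (lebesgue_on K) u)"

definition weak_partial ::
    "(real ^ 'm::finite) set \<Rightarrow> 'm \<Rightarrow> (real ^ 'm \<Rightarrow> real) \<Rightarrow> (real ^ 'm \<Rightarrow> real) \<Rightarrow> bool" where
  "weak_partial \<Omega> j u v \<longleftrightarrow> locally_integrable \<Omega> u \<and> locally_integrable \<Omega> v \<and>
     (\<forall>\<phi>. test_function \<Omega> \<phi> \<longrightarrow>
        (LINT x|lebesgue_on \<Omega>. u x * partial j \<phi> x) = - (LINT x|lebesgue_on \<Omega>. v x * \<phi> x))"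

definition Linf_norm :: "(real ^ 'm::finite) set \<Rightarrow> (real ^ 'm \<Rightarrow> real) \<Rightarrow> ennreal" where
  "Linf_norm \<Omega> u = esssup (lebesgue_on \<Omega>) (\<lambda>x. ennreal \<bar>u x\<bar>)"

definition Linf :: "(real ^ 'm::finite) set \<Rightarrow> (real ^ 'm \<Rightarrow> real) set" where
  "Linf \<Omega> = {u. u \<in> borel_measurable (lebesgue_on \<Omega>) \<and> Linf_norm \<Omega> u < \<infinity>}"

definition W1inf_real :: "(real ^ 'm::finite) set \<Rightarrow> (real ^ 'm \<Rightarrow> real) set" where
  "W1inf_real \<Omega> = {u \<in> Linf \<Omega>. \<forall>j. \<exists>v \<in> Linf \<Omega>. weak_partial \<Omega> j u v}"

text \<open>Weak derivatives are unique almost everywhere, so the choice of \<open>v\<close> is immaterial.\<close>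

definition partial_bound ::
    "(real ^ 'm::finite) set \<Rightarrow> 'm \<Rightarrow> (real ^ 'm \<Rightarrow> 'a::metric_space) \<Rightarrow> (real ^ 'm \<Rightarrow> real) \<Rightarrow> bool" where
  "partial_bound \<Omega> j f \<phi> \<longleftrightarrow> \<phi> \<in> Linf \<Omega> \<and> (\<forall>x\<in>\<Omega>. 0 \<le> \<phi> x) \<and>
     (\<forall>P v. weak_partial \<Omega> j (\<lambda>x. dist (f x) P) v \<longrightarrow> (AE x in lebesgue_on \<Omega>. \<bar>v x\<bar> \<le> \<phi> x))"

definition W1inf :: "(real ^ 'm::finite) set \<Rightarrow> (real ^ 'm \<Rightarrow> 'a::metric_space) set" where
  "W1inf \<Omega> = {f. f \<in> borel_measurable (lebesgue_on \<Omega>) \<and>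
     (\<forall>P. (\<lambda>x. dist (f x) P) \<in> W1inf_real \<Omega>) \<and> (\<forall>j. \<exists>\<phi>. partial_bound \<Omega> j f \<phi>)}"

definition metric_partial ::
    "(real ^ 'm::finite) set \<Rightarrow> 'm \<Rightarrow> (real ^ 'm \<Rightarrow> 'a::metric_space) \<Rightarrow> real ^ 'm \<Rightarrow> real" where
  "metric_partial \<Omega> j f = (SOME \<phi>. partial_bound \<Omega> j f \<phi> \<and>
     (\<forall>\<psi>. partial_bound \<Omega> j f \<psi> \<longrightarrow> (AE x in lebesgue_on \<Omega>. \<phi> x \<le> \<psi> x)))"

definition metric_gradient ::
    "(real ^ 'm::finite) set \<Rightarrow> (real ^ 'm \<Rightarrow> 'a::metric_space) \<Rightarrow> real ^ 'm \<Rightarrow> real" where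
  "metric_gradient \<Omega> f x = sqrt (\<Sum>j\<in>UNIV. (metric_partial \<Omega> j f x)\<^sup>2)"

end

theory Submission
  imports Defs
begin

text \<open>Let \<open>\<rho>\<^sub>0 \<le> \<dots> \<le> \<rho>\<^sub>Q\<^sub>-\<^sub>1\<close> be the sorted values of one coordinate of \<open>f\<close> along a line parallel to an axis.
  They are the roots of a polynomial whose coefficients are invariant, hence polynomials in the
  components of \<open>\<Sigma> \<circ> f\<close>, and of class \<open>C\<^sup>Q\<^sup>-\<^sup>1\<^sup>,\<^sup>1\<close>. So Bronshtein's theorem bounds their slopes, and since \<open>f\<close> is
  continuous this bounds the slope of \<open>f\<close> itself. Dividing \<open>f\<close> by
  \<open>1 + max\<^sub>j \<parallel>\<Sigma>\<^sub>j \<circ> f\<parallel>\<^bsup>1/d\<^sub>j\<^esup>\<close> makes all norms at most \<open>1\<close>, so by homogeneity a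
  uniform constant suffices.

  Bronshtein's theorem is proved by induction on the degree. If the variance \<open>r\<^sup>2\<close> of the roots at \<open>0\<close> vanishes, it is
  \<open>O(t\<^sup>2)\<close> because it is nonnegative with bounded second differences. Otherwise zooming in by the factor
  \<open>r\<close> in space and in time keeps the coefficients bounded and opens a gap between the roots, so that the polynomial splits
  into factors of smaller degree. Regularity is measured by divided differences: the Leibniz rule turns a
  factorization into a Bezout equation for the divided differences of the factors, and the gap bounds its solution.\<close>

section \<open>Divided differences\<close>

text \<open>Sorted coordinates forget which coordinates belong to the same point: the tuples
  {(0,0),(1,1)} and {(0,1),(1,0)} have the same ones. So slope bounds for all sorted coordinates do
  not bound the distance of tuples; continuity of \<open>f\<close> has to select the matching that
  is close to the base point.

  The zoom succeeds because the second difference estimate keeps the spread of the roots comparable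
  to \<open>r\<close> during a time of order \<open>r\<close>. Under it the differences of order n
  of the coefficients gain the n-th power of the time scale and lose at most the n-th power of
  \<open>r\<close>. Lower orders would blow up; they are recovered from the top order and the sup
  bound.

  The scale \<open>r\<close> depends on the base point, so the induction can only give a slope at
  one point, on a neighbourhood of uncontrolled size. Since this holds at every point of a segment
  with the same constant, subdivision turns it into a Lipschitz bound.

  Divided differences are used because they see a Lipschitz top derivative without differentiating
  it and obey an exact product rule.\<close>

definition dd :: "(real \<Rightarrow> real) \<Rightarrow> real set \<Rightarrow> real" where
  "dd u S = (\<Sum>x\<in>S. u x / (\<Prod>y\<in>S - {x}. x - y))"

lemma dd_singleton [simp]: "dd u {x} = u x"
  by (simp add: dd_def)

lemma dd_add: "dd (\<lambda>t. u t + v t) S = dd u S + dd v S"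
  by (simp add: dd_def add_divide_distrib sum.distrib)

lemma dd_cmult: "dd (\<lambda>t. c * u t) S = c * dd u S"
  by (simp add: dd_def sum_distrib_left)

lemma dd_cong: "(\<And>x. x \<in> S \<Longrightarrow> u x = v x) \<Longrightarrow> dd u S = dd v S"
  by (simp add: dd_def)

lemma dd_insert:
  assumes "finite S" "a \<notin> S"
  shows "dd u (insert a S) = u a / (\<Prod>y\<in>S. a - y) + (\<Sum>x\<in>S. u x / ((x - a) * (\<Prod>y\<in>S - {x}. x - y)))"
proof -
  have "(\<Prod>y\<in>insert a S - {x}. x - y) = (x - a) * (\<Prod>y\<in>S - {x}. x - y)" if "x \<in> S" for x
  proof -
    have "insert a S - {x} = insert a (S - {x})" using that assms by auto
    then show ?thesis using assms that by simp
  qed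
  moreover have "insert a S - {a} = S" using assms by auto
  ultimately show ?thesis
    unfolding dd_def using assms by simp
qed

text \<open>\<open>dd\<close> is the Lagrange form of a divided difference, and this is its
  recursion. At each common node it is the partial fraction identity (a - b) / ((x - a)(x - b)) = 1
  / (x - a) - 1 / (x - b).\<close>

lemma dd_step:
  assumes S: "finite S" "a \<notin> S" "b \<notin> S" "a \<noteq> b"
  shows "(a - b) * dd u (insert a (insert b S)) = dd u (insert a S) - dd u (insert b S)"
proof -
  let ?p = "\<lambda>x. \<Prod>y\<in>S - {x}. x - y"
  have "dd u (insert a (insert b S)) = u a / ((a - b) * (\<Prod>y\<in>S. a - y)) +
     (u b / ((b - a) * (\<Prod>y\<in>S. b - y)) + (\<Sum>x\<in>S. u x / ((x - a) * ((x - b) * ?p x))))"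
  proof -
    have "(\<Prod>y\<in>insert b S - {x}. x - y) = (x - b) * ?p x" if "x \<in> S" for x
    proof -
      have "insert b S - {x} = insert b (S - {x})" using that S by auto
      then show ?thesis using S that by simp
    qed
    moreover have "insert b S - {b} = S" using S by auto
    moreover have "a \<notin> insert b S" using S by auto
    ultimately show ?thesis
      using S by (simp add: dd_insert[of "insert b S" a])
  qed
  then have "(a - b) * dd u (insert a (insert b S)) = u a / (\<Prod>y\<in>S. a - y) - u b / (\<Prod>y\<in>S. b - y)
      + (a - b) * (\<Sum>x\<in>S. u x / ((x - a) * ((x - b) * ?p x)))"
    using S(4) by (simp add: distrib_left divide_simps) (simp add: field_simps)
  also have "(a - b) * (\<Sum>x\<in>S. u x / ((x - a) * ((x - b) * ?p x))) =
      (\<Sum>x\<in>S. u x / ((x - a) * ?p x) - u x / ((x - b) * ?p x))"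
    unfolding sum_distrib_left
  proof (rule sum.cong[OF refl])
    fix x assume "x \<in> S"
    then have ne: "x - a \<noteq> 0" "x - b \<noteq> 0" using S by auto
    have "?p x \<noteq> 0" using S(1) by auto
    with ne show "(a - b) * (u x / ((x - a) * ((x - b) * ?p x))) =
        u x / ((x - a) * ?p x) - u x / ((x - b) * ?p x)"
      by (simp add: divide_simps) (simp add: algebra_simps)
  qed
  finally show ?thesis
    using S by (simp add: dd_insert sum_subtractf)
qed

lemma dd_pair: "a \<noteq> b \<Longrightarrow> dd u {a, b} = (u a - u b) / (a - b)"
  using dd_step[of "{}" a b u] by (simp add: field_simps)

lemma dd_const:
  assumes "finite S" "2 \<le> card S" shows "dd (\<lambda>_. c) S = 0"
proof -
  have "\<forall>S. finite S \<longrightarrow> card S = Suc (Suc k) \<longrightarrow> dd (\<lambda>_. c) S = 0" for k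
  proof (induction k)
    case 0
    show ?case
    proof (intro allI impI)
      fix S :: "real set" assume "finite S" "card S = Suc (Suc 0)"
      then obtain a b where "S = {a, b}" "a \<noteq> b" by (auto simp: card_Suc_eq)
      then show "dd (\<lambda>_. c) S = 0" by (simp add: dd_pair)
    qed
  next
    case (Suc k)
    show ?case
    proof (intro allI impI)
      fix S :: "real set" assume S: "finite S" "card S = Suc (Suc (Suc k))"
      then obtain a R where R: "S = insert a R" "a \<notin> R" "card R = Suc (Suc k)"
        by (metis card_Suc_eq)
      then obtain b T where "R = insert b T" "b \<notin> T" "card T = Suc k"
        by (metis card_Suc_eq)
      with R have T: "S = insert a (insert b T)" "a \<noteq> b" "a \<notin> T" "b \<notin> T" "card T = Suc k"
        by auto
      then have "finite T" using S by auto
      then have "dd (\<lambda>_. c) (insert a T) = 0" "dd (\<lambda>_. c) (insert b T) = 0"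
        using Suc T by auto
      then have "(a - b) * dd (\<lambda>_. c) S = 0"
        using dd_step[OF \<open>finite T\<close> T(3,4,2)] T by simp
      then show "dd (\<lambda>_. c) S = 0" using T by simp
    qed
  qed
  from this[of "card S - 2"] assms show ?thesis by simp
qed

text \<open>The summand of the node \<open>a\<close> vanishes, and in the others the factor
  \<open>x - a\<close> cancels what the extra node adds to the denominator. This lowers the order by
  one in \<open>dd_bound_integrate\<close>.\<close>

lemma dd_mult_root:
  assumes "finite S" "a \<notin> S"
  shows "dd (\<lambda>s. (s - a) * u s) (insert a S) = dd u S"
proof -
  have "(x - a) * u x / ((x - a) * (\<Prod>y\<in>S - {x}. x - y)) = u x / (\<Prod>y\<in>S - {x}. x - y)" if "x \<in> S" for x
    using that assms by auto
  then have "(\<Sum>x\<in>S. (x - a) * u x / ((x - a) * (\<Prod>y\<in>S - {x}. x - y))) = dd u S"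
    unfolding dd_def by (rule sum.cong[OF refl])
  then show ?thesis
    unfolding dd_insert[OF assms] by simp
qed

text \<open>Each denominator is a product of card S - 1 node differences, and each of them scales by
  \<theta>. These powers of \<theta> are what a zoom in the parameter gains.\<close>

lemma dd_affine:
  assumes "finite S" "\<theta> \<noteq> 0"
  shows "dd (\<lambda>s. u (a + \<theta> * s)) S = \<theta> ^ (card S - 1) * dd u ((\<lambda>s. a + \<theta> * s) ` S)"
proof -
  have inj: "inj_on (\<lambda>s. a + \<theta> * s) X" for X
    using assms by (auto simp: inj_on_def)
  have "(\<Prod>y\<in>(\<lambda>s. a + \<theta> * s) ` S - {a + \<theta> * x}. a + \<theta> * x - y) = \<theta> ^ (card S - 1) * (\<Prod>y\<in>S - {x}. x - y)"
    if "x \<in> S" for x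
  proof -
    have "(\<lambda>s. a + \<theta> * s) ` S - {a + \<theta> * x} = (\<lambda>s. a + \<theta> * s) ` (S - {x})"
      using assms by auto
    then have "(\<Prod>y\<in>(\<lambda>s. a + \<theta> * s) ` S - {a + \<theta> * x}. a + \<theta> * x - y) = (\<Prod>y\<in>S - {x}. \<theta> * (x - y))"
      by (simp add: prod.reindex[OF inj] right_diff_distrib)
    also have "\<dots> = \<theta> ^ (card S - 1) * (\<Prod>y\<in>S - {x}. x - y)"
      using that assms by (simp add: prod.distrib card_Diff_singleton)
    finally show ?thesis .
  qed
  then show ?thesis
    unfolding dd_def using assms by (simp add: sum.reindex[OF inj] sum_distrib_left)
qed

text \<open>The splitting into initial and final segments depends on an order of the nodes, so they
  are given as an injective sequence. The induction multiplies by the distance of the extreme nodes,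
  which makes the recursion applicable to both sides.\<close>

lemma dd_Leibniz:
  fixes x :: "nat \<Rightarrow> real"
  assumes "inj_on x {i..i+k}"
  shows "dd (\<lambda>t. u t * v t) (x ` {i..i+k}) = (\<Sum>l\<le>k. dd u (x ` {i..i+l}) * dd v (x ` {i+l..i+k}))"
  using assms
proof (induction k arbitrary: i)
  case 0
  then show ?case by simp
next
  case (Suc k i)
  have rec: "(x (i + Suc l) - x j) * dd w (x ` {j..i + Suc l}) = dd w (x ` {Suc j..i + Suc l}) - dd w (x ` {j..i + l})"
    if "i \<le> j" "j \<le> i + l" "l \<le> k" for w l j
  proof -
    let ?T = "x ` {Suc j..i + l}"
    have notin: "x p \<notin> x ` B" if "B \<subseteq> {i..i + Suc k}" "p \<in> {i..i+Suc k}" "p \<notin> B" for p B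
      using inj_onD[OF Suc.prems] that by blast
    have "x j \<notin> ?T" "x (i + Suc l) \<notin> ?T"
      using that by (intro notin; auto)+
    moreover have "x (i + Suc l) \<noteq> x j"
      using inj_onD[OF Suc.prems, of "i + Suc l" j] that by auto
    moreover have "x ` {j..i + Suc l} = insert (x (i + Suc l)) (insert (x j) ?T)"
    proof -
      have "{j..i + Suc l} = insert (i + Suc l) (insert j {Suc j..i+l})" using that by auto
      then show ?thesis by (metis image_insert)
    qed
    moreover have "x ` {Suc j..i + Suc l} = insert (x (i + Suc l)) ?T"
    proof -
      have "{Suc j..i + Suc l} = insert (i + Suc l) {Suc j..i+l}" using that by auto
      then show ?thesis by (metis image_insert)
    qed
    moreover have "x ` {j..i + l} = insert (x j) ?T"
    proof -
      have "{j..i + l} = insert j {Suc j..i+l}" using that by auto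
      then show ?thesis by (metis image_insert)
    qed
    ultimately show ?thesis using dd_step[of ?T "x (i + Suc l)" "x j" w] by simp
  qed
  have ne: "x (i + Suc k) - x i \<noteq> 0"
    using inj_onD[OF Suc.prems, of "i + Suc k" i] by auto
  define U where "U l = dd u (x ` {i..i+l})" for l
  define U' where "U' l = dd u (x ` {Suc i..Suc i+l})" for l
  define V where "V l = dd v (x ` {i+l..i+k})" for l
  define V' where "V' l = dd v (x ` {i+l..i+Suc k})" for l
  have U: "(x (i + Suc l) - x i) * U (Suc l) = U' l - U l" if "l \<le> k" for l
    using rec[of i l u] that by (simp add: U_def U'_def)
  have V: "(x (i + Suc k) - x (i + l)) * V' l = V' (Suc l) - V l" if "l \<le> k" for l
    using rec[of "i + l" k v] that by (simp add: V_def V'_def)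
  have "(x (i + Suc k) - x i) * dd (\<lambda>t. u t * v t) (x ` {i..i+Suc k}) =
    dd (\<lambda>t. u t * v t) (x ` {Suc i..Suc i+k}) - dd (\<lambda>t. u t * v t) (x ` {i..i+k})"
    using rec[of i k] by simp
  also have "dd (\<lambda>t. u t * v t) (x ` {Suc i..Suc i+k}) = (\<Sum>l\<le>k. U' l * V' (Suc l))"
    using Suc.IH[of "Suc i"] inj_on_subset[OF Suc.prems, of "{Suc i..Suc i+k}"] by (auto simp: U'_def V'_def)
  also have "dd (\<lambda>t. u t * v t) (x ` {i..i+k}) = (\<Sum>l\<le>k. U l * V l)"
    using Suc.IH[of i] inj_on_subset[OF Suc.prems, of "{i..i+k}"] by (auto simp: U_def V_def)
  \<comment> \<open>A discrete product rule: the increments of \<open>U\<close> and of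
    \<open>V\<close> are separated, and the recursion turns each into a difference of one order
    more.\<close>
  also have "(\<Sum>l\<le>k. U' l * V' (Suc l)) - (\<Sum>l\<le>k. U l * V l) =
     (\<Sum>l\<le>k. (U' l - U l) * V' (Suc l)) + (\<Sum>l\<le>k. U l * (V' (Suc l) - V l))"
    by (simp add: sum_subtractf[symmetric] sum.distrib[symmetric] algebra_simps)
  also have "\<dots> = (\<Sum>l\<le>k. (x (i + Suc l) - x i) * U (Suc l) * V' (Suc l)) +
      (\<Sum>l\<le>k. (x (i + Suc k) - x (i + l)) * U l * V' l)"
    using U V by (simp add: mult.assoc mult.left_commute)
  also have "(\<Sum>l\<le>k. (x (i + Suc l) - x i) * U (Suc l) * V' (Suc l)) =
      (\<Sum>l\<le>Suc k. (x (i + l) - x i) * U l * V' l)"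
    by (simp add: sum.atMost_Suc_shift del: sum.atMost_Suc)
  also have "(\<Sum>l\<le>k. (x (i + Suc k) - x (i + l)) * U l * V' l) =
      (\<Sum>l\<le>Suc k. (x (i + Suc k) - x (i + l)) * U l * V' l)"
    by simp
  \<comment> \<open>For every \<open>l\<close> the two weights add up to the distance of the extreme
    nodes.\<close>
  also have "(\<Sum>l\<le>Suc k. (x (i + l) - x i) * U l * V' l) + \<dots> = (x (i + Suc k) - x i) * (\<Sum>l\<le>Suc k. U l * V' l)"
    unfolding sum.distrib[symmetric] sum_distrib_left by (intro sum.cong) (auto simp: algebra_simps)
  finally show ?case using ne by (simp add: U_def V'_def del: sum.atMost_Suc)
qed


text \<open>The inductive step of the Hermite-Genocchi formula, with the mean value theorem in place
  of the integral. Contracting the nodes by \<theta> towards one of them, \<open>c\<close>, connects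
  a constant function, whose difference is 0, with \<open>h\<close>. The derivative in \<theta>
  carries the factor \<open>s - c\<close>, which removes the node \<open>c\<close>, and the
  contraction of the others contributes only \<theta>^k, at most 1.\<close>

lemma dd_bound_integrate:
  assumes S: "finite S" "S \<subseteq> {a..b}" "card S = Suc (Suc k)"
    and deriv: "\<And>t. t \<in> {a..b} \<Longrightarrow> (h has_real_derivative h' t) (at t within {a..b})"
    and bound: "\<And>T. finite T \<Longrightarrow> T \<subseteq> {a..b} \<Longrightarrow> card T = Suc k \<Longrightarrow> \<bar>dd h' T\<bar> \<le> M"
  shows "\<bar>dd h S\<bar> \<le> M"
proof -
  obtain c T where T: "S = insert c T" "c \<notin> T" "card T = Suc k"
    using S(3) by (metis card_Suc_eq)
  have fin: "finite T" using S T by simp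
  have M: "0 \<le> M" using bound[of T] T S fin by fastforce
  define w where "w \<theta> = dd (\<lambda>s. h (c + \<theta> * (s - c))) S" for \<theta>
  define w' where "w' \<theta> = dd (\<lambda>s. (s - c) * h' (c + \<theta> * (s - c))) S" for \<theta>
  have mem: "c + \<theta> * (s - c) \<in> {a..b}" if "s \<in> S" "\<theta> \<in> {0..1}" for s \<theta>
  proof -
    have "c \<in> {a..b}" "s \<in> {a..b}" using S T that by auto
    then have "(1 - \<theta>) *\<^sub>R c + \<theta> *\<^sub>R s \<in> {a..b}"
      using that by (intro convexD[OF convex_real_interval(5)]) auto
    then show ?thesis by (simp add: algebra_simps)
  qed
  have dw: "(w has_real_derivative w' \<theta>) (at \<theta> within {0..1})" if "\<theta> \<in> {0..1}" for \<theta>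
    unfolding w_def w'_def dd_def
  proof (rule DERIV_sum, rule DERIV_cdivide)
    fix s assume "s \<in> S"
    show "((\<lambda>\<theta>. h (c + \<theta> * (s - c))) has_real_derivative (s - c) * h' (c + \<theta> * (s - c))) (at \<theta> within {0..1})"
    proof -
      have "((\<lambda>\<theta>. c + \<theta> * (s - c)) has_real_derivative (s - c)) (at \<theta> within {0..1})"
        by (auto intro!: derivative_eq_intros)
      moreover have "(h has_real_derivative h' (c + \<theta> * (s - c)))
          (at (c + \<theta> * (s - c)) within (\<lambda>\<theta>. c + \<theta> * (s - c)) ` {0..1})"
        by (rule has_field_derivative_subset[OF deriv[OF mem[OF \<open>s \<in> S\<close> that]]])
          (use mem[OF \<open>s \<in> S\<close>] in auto)
      ultimately show ?thesis
        using DERIV_image_chain[of h "h' (c + \<theta> * (s - c))" "\<lambda>\<theta>. c + \<theta> * (s - c)" \<theta> "{0..1}" "s - c"]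
        unfolding o_def mult.commute[of "s - c" "h' (c + \<theta> * (s - c))"] by blast
    qed
  qed
  have bw': "\<bar>w' \<theta>\<bar> \<le> M" if "0 < \<theta>" "\<theta> < 1" for \<theta>
  proof -
    have "w' \<theta> = dd (\<lambda>s. h' (c + \<theta> * (s - c))) T"
      unfolding w'_def T(1) by (rule dd_mult_root[OF fin T(2)])
    also have "(\<lambda>s. h' (c + \<theta> * (s - c))) = (\<lambda>s. h' ((c - \<theta> * c) + \<theta> * s))"
      by (simp add: right_diff_distrib add_diff_eq diff_add_eq)
    also have "dd (\<lambda>s. h' ((c - \<theta> * c) + \<theta> * s)) T = \<theta> ^ k * dd h' ((\<lambda>s. (c - \<theta> * c) + \<theta> * s) ` T)"
      using that dd_affine[OF fin, of \<theta> h' "c - \<theta> * c"] T(3) by simp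
    finally have eq: "w' \<theta> = \<theta> ^ k * dd h' ((\<lambda>s. (c - \<theta> * c) + \<theta> * s) ` T)" .
    have "\<bar>dd h' ((\<lambda>s. (c - \<theta> * c) + \<theta> * s) ` T)\<bar> \<le> M"
    proof (rule bound)
      show "(\<lambda>s. c - \<theta> * c + \<theta> * s) ` T \<subseteq> {a..b}"
      proof (rule image_subsetI)
        fix s assume "s \<in> T"
        then have "c + \<theta> * (s - c) \<in> {a..b}"
          using mem[of s \<theta>] T that by simp
        then show "c - \<theta> * c + \<theta> * s \<in> {a..b}" by (simp add: algebra_simps)
      qed
      have "inj_on (\<lambda>s. c - \<theta> * c + \<theta> * s) T" using that by (auto simp: inj_on_def)
      then show "card ((\<lambda>s. c - \<theta> * c + \<theta> * s) ` T) = Suc k" using T by (simp add: card_image)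
    qed (use fin in auto)
    moreover have "\<theta> ^ k \<le> 1" using that by (simp add: power_le_one)
    ultimately show ?thesis
      using that mult_mono[of "\<theta> ^ k" 1 "\<bar>dd h' ((\<lambda>s. (c - \<theta> * c) + \<theta> * s) ` T)\<bar>" M]
      unfolding eq abs_mult by simp
  qed
  have "\<exists>z\<in>{0<..<1}. w 1 - w 0 = w' z * (1 - 0)"
    by (rule mvt_simple) (use dw in \<open>auto simp: has_field_derivative_def\<close>)
  then have "\<bar>w 1 - w 0\<bar> \<le> M" using bw' by auto
  moreover have "w 1 = dd h S" by (simp add: w_def)
  moreover have "w 0 = 0" using S by (simp add: w_def dd_const)
  ultimately show ?thesis by simp
qed

text \<open>A substitute for a C^(K-1,1) norm on [-1,1]: differences of order at most K use at most
  K + 1 nodes. The interval is fixed because slopes are always sought at 0 and other segments are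
  brought here by scaling.\<close>

definition dd_bounded :: "nat \<Rightarrow> real \<Rightarrow> (real \<Rightarrow> real) \<Rightarrow> bool" where
  "dd_bounded K A u \<longleftrightarrow> (\<forall>S. S \<subseteq> {-1..1} \<and> S \<noteq> {} \<and> finite S \<and> card S \<le> Suc K \<longrightarrow> \<bar>dd u S\<bar> \<le> A)"

lemma dd_boundedD: "dd_bounded K A u \<Longrightarrow> S \<subseteq> {-1..1} \<Longrightarrow> S \<noteq> {} \<Longrightarrow> finite S \<Longrightarrow> card S \<le> Suc K \<Longrightarrow> \<bar>dd u S\<bar> \<le> A"
  by (auto simp: dd_bounded_def)

lemma dd_bounded_value: "dd_bounded K A u \<Longrightarrow> t \<in> {-1..1} \<Longrightarrow> \<bar>u t\<bar> \<le> A"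
  using dd_boundedD[of K A u "{t}"] by simp

lemma dd_bounded_nonneg: "dd_bounded K A u \<Longrightarrow> 0 \<le> A"
  using dd_bounded_value[of K A u 0] by (simp add: order.trans[OF abs_ge_zero])

lemma dd_bounded_Lipschitz:
  assumes "dd_bounded K A u" "1 \<le> K" "s \<in> {-1..1}" "t \<in> {-1..1}"
  shows "\<bar>u s - u t\<bar> \<le> A * \<bar>s - t\<bar>"
proof (cases "s = t")
  case False
  then have "\<bar>dd u {s, t}\<bar> \<le> A" using assms by (intro dd_boundedD[of K]) auto
  then show ?thesis using False by (simp add: dd_pair divide_le_eq)
qed simp

lemma dd_bounded_mono: "dd_bounded K A u \<Longrightarrow> k \<le> K \<Longrightarrow> A \<le> B \<Longrightarrow> dd_bounded k B u"
  unfolding dd_bounded_def by (meson Suc_le_mono order.trans)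

lemma dd_bounded_const: "dd_bounded K \<bar>c\<bar> (\<lambda>_. c)"
  unfolding dd_bounded_def
proof (intro allI impI, elim conjE)
  fix S :: "real set" assume "S \<noteq> {}" "finite S"
  then consider a where "S = {a}" | "2 \<le> card S"
    by (metis One_nat_def Suc_leI card_1_singletonE card_gt_0_iff le_neq_implies_less numeral_2_eq_2)
  then show "\<bar>dd (\<lambda>_. c) S\<bar> \<le> \<bar>c\<bar>"
    using \<open>finite S\<close> by cases (auto simp: dd_const)
qed

lemma dd_bounded_add:
  "dd_bounded K A u \<Longrightarrow> dd_bounded K B v \<Longrightarrow> dd_bounded K (A + B) (\<lambda>t. u t + v t)"
  unfolding dd_bounded_def dd_add by (intro allI impI order.trans[OF abs_triangle_ineq] add_mono) auto

lemma dd_bounded_cmult: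
  "dd_bounded K A u \<Longrightarrow> dd_bounded K (\<bar>c\<bar> * A) (\<lambda>t. c * u t)"
  unfolding dd_bounded_def dd_cmult abs_mult by (intro allI impI mult_left_mono) auto

lemma finite_set_enum:
  assumes "finite (S :: real set)" "card S = Suc k"
  obtains x :: "nat \<Rightarrow> real" where "inj_on x {0..k}" "S = x ` {0..k}"
proof -
  have "\<exists>x. bij_betw x {0..<Suc k} S"
    using assms by (metis ex_bij_betw_nat_finite)
  then show ?thesis using that by (auto simp: bij_betw_def atLeastLessThanSuc_atLeastAtMost)
qed

lemma dd_bounded_mult:
  assumes "dd_bounded K A u" "dd_bounded K B v"
  shows "dd_bounded K (real (Suc K) * (A * B)) (\<lambda>t. u t * v t)"
  unfolding dd_bounded_def
proof (intro allI impI, elim conjE)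
  fix S :: "real set" assume S: "S \<subseteq> {-1..1}" "S \<noteq> {}" "finite S" "card S \<le> Suc K"
  have AB: "0 \<le> A" "0 \<le> B" using assms dd_bounded_nonneg by auto
  obtain k where k: "card S = Suc k" using S by (metis card_0_eq not0_implies_Suc)
  obtain x where x: "inj_on x {0..k}" "S = x ` {0..k}" using finite_set_enum S k by metis
  have "\<bar>dd u (x ` {0..0+l}) * dd v (x ` {0+l..0+k})\<bar> \<le> A * B" if "l \<in> {..k}" for l
  proof -
    have *: "x ` I \<subseteq> {-1..1}" "card (x ` I) \<le> Suc K" if "I \<subseteq> {0..k}" for I
    proof -
      show "x ` I \<subseteq> {-1..1}" using that x(2) S(1) by blast
      have "card (x ` I) \<le> card S" using that x(2) S by (intro card_mono) auto
      then show "card (x ` I) \<le> Suc K" using S by simp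
    qed
    have "\<bar>dd u (x ` {0..0+l})\<bar> \<le> A" "\<bar>dd v (x ` {0+l..0+k})\<bar> \<le> B"
      using that by (intro dd_boundedD[OF assms(1)] dd_boundedD[OF assms(2)] *; auto)+
    then show ?thesis unfolding abs_mult using AB by (intro mult_mono) auto
  qed
  then have "\<bar>dd (\<lambda>t. u t * v t) (x ` {0..0+k})\<bar> \<le> (\<Sum>l\<in>{..k}. A * B)"
    by (subst dd_Leibniz) (use x in simp, intro order.trans[OF sum_abs] sum_mono)
  also have "\<dots> = real (Suc k) * (A * B)" by simp
  also have "\<dots> \<le> real (Suc K) * (A * B)" using k S AB by (intro mult_right_mono) auto
  finally show "\<bar>dd (\<lambda>t. u t * v t) S\<bar> \<le> real (Suc K) * (A * B)" by (simp only: x(2) add_0)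
qed

lemma scale_mem_symmetric_interval:
  fixes \<theta> t :: real
  assumes "0 \<le> \<theta>" "\<theta> \<le> 1" "t \<in> {-1..1}"
  shows "\<theta> * t \<in> {-1..1}"
proof -
  have "\<bar>t\<bar> \<le> 1" using assms by (auto simp: abs_le_iff)
  then have "\<bar>\<theta> * t\<bar> \<le> 1" using assms by (simp add: abs_mult mult_le_one)
  then show ?thesis by (simp add: abs_le_iff minus_le_iff)
qed

lemma dd_bounded_scale:
  assumes "dd_bounded K A u" "0 \<le> \<theta>" "\<theta> \<le> 1"
  shows "dd_bounded K A (\<lambda>t. u (\<theta> * t))"
proof (cases "\<theta> = 0")
  case True
  then show ?thesis
    using dd_bounded_mono[OF dd_bounded_const[of K "u 0"], of K A] dd_bounded_value[OF assms(1), of 0] by simp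
next
  case False
  show ?thesis unfolding dd_bounded_def
  proof (intro allI impI, elim conjE)
    fix S :: "real set" assume S: "S \<subseteq> {-1..1}" "S \<noteq> {}" "finite S" "card S \<le> Suc K"
    have "\<bar>dd u ((\<lambda>s. 0 + \<theta> * s) ` S)\<bar> \<le> A"
    proof (rule dd_boundedD[OF assms(1)])
      show "(\<lambda>s. 0 + \<theta> * s) ` S \<subseteq> {-1..1}"
        unfolding add_0 using S assms by (intro image_subsetI scale_mem_symmetric_interval) auto
      show "card ((\<lambda>s. 0 + \<theta> * s) ` S) \<le> Suc K" using S card_image_le order_trans by blast
    qed (use S in auto)
    moreover have "\<bar>\<theta> ^ (card S - 1)\<bar> \<le> 1" using assms by (simp add: power_le_one)
    moreover have "dd (\<lambda>t. u (\<theta> * t)) S = \<theta> ^ (card S - 1) * dd u ((\<lambda>s. 0 + \<theta> * s) ` S)"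
      using dd_affine[OF S(3) False, of u 0] by simp
    ultimately show "\<bar>dd (\<lambda>t. u (\<theta> * t)) S\<bar> \<le> A"
      using mult_mono[of "\<bar>\<theta> ^ (card S - 1)\<bar>" 1 "\<bar>dd u ((\<lambda>s. 0 + \<theta> * s) ` S)\<bar>" A]
      by (simp only: abs_mult) simp
  qed
qed


text \<open>In order one the Lipschitz bound of the top derivative is itself the claim;
  \<open>k\<close> integrations then reach order k + 1, without a derivative of that order.\<close>

lemma dd_bound_iterated_deriv:
  assumes deriv: "\<And>i t. i < k \<Longrightarrow> t \<in> {a..b} \<Longrightarrow> (U i has_real_derivative U (Suc i) t) (at t within {a..b})"
    and Lip: "\<And>s t. s \<in> {a..b} \<Longrightarrow> t \<in> {a..b} \<Longrightarrow> \<bar>U k s - U k t\<bar> \<le> M * \<bar>s - t\<bar>"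
    and S: "finite S" "S \<subseteq> {a..b}" "card S = Suc (Suc k)"
  shows "\<bar>dd (U 0) S\<bar> \<le> M"
proof -
  have "\<bar>dd (U (k - i)) T\<bar> \<le> M" if "i \<le> k" "finite T" "T \<subseteq> {a..b}" "card T = Suc (Suc i)" for i T
    using that
  proof (induction i arbitrary: T)
    case 0
    then obtain p q where pq: "T = {p, q}" "p \<noteq> q" by (auto simp: card_Suc_eq)
    then show ?case using Lip[of p q] 0 by (simp add: dd_pair divide_le_eq)
  next
    case (Suc i)
    show ?case
    proof (rule dd_bound_integrate[OF Suc.prems(2,3,4)])
      fix t assume "t \<in> {a..b}"
      then show "(U (k - Suc i) has_real_derivative U (k - i) t) (at t within {a..b})"
        using deriv[of "k - Suc i" t] Suc.prems(1) by (simp add: Suc_diff_Suc)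
    qed (use Suc in auto)
  qed
  from this[of k S] S show ?thesis by simp
qed

text \<open>Nodes of \<open>S\<close> are replaced by nodes of \<open>T\<close> one at a time. By
  \<open>dd_step\<close> one replacement costs the distance of the two nodes, at most 2 in [-1,1],
  times a difference of order K.\<close>

lemma dd_exchange:
  assumes "\<And>S. finite S \<Longrightarrow> S \<subseteq> {-1..1} \<Longrightarrow> card S = Suc K \<Longrightarrow> \<bar>dd u S\<bar> \<le> M"
    and "finite S" "finite T" "finite R" "S \<union> T \<union> R \<subseteq> {-1..1}"
    and "S \<inter> T = {}" "S \<inter> R = {}" "T \<inter> R = {}" "card S = k" "card T = k" "k + card R = K"
  shows "\<bar>dd u (S \<union> R) - dd u (T \<union> R)\<bar> \<le> k * (2 * M)"
  using assms(2-)
proof (induction k arbitrary: S T R)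
  case (Suc k)
  obtain a S' where S': "S = insert a S'" "a \<notin> S'" "card S' = k" using Suc.prems by (metis card_Suc_eq)
  obtain b T' where T': "T = insert b T'" "b \<notin> T'" "card T' = k" using Suc.prems by (metis card_Suc_eq)
  have ab: "a \<noteq> b" "a \<notin> S' \<union> R" "b \<notin> S' \<union> R" using S' T' Suc.prems by auto
  have fin: "finite (S' \<union> R)" using Suc.prems S' by auto
  have card: "card (S' \<union> R) = k + card R" using Suc.prems S' fin by (subst card_Un_disjoint) auto
  have "\<bar>a\<bar> \<le> 1" "\<bar>b\<bar> \<le> 1" using S' T' Suc.prems by (auto simp: abs_le_iff)
  then have "\<bar>a - b\<bar> \<le> 2" by linarith
  moreover have "\<bar>dd u (insert a (insert b (S' \<union> R)))\<bar> \<le> M"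
    using ab fin card Suc.prems S' T' by (intro assms(1)) auto
  ultimately have "\<bar>dd u (insert a (S' \<union> R)) - dd u (insert b (S' \<union> R))\<bar> \<le> 2 * M"
    unfolding dd_step[OF fin ab(2,3,1), symmetric] abs_mult by (intro mult_mono) auto
  moreover have "\<bar>dd u (S' \<union> insert b R) - dd u (T' \<union> insert b R)\<bar> \<le> k * (2 * M)"
    using Suc.prems S' T' by (intro Suc.IH) auto
  moreover have "S \<union> R = insert a (S' \<union> R)" "T' \<union> insert b R = T \<union> R" "S' \<union> insert b R = insert b (S' \<union> R)"
    unfolding S'(1) T'(1) by auto
  ultimately have "\<bar>dd u (S \<union> R) - dd u (insert b (S' \<union> R))\<bar> \<le> 2 * M"
    "\<bar>dd u (insert b (S' \<union> R)) - dd u (T \<union> R)\<bar> \<le> k * (2 * M)" by simp_all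
  then have "\<bar>dd u (S \<union> R) - dd u (T \<union> R)\<bar> \<le> 2 * M + k * (2 * M)" by linarith
  then show ?case by (simp add: algebra_simps)
qed simp

text \<open>Arbitrary nodes may almost collide, and then the values of \<open>u\<close> alone give
  no bound. They are therefore exchanged for well separated ones, where the Lagrange form is bounded
  by values.\<close>

lemma dd_interpolate_step:
  assumes K: "1 \<le> K" and M0: "\<And>t. t \<in> {-1..1} \<Longrightarrow> \<bar>u t\<bar> \<le> M0"
    and M: "\<And>S. finite S \<Longrightarrow> S \<subseteq> {-1..1} \<Longrightarrow> card S = Suc K \<Longrightarrow> \<bar>dd u S\<bar> \<le> M"
    and S: "finite S" "S \<subseteq> {-1..1}" "card S = K"
  shows "\<bar>dd u S\<bar> \<le> K * (M0 * (2 * K) ^ (K - 1)) + K * (2 * M)"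
proof -
  \<comment> \<open>A grid of 2K + 1 points in [0,1]: removing the K given nodes leaves at least K
    of them, at mutual distance at least 1/(2K).\<close>
  define y where "y i = real i / real (2 * K)" for i
  have inj: "inj_on y A" for A using K by (auto simp: y_def inj_on_def)
  define Y where "Y = y ` {0..2 * K}"
  have Y: "finite Y" "card Y = 2 * K + 1" unfolding Y_def using card_image[OF inj] by auto
  have "card (Y - S) \<ge> card Y - card S" using S(1) by (rule diff_card_le_card_Diff)
  then have "K \<le> card (Y - S)" using Y S by simp
  then obtain T where T: "T \<subseteq> Y - S" "card T = K" "finite T"
    using obtain_subset_with_card_n by metis
  have Tsub: "T \<subseteq> {-1..1}"
  proof
    fix t assume "t \<in> T"
    then obtain i where "i \<le> 2 * K" "t = y i" using T(1) by (auto simp: Y_def)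
    moreover have "0 \<le> y i" by (simp add: y_def)
    moreover have "y i \<le> 1" if "i \<le> 2 * K"
    proof -
      have "real i \<le> real (2 * K)" using that by (simp only: of_nat_le_iff)
      then show ?thesis using K unfolding y_def by (simp add: divide_le_eq)
    qed
    ultimately show "t \<in> {-1..1}" by auto
  qed
  have sep: "1 / (2 * K) \<le> \<bar>s - t\<bar>" if "s \<in> T" "t \<in> T" "s \<noteq> t" for s t
  proof -
    have "s \<in> Y" "t \<in> Y" using that T by auto
    then obtain i j where ij: "s = y i" "t = y j" by (auto simp: Y_def)
    then have "i \<noteq> j" using that by auto
    then have "1 \<le> \<bar>real i - real j\<bar>" by linarith
    then show ?thesis unfolding ij y_def by (simp add: diff_divide_distrib[symmetric] divide_right_mono)
  qed
  have "\<bar>dd u T\<bar> \<le> (\<Sum>x\<in>T. M0 * (2 * K) ^ (K - 1))"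
    unfolding dd_def
  proof (intro order.trans[OF sum_abs] sum_mono)
    fix x assume x: "x \<in> T"
    have "(1 / (2 * K)) ^ (K - 1) \<le> (\<Prod>y\<in>T - {x}. \<bar>x - y\<bar>)"
      using prod_mono[of "T - {x}" "\<lambda>_. 1 / (2 * real K)" "\<lambda>y. \<bar>x - y\<bar>"] sep[OF x] x T
      by (simp add: card_Diff_singleton)
    then have *: "1 / (2 * K) ^ (K - 1) \<le> \<bar>\<Prod>y\<in>T - {x}. x - y\<bar>"
      by (simp add: abs_prod power_divide)
    have pos: "0 < 1 / (2 * real K) ^ (K - 1)" using K by simp
    have "\<bar>u x / (\<Prod>y\<in>T - {x}. x - y)\<bar> \<le> M0 / (1 / (2 * real K) ^ (K - 1))"
      unfolding abs_divide using M0[of x] M0[of 0] x Tsub * pos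
      by (intro frac_le) auto
    then show "\<bar>u x / (\<Prod>y\<in>T - {x}. x - y)\<bar> \<le> M0 * (2 * K) ^ (K - 1)" by simp
  qed
  then have "\<bar>dd u T\<bar> \<le> K * (M0 * (2 * K) ^ (K - 1))" using T by simp
  moreover have "\<bar>dd u (S \<union> {}) - dd u (T \<union> {})\<bar> \<le> K * (2 * M)"
    using T S Tsub by (intro dd_exchange[OF M]) auto
  ultimately show ?thesis by simp
qed

text \<open>An inequality of Landau-Kolmogorov type: the sup bound and the top order control all
  orders in between. It is needed because rescaling keeps only these two under control. The
  induction bounds the next lower order first and then uses that as the new top order.\<close>

lemma dd_interpolate:
  "\<exists>C. \<forall>u. (\<forall>t\<in>{-1..1}. \<bar>u t\<bar> \<le> M0) \<and>
     (\<forall>S. finite S \<and> S \<subseteq> {-1..1} \<and> card S = Suc K \<longrightarrow> \<bar>dd u S\<bar> \<le> M) \<longrightarrow> dd_bounded K C u"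
proof (induction K arbitrary: M)
  case 0
  show ?case
  proof (intro exI[of _ M0] allI impI)
    fix u :: "real \<Rightarrow> real"
    assume u: "(\<forall>t\<in>{-1..1}. \<bar>u t\<bar> \<le> M0) \<and>
      (\<forall>S. finite S \<and> S \<subseteq> {-1..1} \<and> card S = Suc 0 \<longrightarrow> \<bar>dd u S\<bar> \<le> M)"
    show "dd_bounded 0 M0 u"
      unfolding dd_bounded_def
    proof (intro allI impI)
      fix S :: "real set" assume S: "S \<subseteq> {-1..1} \<and> S \<noteq> {} \<and> finite S \<and> card S \<le> Suc 0"
      then have "card S = 1" by (metis One_nat_def card_0_eq le_Suc_eq le_zero_eq)
      then obtain a where "S = {a}" using card_1_singletonE by blast
      then show "\<bar>dd u S\<bar> \<le> M0" using u S by simp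
    qed
  qed
next
  case (Suc K)
  define M' where "M' = Suc K * (M0 * (2 * Suc K) ^ K) + Suc K * (2 * M)"
  obtain C where C: "\<forall>u. (\<forall>t\<in>{-1..1}. \<bar>u t\<bar> \<le> M0) \<and>
     (\<forall>S. finite S \<and> S \<subseteq> {-1..1} \<and> card S = Suc K \<longrightarrow> \<bar>dd u S\<bar> \<le> M') \<longrightarrow> dd_bounded K C u"
    using Suc.IH by blast
  show ?case
  proof (intro exI[of _ "max C M"] allI impI)
    fix u :: "real \<Rightarrow> real"
    assume u: "(\<forall>t\<in>{-1..1}. \<bar>u t\<bar> \<le> M0) \<and>
      (\<forall>S. finite S \<and> S \<subseteq> {-1..1} \<and> card S = Suc (Suc K) \<longrightarrow> \<bar>dd u S\<bar> \<le> M)"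
    have "\<bar>dd u S\<bar> \<le> M'" if "finite S" "S \<subseteq> {-1..1}" "card S = Suc K" for S
      using dd_interpolate_step[of "Suc K" u M0 M S] u that by (auto simp: M'_def)
    then have *: "dd_bounded K C u"
      using C[THEN spec, THEN mp, of u] u by simp
    show "dd_bounded (Suc K) (max C M) u"
      unfolding dd_bounded_def
    proof (intro allI impI)
      fix S :: "real set" assume S: "S \<subseteq> {-1..1} \<and> S \<noteq> {} \<and> finite S \<and> card S \<le> Suc (Suc K)"
      then consider "card S \<le> Suc K" | "card S = Suc (Suc K)" by (metis le_Suc_eq)
      then show "\<bar>dd u S\<bar> \<le> max C M"
      proof cases
        case 1
        then show ?thesis using dd_boundedD[OF *, of S] S by auto
      next
        case 2
        then show ?thesis using u S by auto
      qed
    qed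
  qed
qed

section \<open>Coefficient bounds for polynomials\<close>

definition coeffs_le :: "real \<Rightarrow> real poly \<Rightarrow> bool" where
  "coeffs_le B p \<longleftrightarrow> (\<forall>k. \<bar>coeff p k\<bar> \<le> B)"

lemma coeffs_le_nonneg: "coeffs_le B p \<Longrightarrow> 0 \<le> B"
  unfolding coeffs_le_def by (meson abs_ge_zero order.trans)

lemma coeffs_le_mono: "coeffs_le A p \<Longrightarrow> A \<le> B \<Longrightarrow> coeffs_le B p"
  unfolding coeffs_le_def by (meson order.trans)

lemma coeffs_le_add: "coeffs_le A p \<Longrightarrow> coeffs_le B q \<Longrightarrow> coeffs_le (A + B) (p + q)"
  unfolding coeffs_le_def by (auto intro: order.trans[OF abs_triangle_ineq] add_mono)

lemma coeffs_le_diff: "coeffs_le A p \<Longrightarrow> coeffs_le B q \<Longrightarrow> coeffs_le (A + B) (p - q)"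
  unfolding coeffs_le_def by (auto intro: order.trans[OF abs_triangle_ineq4] add_mono)

lemma coeffs_le_sum: "(\<And>i. i \<in> I \<Longrightarrow> coeffs_le A (p i)) \<Longrightarrow> coeffs_le (real (card I) * A) (\<Sum>i\<in>I. p i)"
  unfolding coeffs_le_def coeff_sum
  by (auto intro: order.trans[OF sum_abs] order.trans[OF sum_bounded_above])

lemma coeffs_le_smult: "coeffs_le A p \<Longrightarrow> coeffs_le (\<bar>c\<bar> * A) (smult c p)"
  unfolding coeffs_le_def by (auto simp: abs_mult intro: mult_left_mono)

lemma coeffs_le_const: "coeffs_le \<bar>c\<bar> [:c:]"
  unfolding coeffs_le_def by (auto simp: coeff_pCons split: nat.split)

lemma coeffs_le_linear_mult:
  assumes "coeffs_le A p" "\<bar>a\<bar> \<le> B"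
  shows "coeffs_le ((1 + B) * A) ([:- a, 1:] * p)"
  unfolding coeffs_le_def
proof
  fix k
  have A: "\<bar>coeff p i\<bar> \<le> A" for i using assms by (simp add: coeffs_le_def)
  have "coeff ([:- a, 1:] * p) k = (case k of 0 \<Rightarrow> 0 | Suc j \<Rightarrow> coeff p j) - a * coeff p k"
    by (simp add: coeff_pCons split: nat.split)
  moreover have "\<bar>case k of 0 \<Rightarrow> 0 | Suc j \<Rightarrow> coeff p j\<bar> \<le> A"
    using A coeffs_le_nonneg[OF assms(1)] by (simp split: nat.split)
  moreover have "\<bar>a * coeff p k\<bar> \<le> B * A"
    unfolding abs_mult using A[of k] assms(2) by (intro mult_mono) auto
  ultimately show "\<bar>coeff ([:- a, 1:] * p) k\<bar> \<le> (1 + B) * A"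
    by (simp add: distrib_right)
qed

lemma coeffs_le_mult:
  assumes "coeffs_le A p" "coeffs_le B q" "degree p \<le> m"
  shows "coeffs_le (real (Suc m) * (A * B)) (p * q)"
  unfolding coeffs_le_def
proof
  fix k
  have A: "\<bar>coeff p i\<bar> \<le> A" "\<bar>coeff q i\<bar> \<le> B" for i using assms by (simp_all add: coeffs_le_def)
  have AB: "0 \<le> A" "0 \<le> B" using assms coeffs_le_nonneg by auto
  have "\<bar>coeff (p * q) k\<bar> \<le> (\<Sum>i\<le>k. \<bar>coeff p i * coeff q (k - i)\<bar>)"
    unfolding coeff_mult by (rule sum_abs)
  also have "\<dots> = (\<Sum>i\<in>{..k} \<inter> {..m}. \<bar>coeff p i * coeff q (k - i)\<bar>)"
    using assms(3) by (intro sum.mono_neutral_right) (auto simp: coeff_eq_0)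
  also have "\<dots> \<le> real (card ({..k} \<inter> {..m})) * (A * B)"
    using A AB by (intro order.trans[OF sum_bounded_above]) (auto simp: abs_mult intro: mult_mono)
  also have "\<dots> \<le> real (Suc m) * (A * B)"
  proof (rule mult_right_mono)
    have "card ({..k} \<inter> {..m}) \<le> card {..m}" by (intro card_mono) auto
    then show "real (card ({..k} \<inter> {..m})) \<le> real (Suc m)" by simp
  qed (use AB in simp)
  finally show "\<bar>coeff (p * q) k\<bar> \<le> real (Suc m) * (A * B)" .
qed

lemma abs_poly_le:
  assumes "coeffs_le A p" "degree p \<le> m" "\<bar>z\<bar> \<le> B"
  shows "\<bar>poly p z\<bar> \<le> real (Suc m) * (A * (1 + B) ^ m)"
proof -
  have A0: "0 \<le> A" using assms coeffs_le_nonneg by auto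
  have "poly p z = (\<Sum>i\<le>m. coeff p i * z ^ i)"
    unfolding poly_altdef using assms(2) by (intro sum.mono_neutral_left) (auto simp: coeff_eq_0)
  then have "\<bar>poly p z\<bar> \<le> (\<Sum>i\<le>m. \<bar>coeff p i * z ^ i\<bar>)"
    by (simp add: sum_abs)
  also have "\<dots> \<le> of_nat (card {..m}) * (A * (1 + B) ^ m)"
  proof (rule sum_bounded_above)
    fix i assume "i \<in> {..m}"
    then have "(1 + B) ^ i \<le> (1 + B) ^ m" using assms by (intro power_increasing) auto
    moreover have "\<bar>z\<bar> ^ i \<le> (1 + B) ^ i" using assms by (intro power_mono) auto
    ultimately have "\<bar>z\<bar> ^ i \<le> (1 + B) ^ m" by linarith
    then show "\<bar>coeff p i * z ^ i\<bar> \<le> A * (1 + B) ^ m"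
      unfolding abs_mult power_abs using assms(1) A0 by (intro mult_mono) (auto simp: coeffs_le_def)
  qed
  finally show ?thesis by simp
qed

section \<open>Monic polynomials given by their roots\<close>

definition roots_poly :: "nat \<Rightarrow> (nat \<Rightarrow> real) \<Rightarrow> real poly" where
  "roots_poly n x = (\<Prod>i<n. [:- x i, 1:])"

lemma poly_roots_poly: "poly (roots_poly n x) z = (\<Prod>i<n. z - x i)"
  by (simp add: roots_poly_def poly_prod)

lemma roots_poly_0 [simp]: "roots_poly 0 x = 1"
  by (simp add: roots_poly_def)

lemma roots_poly_Suc: "roots_poly (Suc n) x = [:- x n, 1:] * roots_poly n x"
  by (simp add: roots_poly_def mult.commute)

lemma roots_poly_add: "roots_poly (p + q) x = roots_poly p x * roots_poly q (\<lambda>i. x (p + i))"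
  by (induction q) (simp_all add: roots_poly_Suc algebra_simps del: mult_pCons_left mult_pCons_right)

lemma degree_roots_poly [simp]: "degree (roots_poly n x) = n"
  by (simp add: roots_poly_def degree_prod_eq_sum_degree)

lemma lead_coeff_roots_poly [simp]: "coeff (roots_poly n x) n = 1"
proof -
  have "lead_coeff (roots_poly n x) = 1" unfolding roots_poly_def by (simp add: lead_coeff_prod)
  then show ?thesis by simp
qed

lemma coeffs_le_roots_poly:
  assumes "\<And>i. i < n \<Longrightarrow> \<bar>x i\<bar> \<le> B"
  shows "coeffs_le ((1 + B) ^ n) (roots_poly n x)"
  using assms
proof (induction n)
  case 0
  show ?case by (simp add: coeffs_le_def coeff_pCons one_pCons split: nat.split)
next
  case (Suc n)
  then show ?case unfolding roots_poly_Suc power_Suc by (intro coeffs_le_linear_mult) auto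
qed

text \<open>Division read from the top: each coefficient of \<open>p\<close> is a coefficient of the
  product plus \<open>a\<close> times the next higher coefficient of \<open>p\<close>. The bound
  grows by 2 + B per degree, and no lower bound on the size of \<open>a\<close> enters.\<close>

lemma coeffs_le_linear_div:
  assumes "coeffs_le M ([:- a, 1:] * p)" "\<bar>a\<bar> \<le> B" "degree p \<le> m"
  shows "coeffs_le (M * (2 + B) ^ Suc m) p"
proof -
  have M: "0 \<le> M" using assms coeffs_le_nonneg by auto
  have B: "0 \<le> B" using assms(2) by linarith
  have "\<bar>coeff p (Suc m - i)\<bar> \<le> M * (2 + B) ^ i" if "i \<le> Suc m" for i
    using that
  proof (induction i)
    case 0
    then show ?case using assms(3) M by (simp add: coeff_eq_0)
  next
    case (Suc i)
    define k where "k = m - i"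
    have k: "Suc m - i = Suc k" "Suc m - Suc i = k" using Suc.prems by (auto simp: k_def)
    have "coeff ([:- a, 1:] * p) (Suc k) = coeff p k - a * coeff p (Suc k)"
      by simp
    moreover have "\<bar>coeff ([:- a, 1:] * p) (Suc k)\<bar> \<le> M" using assms(1) by (simp only: coeffs_le_def)
    ultimately have "\<bar>coeff p k\<bar> \<le> M + \<bar>a * coeff p (Suc k)\<bar>" by linarith
    also have "\<bar>a * coeff p (Suc k)\<bar> \<le> B * (M * (2 + B) ^ i)"
      unfolding abs_mult using Suc k assms(2) B by (intro mult_mono) auto
    also have "M + B * (M * (2 + B) ^ i) \<le> M * (2 + B) ^ i + B * (M * (2 + B) ^ i)"
      using M B by (simp add: mult_le_cancel_left1 one_le_power)
    also have "\<dots> \<le> M * (2 + B) ^ Suc i"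
      using M B by (simp add: algebra_simps)
    finally show ?case using k by simp
  qed
  note bound = this
  show ?thesis
    unfolding coeffs_le_def
  proof
    fix k show "\<bar>coeff p k\<bar> \<le> M * (2 + B) ^ Suc m"
    proof (cases "k \<le> m")
      case True
      then have "\<bar>coeff p k\<bar> \<le> M * (2 + B) ^ (Suc m - k)" using bound[of "Suc m - k"] by simp
      also have "\<dots> \<le> M * (2 + B) ^ Suc m"
        using M B by (intro mult_left_mono power_increasing) auto
      finally show ?thesis .
    next
      case False
      then show ?thesis using assms(3) M B by (simp add: coeff_eq_0)
    qed
  qed
qed

text \<open>Dividing \<open>R\<close> by \<open>F\<close>, one root of \<open>F\<close> at a time.\<close>

lemma remainder_bound:
  "\<exists>C. \<forall>\<alpha> X Y R. (\<forall>i<p. \<bar>\<alpha> i\<bar> \<le> B) \<and> roots_poly p \<alpha> * X + Y = R \<and> (\<forall>k\<ge>p. coeff Y k = 0) \<and>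
     degree R \<le> D \<and> coeffs_le M R \<longrightarrow> coeffs_le C Y"
proof (induction p arbitrary: M)
  case 0
  show ?case
    by (intro exI[of _ 0]) (auto simp: coeffs_le_def)
next
  case (Suc p)
  \<comment> \<open>\<open>E\<close> bounds the value of \<open>R\<close> at a root, and
    \<open>M1\<close> the coefficients left after this value is subtracted and the root divided
    out.\<close>
  define E where "E = real (Suc D) * (M * (1 + B) ^ D)"
  define M1 where "M1 = (M + E) * (2 + B) ^ Suc D"
  obtain C where C: "\<forall>\<alpha> X Y R. (\<forall>i<p. \<bar>\<alpha> i\<bar> \<le> B) \<and> roots_poly p \<alpha> * X + Y = R \<and> (\<forall>k\<ge>p. coeff Y k = 0) \<and>
     degree R \<le> D \<and> coeffs_le M1 R \<longrightarrow> coeffs_le C Y"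
    using Suc.IH by blast
  show ?case
  proof (intro exI[of _ "(1 + B) * C + E"] allI impI, elim conjE)
    fix \<alpha> X Y R
    assume \<alpha>: "\<forall>i<Suc p. \<bar>\<alpha> i\<bar> \<le> B" and eq: "roots_poly (Suc p) \<alpha> * X + Y = R"
      and Y: "\<forall>k\<ge>Suc p. coeff Y k = 0" and R: "degree R \<le> D" "coeffs_le M R"
    let ?a = "\<alpha> p"
    have val: "poly Y ?a = poly R ?a" using eq by (auto simp: roots_poly_Suc)
    have "[:- ?a, 1:] dvd Y - [:poly R ?a:]" by (simp flip: poly_eq_0_iff_dvd add: val)
    then obtain Y1 where Y1: "Y - [:poly R ?a:] = [:- ?a, 1:] * Y1" by (elim dvdE)
    have E: "\<bar>poly R ?a\<bar> \<le> E" unfolding E_def using abs_poly_le[OF R(2,1)] \<alpha> by simp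
    \<comment> \<open>\<open>Y\<close> and \<open>R\<close> have the same value at the root.
      Subtracting it and dividing by the linear factor leaves the same kind of equation with one
      root less.\<close>
    define R1 where "R1 = roots_poly p \<alpha> * X + Y1"
    have eq1: "[:- ?a, 1:] * R1 = R - [:poly R ?a:]"
    proof -
      have "[:- ?a, 1:] * R1 = roots_poly (Suc p) \<alpha> * X + [:- ?a, 1:] * Y1"
        by (simp only: R1_def roots_poly_Suc distrib_left mult.assoc)
      then show ?thesis using eq Y1 by (metis add_diff_eq)
    qed
    have deg: "degree q \<le> m" if "[:- ?a, 1:] * q = r" "degree r \<le> Suc m" for q r m
    proof (cases "q = 0")
      case False
      then have "degree r = Suc (degree q)" using that(1) by (subst that(1)[symmetric], subst degree_mult_eq) auto
      then show ?thesis using that(2) by simp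
    qed simp
    have dR1: "degree R1 \<le> D"
      by (rule deg[OF eq1]) (use R(1) in \<open>intro degree_diff_le; simp\<close>)
    have "coeffs_le (M + \<bar>poly R ?a\<bar>) ([:- ?a, 1:] * R1)"
      unfolding eq1 by (intro coeffs_le_diff R(2) coeffs_le_const)
    then have "coeffs_le (M + E) ([:- ?a, 1:] * R1)" using E by (elim coeffs_le_mono) simp
    then have "coeffs_le M1 R1"
      unfolding M1_def using \<alpha> dR1 by (intro coeffs_le_linear_div) auto
    moreover have "\<forall>k\<ge>p. coeff Y1 k = 0"
    proof (cases "p = 0")
      case False
      have "degree Y \<le> p" using Y by (intro degree_le) auto
      then have "degree Y1 \<le> p - 1"
        using False by (intro deg[OF Y1[symmetric]] degree_diff_le) auto
      then show ?thesis using False by (auto intro!: coeff_eq_0)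
    next
      case True
      then have "degree (Y - [:poly R ?a:]) = 0" using Y
        by (metis (no_types, lifting) One_nat_def Suc_leI degree_0 degree_diff_le degree_le degree_pCons_0 le_zero_eq)
      have "Y1 = 0"
      proof (rule ccontr)
        assume "Y1 \<noteq> 0"
        then have "degree ([:- ?a, 1:] * Y1) = Suc (degree Y1)" by (subst degree_mult_eq) auto
        then show False using \<open>degree (Y - [:poly R ?a:]) = 0\<close> Y1 by simp
      qed
      then show ?thesis by simp
    qed
    ultimately have "coeffs_le C Y1"
      using C \<alpha> dR1 R1_def by (metis less_SucI)
    then have "coeffs_le ((1 + B) * C) ([:- ?a, 1:] * Y1)" using \<alpha> by (intro coeffs_le_linear_mult) auto
    then have "coeffs_le ((1 + B) * C + \<bar>poly R ?a\<bar>) ([:- ?a, 1:] * Y1 + [:poly R ?a:])"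
      by (intro coeffs_le_add coeffs_le_const)
    moreover have "[:- ?a, 1:] * Y1 + [:poly R ?a:] = Y" using Y1 by (metis diff_add_cancel)
    ultimately show "coeffs_le ((1 + B) * C + E) Y"
      using E by (metis coeffs_le_mono add_left_mono)
  qed
qed

text \<open>The gap \<open>g\<close> plays the role of a lower bound for the resultant of the two factors.\<close>

lemma Bezout_bound:
  assumes g: "0 < g"
  shows "\<exists>C. \<forall>\<alpha> \<beta> X Y R. (\<forall>i<p. \<bar>\<alpha> i\<bar> \<le> B) \<and> (\<forall>j<q. \<bar>\<beta> j\<bar> \<le> B) \<and>
     (\<forall>i<p. \<forall>j<q. g \<le> \<bar>\<alpha> i - \<beta> j\<bar>) \<and>
     roots_poly p \<alpha> * X + Y * roots_poly q \<beta> = R \<and> (\<forall>k\<ge>p. coeff Y k = 0) \<and>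
     degree R \<le> D \<and> coeffs_le M R \<longrightarrow> coeffs_le C Y"
proof (induction q)
  case 0
  obtain C where "\<forall>\<alpha> X Y R. (\<forall>i<p. \<bar>\<alpha> i\<bar> \<le> B) \<and> roots_poly p \<alpha> * X + Y = R \<and> (\<forall>k\<ge>p. coeff Y k = 0) \<and>
     degree R \<le> D \<and> coeffs_le M R \<longrightarrow> coeffs_le C Y"
    using remainder_bound by blast
  then show ?case by (intro exI[of _ C]) auto
next
  case (Suc q)
  then obtain C where C: "\<forall>\<alpha> \<beta> X Y R. (\<forall>i<p. \<bar>\<alpha> i\<bar> \<le> B) \<and> (\<forall>j<q. \<bar>\<beta> j\<bar> \<le> B) \<and>
     (\<forall>i<p. \<forall>j<q. g \<le> \<bar>\<alpha> i - \<beta> j\<bar>) \<and>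
     roots_poly p \<alpha> * X + Y * roots_poly q \<beta> = R \<and> (\<forall>k\<ge>p. coeff Y k = 0) \<and>
     degree R \<le> D \<and> coeffs_le M R \<longrightarrow> coeffs_le C Y" by blast
  \<comment> \<open>The bound for the coefficient of degree p - 1 of \<open>Y\<close>, obtained at
    the new root, where the first factor has size at least g^p.\<close>
  define E where "E = real (Suc p) * (C * (1 + B) ^ p) / g ^ p"
  define M2 where "M2 = C + E * (1 + B) ^ p"
  show ?case
  proof (intro exI[of _ "max 0 (M2 * (2 + B) ^ Suc p)"] allI impI, elim conjE)
    fix \<alpha> \<beta> :: "nat \<Rightarrow> real" and X Y R
    assume \<alpha>: "\<forall>i<p. \<bar>\<alpha> i\<bar> \<le> B" and \<beta>: "\<forall>j<Suc q. \<bar>\<beta> j\<bar> \<le> B"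
      and gap: "\<forall>i<p. \<forall>j<Suc q. g \<le> \<bar>\<alpha> i - \<beta> j\<bar>"
      and eq: "roots_poly p \<alpha> * X + Y * roots_poly (Suc q) \<beta> = R"
      and Y: "\<forall>k\<ge>p. coeff Y k = 0" and R: "degree R \<le> D" "coeffs_le M R"
    show "coeffs_le (max 0 (M2 * (2 + B) ^ Suc p)) Y"
    proof (cases p)
      case 0
      then have "Y = 0" using Y by (simp add: poly_eq_iff)
      then show ?thesis by (simp add: coeffs_le_def)
    next
      case (Suc p')
      let ?b = "\<beta> q" and ?F = "roots_poly p \<alpha>" and ?G = "roots_poly q \<beta>"
      define y where "y = coeff Y p'"
      \<comment> \<open>Absorbs the new root into \<open>Y\<close>. The product may have degree p;
        subtracting \<open>y\<close> times the monic first factor brings it below p again, and the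
        correction goes into \<open>X\<close>.\<close>
      define Y' where "Y' = [:- ?b, 1:] * Y - smult y ?F"
      have Y': "\<forall>k\<ge>p. coeff Y' k = 0"
      proof (intro allI impI)
        fix k assume k: "p \<le> k"
        then obtain k' where k': "k = Suc k'" using Suc by (cases k) auto
        have "coeff Y' k = coeff Y k' - y * coeff ?F k"
          using Y k by (simp add: Y'_def k')
        also have "\<dots> = 0"
        proof (cases "k = p")
          case True
          then show ?thesis using Suc k' by (simp add: y_def)
        next
          case False
          then have "p < k" using k by simp
          then show ?thesis using Y k' by (simp add: coeff_eq_0)
        qed
        finally show "coeff Y' k = 0" .
      qed
      have eq': "?F * (X + smult y ?G) + Y' * ?G = R"
        unfolding eq[symmetric] Y'_def roots_poly_Suc
        by (simp add: algebra_simps del: mult_pCons_left mult_pCons_right)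
      have CY': "coeffs_le C Y'"
        using C[rule_format, of \<alpha> \<beta> "X + smult y ?G" Y' R] eq' \<alpha> \<beta> gap Y' R by simp
      have degY': "degree Y' \<le> p" using Y' by (intro degree_le) auto
      have Fb: "g ^ p \<le> \<bar>poly ?F ?b\<bar>"
      proof -
        have "(\<Prod>i<p. g) \<le> (\<Prod>i<p. \<bar>?b - \<alpha> i\<bar>)"
          using gap g by (intro prod_mono) (auto simp: abs_minus_commute)
        then show ?thesis by (simp add: poly_roots_poly abs_prod)
      qed
      have gp: "0 < g ^ p" using g by simp
      \<comment> \<open>At the new root the linear factor vanishes, so the bounded polynomial
        \<open>Y'\<close> determines \<open>y\<close> as soon as the first factor is bounded away
        from 0 there.\<close>
      have "poly Y' ?b = - (y * poly ?F ?b)" by (simp add: Y'_def)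
      then have "\<bar>y\<bar> * \<bar>poly ?F ?b\<bar> = \<bar>poly Y' ?b\<bar>" by (simp add: abs_mult)
      also have "\<dots> \<le> real (Suc p) * (C * (1 + B) ^ p)"
        using abs_poly_le[OF CY' degY'] \<beta> by simp
      finally have "\<bar>y\<bar> * g ^ p \<le> real (Suc p) * (C * (1 + B) ^ p)"
        using mult_left_mono[OF Fb, of "\<bar>y\<bar>"] by simp
      then have y: "\<bar>y\<bar> \<le> E" unfolding E_def using gp by (simp add: pos_le_divide_eq)
      have B0: "0 \<le> B" using \<beta> by (meson abs_ge_zero lessI order.trans)
      have "[:- ?b, 1:] * Y = Y' + smult y ?F" by (simp add: Y'_def)
      moreover have "coeffs_le (C + \<bar>y\<bar> * (1 + B) ^ p) (Y' + smult y ?F)"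
        using \<alpha> by (intro coeffs_le_add coeffs_le_smult CY' coeffs_le_roots_poly) auto
      ultimately have "coeffs_le M2 ([:- ?b, 1:] * Y)"
        using y B0 by (auto simp: M2_def elim!: coeffs_le_mono intro: mult_right_mono)
      moreover have "degree Y \<le> p" using Y by (intro degree_le) auto
      ultimately have "coeffs_le (M2 * (2 + B) ^ Suc p) Y"
        using \<beta> by (intro coeffs_le_linear_div) auto
      then show ?thesis by (elim coeffs_le_mono) simp
    qed
  qed
qed

text \<open>Differences coefficient by coefficient, kept as one polynomial, so that the Leibniz rule
  for a factorization becomes an equation between polynomials.\<close>

definition ddp :: "(real \<Rightarrow> real poly) \<Rightarrow> real set \<Rightarrow> real poly" where
  "ddp F S = (\<Sum>x\<in>S. smult (inverse (\<Prod>y\<in>S - {x}. x - y)) (F x))"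

lemma coeff_ddp: "coeff (ddp F S) m = dd (\<lambda>t. coeff (F t) m) S"
  by (simp add: ddp_def dd_def coeff_sum field_simps)

lemma poly_ddp: "poly (ddp F S) z = dd (\<lambda>t. poly (F t) z) S"
  by (simp add: ddp_def dd_def poly_sum field_simps)

lemma ddp_singleton [simp]: "ddp F {x} = F x"
  by (simp add: ddp_def)

lemma ddp_Leibniz:
  fixes x :: "nat \<Rightarrow> real"
  assumes "inj_on x {0..k}"
  shows "ddp (\<lambda>t. F t * G t) (x ` {0..k}) = (\<Sum>l\<le>k. ddp F (x ` {0..l}) * ddp G (x ` {l..k}))"
proof -
  have "poly (ddp (\<lambda>t. F t * G t) (x ` {0..k})) z = poly (\<Sum>l\<le>k. ddp F (x ` {0..l}) * ddp G (x ` {l..k})) z" for z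
    using dd_Leibniz[of x 0 k "\<lambda>t. poly (F t) z" "\<lambda>t. poly (G t) z"] assms
    by (simp add: poly_ddp poly_sum)
  then show ?thesis by (simp add: poly_eq_poly_eq_iff[symmetric] fun_eq_iff)
qed

lemma degree_ddp_roots: "degree (ddp (\<lambda>t. roots_poly p (\<rho> t)) S) \<le> p"
  by (rule degree_le) (auto simp: coeff_ddp coeff_eq_0 dd_def)

text \<open>The leading coefficient is constantly 1, so its differences vanish from order one on.
  The resulting drop of degree is the normalization under which \<open>Bezout_bound\<close> bounds
  the solution.\<close>

lemma coeff_ddp_roots:
  assumes "finite S" "2 \<le> card S" "p \<le> k"
  shows "coeff (ddp (\<lambda>t. roots_poly p (\<rho> t)) S) k = 0"
proof (cases "k = p")
  case True
  then show ?thesis using dd_const[OF assms(1,2)] by (simp add: coeff_ddp)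
next
  case False
  then show ?thesis using assms(3) by (simp add: coeff_ddp coeff_eq_0 dd_def)
qed

text \<open>The gap is required between roots at different times \<open>s\<close> and
  \<open>t\<close>, because the Leibniz rule evaluates one factor at the first node and the other at
  the last.\<close>

definition separated :: "nat \<Rightarrow> nat \<Rightarrow> real \<Rightarrow> real \<Rightarrow> (real \<Rightarrow> nat \<Rightarrow> real) \<Rightarrow> (real \<Rightarrow> nat \<Rightarrow> real) \<Rightarrow> bool" where
  "separated p q B g \<rho> \<mu> \<longleftrightarrow>
     (\<forall>t\<in>{-1..1}. (\<forall>i<p. \<bar>\<rho> t i\<bar> \<le> B) \<and> (\<forall>j<q. \<bar>\<mu> t j\<bar> \<le> B)) \<and>
     (\<forall>s\<in>{-1..1}. \<forall>t\<in>{-1..1}. \<forall>i<p. \<forall>j<q. g \<le> \<bar>\<rho> s i - \<mu> t j\<bar>)"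

lemma dd_bounded_roots_poly_0:
  assumes "\<And>t i. t \<in> {-1..1} \<Longrightarrow> i < p \<Longrightarrow> \<bar>\<rho> t i\<bar> \<le> B"
  shows "dd_bounded 0 ((1 + B) ^ p) (\<lambda>t. coeff (roots_poly p (\<rho> t)) m)"
  unfolding dd_bounded_def
proof (intro allI impI, elim conjE)
  fix S :: "real set" assume S: "S \<subseteq> {-1..1}" "S \<noteq> {}" "finite S" "card S \<le> Suc 0"
  then have "card S = 1" by (metis One_nat_def card_0_eq le_Suc_eq le_zero_eq)
  then obtain a where a: "S = {a}" using card_1_singletonE by blast
  then show "\<bar>dd (\<lambda>t. coeff (roots_poly p (\<rho> t)) m) S\<bar> \<le> (1 + B) ^ p"
    using coeffs_le_roots_poly[of p "\<rho> a" B] assms S by (simp add: coeffs_le_def)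
qed

text \<open>By Leibniz, the two top order divided differences of the factors solve a Bezout equation whose
  right hand side only involves lower orders.\<close>

lemma dd_bounded_factors:
  assumes g: "0 < g"
  shows "\<exists>C. \<forall>\<rho> \<mu>. separated p q B g \<rho> \<mu> \<and>
     (\<forall>m. dd_bounded K A (\<lambda>t. coeff (roots_poly p (\<rho> t) * roots_poly q (\<mu> t)) m)) \<longrightarrow>
     (\<forall>m. dd_bounded K C (\<lambda>t. coeff (roots_poly p (\<rho> t)) m) \<and> dd_bounded K C (\<lambda>t. coeff (roots_poly q (\<mu> t)) m))"
proof (induction K)
  case 0
  show ?case
  proof (intro exI[of _ "max ((1 + B) ^ p) ((1 + B) ^ q)"] allI impI, elim conjE)
    fix \<rho> \<mu> m assume s: "separated p q B g \<rho> \<mu>"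
    show "dd_bounded 0 (max ((1 + B) ^ p) ((1 + B) ^ q)) (\<lambda>t. coeff (roots_poly p (\<rho> t)) m) \<and>
      dd_bounded 0 (max ((1 + B) ^ p) ((1 + B) ^ q)) (\<lambda>t. coeff (roots_poly q (\<mu> t)) m)"
      using s by (intro conjI dd_bounded_mono[OF dd_bounded_roots_poly_0[of _ _ B]]) (auto simp: separated_def)
  qed
next
  case (Suc K)
  then obtain C where C: "\<forall>\<rho> \<mu>. separated p q B g \<rho> \<mu> \<and>
     (\<forall>m. dd_bounded K A (\<lambda>t. coeff (roots_poly p (\<rho> t) * roots_poly q (\<mu> t)) m)) \<longrightarrow>
     (\<forall>m. dd_bounded K C (\<lambda>t. coeff (roots_poly p (\<rho> t)) m) \<and> dd_bounded K C (\<lambda>t. coeff (roots_poly q (\<mu> t)) m))"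
    by blast
  \<comment> \<open>\<open>A\<close> for the difference of the product, plus K mixed terms, each
    with at most p + 1 products of lower order differences in every coefficient.\<close>
  define M where "M = A + real K * (real (Suc p) * (C * C))"
  obtain C1 where C1: "\<forall>\<alpha> \<beta> X Y R. (\<forall>i<p. \<bar>\<alpha> i\<bar> \<le> B) \<and> (\<forall>j<q. \<bar>\<beta> j\<bar> \<le> B) \<and>
     (\<forall>i<p. \<forall>j<q. g \<le> \<bar>\<alpha> i - \<beta> j\<bar>) \<and>
     roots_poly p \<alpha> * X + Y * roots_poly q \<beta> = R \<and> (\<forall>k\<ge>p. coeff Y k = 0) \<and>
     degree R \<le> p + q \<and> coeffs_le M R \<longrightarrow> coeffs_le C1 Y"
    using Bezout_bound[OF g] by blast
  \<comment> \<open>The same estimate with the factors exchanged, for the difference of the second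
    one.\<close>
  obtain C2 where C2: "\<forall>\<alpha> \<beta> X Y R. (\<forall>i<q. \<bar>\<alpha> i\<bar> \<le> B) \<and> (\<forall>j<p. \<bar>\<beta> j\<bar> \<le> B) \<and>
     (\<forall>i<q. \<forall>j<p. g \<le> \<bar>\<alpha> i - \<beta> j\<bar>) \<and>
     roots_poly q \<alpha> * X + Y * roots_poly p \<beta> = R \<and> (\<forall>k\<ge>q. coeff Y k = 0) \<and>
     degree R \<le> p + q \<and> coeffs_le M R \<longrightarrow> coeffs_le C2 Y"
    using Bezout_bound[OF g] by blast
  show ?case
  proof (intro exI[of _ "max C (max C1 C2)"] allI impI, elim conjE)
    fix \<rho> \<mu> m
    assume s: "separated p q B g \<rho> \<mu>"
      and A: "\<forall>m. dd_bounded (Suc K) A (\<lambda>t. coeff (roots_poly p (\<rho> t) * roots_poly q (\<mu> t)) m)"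
    let ?F = "\<lambda>t. roots_poly p (\<rho> t)" and ?G = "\<lambda>t. roots_poly q (\<mu> t)"
    have "\<forall>m. dd_bounded K A (\<lambda>t. coeff (?F t * ?G t) m)"
      using A by (auto intro: dd_bounded_mono[of "Suc K" A])
    then have low: "dd_bounded K C (\<lambda>t. coeff (?F t) m)" "dd_bounded K C (\<lambda>t. coeff (?G t) m)" for m
      using C s by blast+
    have top: "coeffs_le C1 (ddp ?F S) \<and> coeffs_le C2 (ddp ?G S)"
      if S: "S \<subseteq> {-1..1}" "finite S" "card S = Suc (Suc K)" for S
    proof -
      obtain x where x: "inj_on x {0..Suc K}" "S = x ` {0..Suc K}" using finite_set_enum S by metis
      have sub: "x ` I \<subseteq> {-1..1}" if "I \<subseteq> {0..Suc K}" for I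
        using that x(2) S(1) by blast
      have card: "card (x ` I) = card I" if "I \<subseteq> {0..Suc K}" for I
        using card_image inj_on_subset[OF x(1) that] by blast
      \<comment> \<open>The two extreme terms of the Leibniz sum put the full difference on one
        factor and none on the other; they contain the unknowns. The terms moved into
        \<open>R\<close> have orders at most K in both factors.\<close>
      define R where "R = ddp (\<lambda>t. ?F t * ?G t) S - (\<Sum>l\<in>{1..K}. ddp ?F (x ` {0..l}) * ddp ?G (x ` {l..Suc K}))"
      have "{..Suc K} = insert 0 (insert (Suc K) {1..K})" by auto
      then have "ddp (\<lambda>t. ?F t * ?G t) S = ?F (x 0) * ddp ?G S + (ddp ?F S * ?G (x (Suc K)) +
          (\<Sum>l\<in>{1..K}. ddp ?F (x ` {0..l}) * ddp ?G (x ` {l..Suc K})))"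
        using ddp_Leibniz[OF x(1), of ?F ?G] x(2) by simp
      then have eq: "?F (x 0) * ddp ?G S + ddp ?F S * ?G (x (Suc K)) = R"
        by (simp add: R_def)
      have x01: "x 0 \<in> {-1..1}" "x (Suc K) \<in> {-1..1}" using sub[of "{0}"] sub[of "{Suc K}"] by auto
      have "coeffs_le A (ddp (\<lambda>t. ?F t * ?G t) S)"
        unfolding coeffs_le_def coeff_ddp using A S by (auto intro!: dd_boundedD[of "Suc K" A])
      moreover have "coeffs_le (real (card {1..K}) * (real (Suc p) * (C * C)))
          (\<Sum>l\<in>{1..K}. ddp ?F (x ` {0..l}) * ddp ?G (x ` {l..Suc K}))"
      proof (intro coeffs_le_sum coeffs_le_mult degree_ddp_roots)
        fix l assume l: "l \<in> {1..K}"
        then have "card (x ` {0..l}) \<le> Suc K" "card (x ` {l..Suc K}) \<le> Suc K"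
          using card[of "{0..l}"] card[of "{l..Suc K}"] by auto
        then show "coeffs_le C (ddp ?F (x ` {0..l}))" "coeffs_le C (ddp ?G (x ` {l..Suc K}))"
          unfolding coeffs_le_def coeff_ddp using sub[of "{0..l}"] sub[of "{l..Suc K}"] l
          by (intro allI dd_boundedD[OF low(1)] dd_boundedD[OF low(2)]; auto)+
      qed
      ultimately have M: "coeffs_le M R" unfolding R_def M_def by (intro coeffs_le_diff) auto
      have deg: "degree (P * Q) \<le> p + q" if "degree P \<le> p" "degree Q \<le> q" for P Q :: "real poly"
        using degree_mult_le[of P Q] that by linarith
      have "degree R \<le> p + q"
        unfolding eq[symmetric]
        by (intro degree_add_le deg degree_ddp_roots) (simp_all add: degree_ddp_roots)
      moreover have "\<forall>i<p. \<forall>j<q. g \<le> \<bar>\<rho> (x 0) i - \<mu> (x (Suc K)) j\<bar>"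
        using s x01 by (simp add: separated_def)
      ultimately show ?thesis
        using s x01 eq M coeff_ddp_roots[of S] S
          C1[rule_format, of "\<rho> (x 0)" "\<mu> (x (Suc K))" "ddp ?G S" "ddp ?F S" R]
          C2[rule_format, of "\<mu> (x (Suc K))" "\<rho> (x 0)" "ddp ?F S" "ddp ?G S" R]
        by (simp add: separated_def abs_minus_commute mult.commute add.commute)
    qed
    have "dd_bounded (Suc K) (max C (max C1 C2)) (\<lambda>t. coeff (H t) m)"
      if H: "dd_bounded K C (\<lambda>t. coeff (H t) m)"
        "\<And>S. S \<subseteq> {-1..1} \<Longrightarrow> finite S \<Longrightarrow> card S = Suc (Suc K) \<Longrightarrow> coeffs_le (max C1 C2) (ddp H S)" for H
      unfolding dd_bounded_def
    proof (intro allI impI, elim conjE)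
      fix S :: "real set" assume S: "S \<subseteq> {-1..1}" "S \<noteq> {}" "finite S" "card S \<le> Suc (Suc K)"
      show "\<bar>dd (\<lambda>t. coeff (H t) m) S\<bar> \<le> max C (max C1 C2)"
      proof (cases "card S = Suc (Suc K)")
        case True
        then show ?thesis using H(2)[OF S(1,3)] by (simp add: coeffs_le_def coeff_ddp le_max_iff_disj)
      next
        case False
        then show ?thesis using dd_boundedD[OF H(1) S(1,2,3)] S(4) by (simp add: le_max_iff_disj)
      qed
    qed
    then show "dd_bounded (Suc K) (max C (max C1 C2)) (\<lambda>t. coeff (?F t) m) \<and>
        dd_bounded (Suc K) (max C (max C1 C2)) (\<lambda>t. coeff (?G t) m)"
      using low top by (meson coeffs_le_mono max.cobounded1 max.cobounded2)
  qed
qed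

section \<open>Real-rooted polynomials with regular coefficients\<close>

lemma dd_bounded_bound: "dd_bounded K A u \<Longrightarrow> A \<le> B \<Longrightarrow> dd_bounded K B u"
  by (rule dd_bounded_mono) auto

text \<open>The first two Newton identities. They make the mean and the variance of the roots as
  regular as the coefficients.\<close>

lemma coeff_roots_poly_top:
  "coeff (roots_poly (Suc n) x) n = - (\<Sum>i<Suc n. x i)"
  "(\<Sum>i<Suc (Suc n). (x i)\<^sup>2) = (\<Sum>i<Suc (Suc n). x i)\<^sup>2 - 2 * coeff (roots_poly (Suc (Suc n)) x) n"
proof -
  show top: "coeff (roots_poly (Suc n) x) n = - (\<Sum>i<Suc n. x i)" for n
  proof (induction n)
    case 0
    show ?case by (simp add: roots_poly_Suc)
  next
    case (Suc n)
    have "coeff (roots_poly (Suc (Suc n)) x) (Suc n) =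
        coeff (roots_poly (Suc n) x) n - x (Suc n) * coeff (roots_poly (Suc n) x) (Suc n)"
      by (subst roots_poly_Suc) simp
    then show ?case using Suc.IH by simp
  qed
  show "(\<Sum>i<Suc (Suc n). (x i)\<^sup>2) = (\<Sum>i<Suc (Suc n). x i)\<^sup>2 - 2 * coeff (roots_poly (Suc (Suc n)) x) n"
  proof (induction n)
    case 0
    show ?case by (simp add: roots_poly_Suc power2_eq_square algebra_simps)
  next
    case (Suc n)
    have "coeff (roots_poly (Suc (Suc (Suc n))) x) (Suc n) =
        coeff (roots_poly (Suc (Suc n)) x) n - x (Suc (Suc n)) * coeff (roots_poly (Suc (Suc n)) x) (Suc n)"
      by (subst roots_poly_Suc) simp
    then show ?case
      using Suc.IH top[of "Suc n"] by (simp add: power2_eq_square algebra_simps)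
  qed
qed

text \<open>The neighbourhood of 0 may depend on \<rho>, while \<open>L\<close> is uniform. This
  leaves the freedom to zoom by a factor that depends on \<rho>.\<close>

definition slope_le :: "nat \<Rightarrow> real \<Rightarrow> (real \<Rightarrow> nat \<Rightarrow> real) \<Rightarrow> bool" where
  "slope_le n L \<rho> \<longleftrightarrow> (\<forall>i<n. \<forall>\<^sub>F t in at 0. \<bar>\<rho> t i - \<rho> 0 i\<bar> \<le> L * \<bar>t\<bar>)"

definition sorted_roots :: "nat \<Rightarrow> (real \<Rightarrow> nat \<Rightarrow> real) \<Rightarrow> bool" where
  "sorted_roots n \<rho> \<longleftrightarrow> (\<forall>t\<in>{-1..1}. \<forall>i j. i \<le> j \<and> j < n \<longrightarrow> \<rho> t i \<le> \<rho> t j) \<and>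
     (\<forall>i<n. continuous_on {-1..1} (\<lambda>t. \<rho> t i))"

definition coeffs_bounded :: "nat \<Rightarrow> real \<Rightarrow> (real \<Rightarrow> nat \<Rightarrow> real) \<Rightarrow> bool" where
  "coeffs_bounded n A \<rho> \<longleftrightarrow> (\<forall>m. dd_bounded n A (\<lambda>t. coeff (roots_poly n (\<rho> t)) m))"

section \<open>Affine normalization of the roots and rescaling of the parameter\<close>

lemma roots_poly_affine:
  assumes "r \<noteq> 0"
  shows "roots_poly n (\<lambda>i. (x i - c) / r) = smult (1 / r ^ n) (pcompose (roots_poly n x) [:c, r:])"
proof -
  have "poly (roots_poly n (\<lambda>i. (x i - c) / r)) z = poly (smult (1 / r ^ n) (pcompose (roots_poly n x) [:c, r:])) z" for z
  proof -
    have "(\<Prod>i<n. z - (x i - c) / r) = (\<Prod>i<n. (c + r * z - x i) / r)"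
      using assms by (intro prod.cong) (auto simp: field_simps)
    then show ?thesis
      by (simp add: poly_roots_poly poly_pcompose prod_dividef mult.commute)
  qed
  then show ?thesis by (simp add: poly_eq_poly_eq_iff[symmetric] fun_eq_iff)
qed


lemma ddp_pcompose: "ddp (\<lambda>t. pcompose (F t) q) S = pcompose (ddp F S) q"
  by (simp add: ddp_def pcompose_sum pcompose_smult)

lemma ddp_smult: "ddp (\<lambda>t. smult c (F t)) S = smult c (ddp F S)"
  by (rule poly_eqI) (simp add: coeff_ddp dd_cmult)

lemma ddp_scale:
  assumes "finite S" "\<theta> \<noteq> 0"
  shows "ddp (\<lambda>t. F (\<theta> * t)) S = smult (\<theta> ^ (card S - 1)) (ddp F ((\<lambda>s. \<theta> * s) ` S))"
proof (rule poly_eqI)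
  fix m
  show "coeff (ddp (\<lambda>t. F (\<theta> * t)) S) m = coeff (smult (\<theta> ^ (card S - 1)) (ddp F ((\<lambda>s. \<theta> * s) ` S))) m"
    using dd_affine[OF assms, of "\<lambda>t. coeff (F t) m" 0] by (simp add: coeff_ddp)
qed

lemma coeffs_le_pcompose:
  "\<exists>D. \<forall>p c r. degree p \<le> n \<and> coeffs_le A p \<and> \<bar>c\<bar> \<le> B \<and> \<bar>r\<bar> \<le> B \<longrightarrow> coeffs_le D (pcompose p [:c, r:])"
proof (induction n)
  case 0
  show ?case
  proof (intro exI[of _ A] allI impI, elim conjE)
    fix p :: "real poly" and c r assume "degree p \<le> 0" "coeffs_le A p"
    then show "coeffs_le A (pcompose p [:c, r:])" by (auto elim!: degree_eq_zeroE)
  qed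
next
  case (Suc n)
  then obtain D where D: "\<forall>p c r. degree p \<le> n \<and> coeffs_le A p \<and> \<bar>c\<bar> \<le> B \<and> \<bar>r\<bar> \<le> B \<longrightarrow>
     coeffs_le D (pcompose p [:c, r:])" by blast
  show ?case
  proof (intro exI[of _ "A + real (Suc 1) * (B * D)"] allI impI, elim conjE)
    fix p :: "real poly" and c r
    assume p: "degree p \<le> Suc n" "coeffs_le A p" and cr: "\<bar>c\<bar> \<le> B" "\<bar>r\<bar> \<le> B"
    obtain a q where q: "p = pCons a q" by (cases p)
    have "coeffs_le A q" unfolding coeffs_le_def
      using p(2) by (simp add: q coeffs_le_def coeff_pCons) (metis nat.simps(5))
    moreover have "degree q \<le> n" using p(1) by (auto simp: q split: if_splits)
    ultimately have "coeffs_le D (pcompose q [:c, r:])" using D cr by blast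
    moreover have "coeffs_le B [:c, r:]" 
      using cr by (auto simp: coeffs_le_def coeff_pCons split: nat.split)
    ultimately have "coeffs_le (real (Suc 1) * (B * D)) ([:c, r:] * pcompose q [:c, r:])"
      by (intro coeffs_le_mult) auto
    moreover have "coeffs_le A [:a:]"
    proof -
      have "\<bar>a\<bar> \<le> A" using p(2)[unfolded coeffs_le_def, rule_format, of 0] by (simp add: q)
      then show ?thesis using coeffs_le_mono[OF coeffs_le_const] by blast
    qed
    ultimately show "coeffs_le (A + real (Suc 1) * (B * D)) (pcompose p [:c, r:])"
      unfolding q pcompose_pCons by (intro coeffs_le_add)
  qed
qed

text \<open>The slope changes by the quotient of the two scales, so a zoom with \<theta>
  proportional to \<open>r\<close> costs a fixed constant, however small \<open>r\<close>
  is.\<close>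

lemma slope_le_rescale:
  assumes "slope_le n L (\<lambda>s i. (\<rho> (\<theta> * s) i - c) / r)" "0 < \<theta>" "0 < r"
  shows "slope_le n (L * r / \<theta>) \<rho>"
  unfolding slope_le_def
proof (intro allI impI)
  fix i assume "i < n"
  then obtain d where d: "0 < d"
    "\<And>s. s \<noteq> 0 \<Longrightarrow> \<bar>s\<bar> < d \<Longrightarrow> \<bar>(\<rho> (\<theta> * s) i - c) / r - (\<rho> 0 i - c) / r\<bar> \<le> L * \<bar>s\<bar>"
    using assms(1) unfolding slope_le_def eventually_at by (auto simp: dist_real_def)
  show "\<forall>\<^sub>F t in at 0. \<bar>\<rho> t i - \<rho> 0 i\<bar> \<le> L * r / \<theta> * \<bar>t\<bar>"
    unfolding eventually_at
  proof (intro exI[of _ "d * \<theta>"] conjI ballI impI)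
    fix t :: real assume "t \<noteq> 0 \<and> dist t 0 < d * \<theta>"
    then have "t / \<theta> \<noteq> 0" "\<bar>t / \<theta>\<bar> < d" using assms by (auto simp: dist_real_def divide_less_eq)
    from d(2)[OF this] have "\<bar>(\<rho> t i - \<rho> 0 i) / r\<bar> \<le> L * \<bar>t\<bar> / \<theta>"
      using assms by (simp add: diff_divide_distrib[symmetric])
    then show "\<bar>\<rho> t i - \<rho> 0 i\<bar> \<le> L * r / \<theta> * \<bar>t\<bar>"
      using assms by (simp add: field_simps)
  qed (use d assms in auto)
qed

lemma slope_le_mono: "slope_le n L \<rho> \<Longrightarrow> L \<le> L' \<Longrightarrow> slope_le n L' \<rho>"
  unfolding slope_le_def
proof (intro allI impI)
  fix i assume *: "\<forall>i<n. \<forall>\<^sub>F t in at 0. \<bar>\<rho> t i - \<rho> 0 i\<bar> \<le> L * \<bar>t\<bar>" "L \<le> L'" "i < n"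
  then have "\<forall>\<^sub>F t in at 0. \<bar>\<rho> t i - \<rho> 0 i\<bar> \<le> L * \<bar>t\<bar>" by blast
  then show "\<forall>\<^sub>F t in at 0. \<bar>\<rho> t i - \<rho> 0 i\<bar> \<le> L' * \<bar>t\<bar>"
    by eventually_elim (use *(2) in \<open>meson abs_ge_zero mult_right_mono order.trans\<close>)
qed

lemma sorted_roots_scale:
  assumes "sorted_roots n \<rho>" "0 \<le> \<theta>" "\<theta> \<le> 1" "0 < r"
  shows "sorted_roots n (\<lambda>s i. (\<rho> (\<theta> * s) i - c) / r)"
proof -
  have mem: "\<theta> * s \<in> {-1..1}" if "s \<in> {-1..1}" for s
    using assms(2,3) that by (rule scale_mem_symmetric_interval)
  have "continuous_on {-1..1} (\<lambda>s. \<rho> (\<theta> * s) i)" if "i < n" for i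
    using assms(1) that mem unfolding sorted_roots_def
    by (intro continuous_on_compose2[of "{-1..1}" "\<lambda>t. \<rho> t i" _ "\<lambda>s. \<theta> * s"] continuous_intros) blast+
  then show ?thesis
    using assms mem unfolding sorted_roots_def
    by (auto intro!: divide_right_mono continuous_intros)
qed

text \<open>If all n - 1 gaps were below 1/n^2, the total spread would be below 1/n. As the mean is
  0, the extreme values lie on both sides of 0, so every value would be smaller than 1/n and the sum
  of squares below 1/n, hence below 1.\<close>

lemma sorted_gap:
  fixes x :: "nat \<Rightarrow> real"
  assumes "\<And>i j. i \<le> j \<Longrightarrow> j < n \<Longrightarrow> x i \<le> x j" "(\<Sum>i<n. x i) = 0" "(\<Sum>i<n. (x i)\<^sup>2) = 1"
  shows "\<exists>p. 0 < p \<and> p < n \<and> 1 / (real n)\<^sup>2 \<le> x p - x (p - 1)"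
proof (rule ccontr)
  assume no: "\<not> ?thesis"
  have n: "0 < n" using assms(3) by (cases n) auto
  have step: "x (Suc p) - x p \<le> 1 / (real n)\<^sup>2" if "Suc p < n" for p
    using no that by (force simp: not_le)
  have "x k - x 0 \<le> k * (1 / (real n)\<^sup>2)" if "k < n" for k
    using that
  proof (induction k)
    case (Suc k)
    then have "x (Suc k) - x 0 \<le> 1 / (real n)\<^sup>2 + k * (1 / (real n)\<^sup>2)"
      using step[of k] by simp
    then show ?case by (simp add: add_divide_distrib)
  qed simp
  from this[of "n - 1"] have spread: "x (n - 1) - x 0 \<le> real (n - 1) * (1 / (real n)\<^sup>2)" using n by simp
  have "real (n - 1) * (1 / (real n)\<^sup>2) < real n * (1 / (real n)\<^sup>2)" using n by (intro mult_strict_right_mono) auto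
  also have "\<dots> = 1 / n" using n by (simp add: power2_eq_square)
  finally have spread: "x (n - 1) - x 0 < 1 / n" using spread by simp
  have "(\<Sum>i<n. x 0) \<le> (\<Sum>i<n. x i)" "(\<Sum>i<n. x i) \<le> (\<Sum>i<n. x (n - 1))"
    by (intro sum_mono assms(1); simp; linarith)+
  then have sgn: "x 0 \<le> 0" "0 \<le> x (n - 1)" using assms(2) n by (auto simp: mult_le_0_iff zero_le_mult_iff)
  have "(\<Sum>i<n. (x i)\<^sup>2) < (\<Sum>i<n. (1 / real n)\<^sup>2)"
  proof (rule sum_strict_mono)
    fix i assume "i \<in> {..<n}"
    then have "x 0 \<le> x i" "x i \<le> x (n - 1)" using assms(1)[of 0 i] assms(1)[of i "n - 1"] by auto
    then have "\<bar>x i\<bar> < 1 / n" using spread sgn by linarith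
    then show "(x i)\<^sup>2 < (1 / real n)\<^sup>2" by (simp add: abs_le_square_iff[symmetric] not_le[symmetric])
  qed (use n in auto)
  also have "\<dots> = 1 / n" using n by (simp add: power2_eq_square)
  also have "\<dots> \<le> 1" using n by simp
  finally show False using assms(3) by simp
qed

lemma negative_on_interval:
  fixes f :: "real \<Rightarrow> real"
  assumes "continuous_on {-e..e} f" "f 0 < 0" "\<And>s. s \<in> {-e..e} \<Longrightarrow> f s \<noteq> 0" "s \<in> {-e..e}"
  shows "f s < 0"
proof (rule ccontr)
  assume "\<not> f s < 0"
  then have "0 \<in> {f 0..f s}" using assms(2) by simp
  moreover have "connected (f ` {-e..e})" using assms(1) by (intro connected_continuous_image) auto
  then have "{f 0..f s} \<subseteq> f ` {-e..e}" using assms(4) by (intro connected_contains_Icc) auto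
  ultimately show False using assms(3) by auto
qed

text \<open>The gap persists for a time \<open>\<epsilon>\<close> that depends only on the bounds;
  on this time interval the polynomial splits and the induction hypothesis applies to both factors.
  No uniform modulus of continuity of the roots is available yet, so persistence is read off from
  the values of the polynomial at points inside the gap.\<close>

lemma slope_bound_split:
  assumes IH: "\<And>k A. k < n \<Longrightarrow> \<exists>L. \<forall>\<rho>. sorted_roots k \<rho> \<and> coeffs_bounded k A \<rho> \<longrightarrow> slope_le k L \<rho>"
    and p: "0 < p" "p < n" and g: "0 < g"
  shows "\<exists>L. \<forall>\<mu>. sorted_roots n \<mu> \<and> (\<forall>t\<in>{-1..1}. \<forall>i<n. \<bar>\<mu> t i\<bar> \<le> B) \<and> coeffs_bounded n A \<mu> \<and>
     g \<le> \<mu> 0 p - \<mu> 0 (p - 1) \<longrightarrow> slope_le n L \<mu>"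
proof -
  define q where "q = n - p"
  have q: "q < n" "n = p + q" using p by (auto simp: q_def)
  define E where "E = real (Suc n) * (A * (1 + (B + g)) ^ n)"
  \<comment> \<open>At the points considered the polynomial changes by at most E times the elapsed
    time, while at distance g/3 from all roots its size is at least (g/3)^n. The absolute value and
    the + 1 allow any sign of \<open>E\<close> and make the comparison strict.\<close>
  define \<epsilon> where "\<epsilon> = min 1 ((g / 3) ^ n / (\<bar>E\<bar> + 1))"
  have g3: "0 < g / 3" "0 < (g / 3) ^ n" using g by auto
  then have \<epsilon>: "0 < \<epsilon>" "\<epsilon> \<le> 1" by (auto simp: \<epsilon>_def)
  have "\<epsilon> * (\<bar>E\<bar> + 1) \<le> (g / 3) ^ n"
  proof -
    have "\<epsilon> \<le> (g / 3) ^ n / (\<bar>E\<bar> + 1)" by (simp add: \<epsilon>_def)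
    then show ?thesis by (simp add: pos_le_divide_eq)
  qed
  moreover have "\<epsilon> * E \<le> \<epsilon> * \<bar>E\<bar>" using \<epsilon>(1) by (intro mult_left_mono) auto
  ultimately have E\<epsilon>: "E * \<epsilon> < (g / 3) ^ n"
    using \<epsilon>(1) unfolding distrib_left mult.commute[of E \<epsilon>] by linarith
  obtain C where C: "\<forall>\<rho> \<mu>. separated p q B (g / 3) \<rho> \<mu> \<and>
     (\<forall>m. dd_bounded n A (\<lambda>t. coeff (roots_poly p (\<rho> t) * roots_poly q (\<mu> t)) m)) \<longrightarrow>
     (\<forall>m. dd_bounded n C (\<lambda>t. coeff (roots_poly p (\<rho> t)) m) \<and> dd_bounded n C (\<lambda>t. coeff (roots_poly q (\<mu> t)) m))"
    using dd_bounded_factors[OF g3(1)] by blast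
  obtain L1 where L1: "\<forall>\<rho>. sorted_roots p \<rho> \<and> coeffs_bounded p C \<rho> \<longrightarrow> slope_le p L1 \<rho>"
    using IH[OF p(2)] by blast
  obtain L2 where L2: "\<forall>\<rho>. sorted_roots q \<rho> \<and> coeffs_bounded q C \<rho> \<longrightarrow> slope_le q L2 \<rho>"
    using IH[OF q(1)] by blast
  show ?thesis
  proof (intro exI[of _ "max (L1 / \<epsilon>) (L2 / \<epsilon>)"] allI impI, elim conjE)
    fix \<mu> assume so: "sorted_roots n \<mu>" and B: "\<forall>t\<in>{-1..1}. \<forall>i<n. \<bar>\<mu> t i\<bar> \<le> B"
      and A: "coeffs_bounded n A \<mu>" and gap: "g \<le> \<mu> 0 p - \<mu> 0 (p - 1)"
    have mono: "\<mu> t i \<le> \<mu> t j" if "t \<in> {-1..1}" "i \<le> j" "j < n" for t i j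
      using so that by (auto simp: sorted_roots_def)
    have cont: "continuous_on {-1..1} (\<lambda>t. \<mu> t i)" if "i < n" for i
      using so that by (auto simp: sorted_roots_def)
    have nonzero: "\<mu> s i \<noteq> w"
      if s: "s \<in> {-\<epsilon>..\<epsilon>}" and i: "i < n" and w: "\<bar>w\<bar> \<le> B + g" "\<And>j. j < n \<Longrightarrow> g / 3 \<le> \<bar>w - \<mu> 0 j\<bar>" for s i w
    proof
      assume eq: "\<mu> s i = w"
      have s1: "s \<in> {-1..1}" "\<bar>s\<bar> \<le> \<epsilon>" using s \<epsilon> by auto
      have "coeffs_le (A * \<bar>s\<bar>) (roots_poly n (\<mu> s) - roots_poly n (\<mu> 0))"
        unfolding coeffs_le_def coeff_diff
      proof
        fix m show "\<bar>coeff (roots_poly n (\<mu> s)) m - coeff (roots_poly n (\<mu> 0)) m\<bar> \<le> A * \<bar>s\<bar>"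
          using dd_bounded_Lipschitz[of n A "\<lambda>t. coeff (roots_poly n (\<mu> t)) m" s 0] A s1 i
          by (auto simp: coeffs_bounded_def)
      qed
      then have "\<bar>poly (roots_poly n (\<mu> s) - roots_poly n (\<mu> 0)) w\<bar> \<le>
          real (Suc n) * (A * \<bar>s\<bar> * (1 + (B + g)) ^ n)"
        using w(1) by (intro abs_poly_le degree_diff_le) auto
      also have "\<dots> = E * \<bar>s\<bar>" by (simp add: E_def)
      finally have *: "\<bar>poly (roots_poly n (\<mu> s) - roots_poly n (\<mu> 0)) w\<bar> \<le> E * \<bar>s\<bar>" .
      have "E * \<bar>s\<bar> < (g / 3) ^ n"
      proof (cases "0 \<le> E")
        case True
        then have "E * \<bar>s\<bar> \<le> E * \<epsilon>" using s1(2) by (intro mult_left_mono)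
        then show ?thesis using E\<epsilon> by simp
      next
        case False
        then have "E * \<bar>s\<bar> \<le> 0" by (simp add: mult_nonpos_nonneg)
        then show ?thesis using g3 by linarith
      qed
      moreover have "poly (roots_poly n (\<mu> s)) w = 0"
        using eq i by (auto simp: poly_roots_poly prod_zero_iff)
      ultimately have "\<bar>poly (roots_poly n (\<mu> 0)) w\<bar> < (g / 3) ^ n" using * by simp
      moreover have "(\<Prod>j<n. g / 3) \<le> (\<Prod>j<n. \<bar>w - \<mu> 0 j\<bar>)"
        using w(2) g by (intro prod_mono) auto
      ultimately show False by (simp add: poly_roots_poly abs_prod)
    qed
    \<comment> \<open>Two barriers inside the gap. By the intermediate value theorem the lower roots
      stay below the first and the upper roots above the second, which keeps the groups g/3 apart
      even at different times.\<close>
    define w1 where "w1 = \<mu> 0 (p - 1) + g / 3"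
    define w2 where "w2 = \<mu> 0 p - g / 3"
    have w12: "g / 3 \<le> w2 - w1" using gap by (simp add: w1_def w2_def)
    have bnd0: "\<bar>\<mu> 0 (p - 1)\<bar> \<le> B" "\<bar>\<mu> 0 p\<bar> \<le> B" using B p by auto
    have w_bound: "\<bar>w1\<bar> \<le> B + g" "\<bar>w2\<bar> \<le> B + g"
      using bnd0 g unfolding w1_def w2_def by linarith+
    have far: "g / 3 \<le> \<bar>w1 - \<mu> 0 j\<bar>" "g / 3 \<le> \<bar>w2 - \<mu> 0 j\<bar>" if "j < n" for j
    proof -
      consider "j \<le> p - 1" | "p \<le> j" using p by linarith
      then have "\<mu> 0 j \<le> \<mu> 0 (p - 1) \<or> \<mu> 0 p \<le> \<mu> 0 j"
        using mono[of 0 j "p - 1"] mono[of 0 p j] that p by cases auto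
      then show "g / 3 \<le> \<bar>w1 - \<mu> 0 j\<bar>" "g / 3 \<le> \<bar>w2 - \<mu> 0 j\<bar>"
        using gap unfolding w1_def w2_def by linarith+
    qed
    have sub: "{-\<epsilon>..\<epsilon>} \<subseteq> {-1..1}" using \<epsilon> by auto
    have low: "\<mu> s (p - 1) < w1" if "s \<in> {-\<epsilon>..\<epsilon>}" for s
    proof -
      have "\<mu> s (p - 1) - w1 < 0"
      proof (rule negative_on_interval[of \<epsilon> "\<lambda>s. \<mu> s (p - 1) - w1"])
        show "continuous_on {-\<epsilon>..\<epsilon>} (\<lambda>s. \<mu> s (p - 1) - w1)"
          using p by (intro continuous_intros continuous_on_subset[OF cont sub]) auto
        fix s assume "s \<in> {-\<epsilon>..\<epsilon>}"
        then show "\<mu> s (p - 1) - w1 \<noteq> 0" using nonzero[of s "p - 1" w1] w_bound far p by auto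
      qed (use that g in \<open>auto simp: w1_def\<close>)
      then show ?thesis by simp
    qed
    have high: "w2 < \<mu> s p" if "s \<in> {-\<epsilon>..\<epsilon>}" for s
    proof -
      have "w2 - \<mu> s p < 0"
      proof (rule negative_on_interval[of \<epsilon> "\<lambda>s. w2 - \<mu> s p"])
        show "continuous_on {-\<epsilon>..\<epsilon>} (\<lambda>s. w2 - \<mu> s p)"
          using p by (intro continuous_intros continuous_on_subset[OF cont sub]) auto
        fix s assume "s \<in> {-\<epsilon>..\<epsilon>}"
        then show "w2 - \<mu> s p \<noteq> 0" using nonzero[of s p w2] w_bound far p by auto
      qed (use that g in \<open>auto simp: w2_def\<close>)
      then show ?thesis by simp
    qed
    \<comment> \<open>The trivial normalization by 0 and 1 is the form in which
      \<open>sorted_roots_scale\<close> applies.\<close>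
    define F where "F s i = (\<mu> (\<epsilon> * s) i - 0) / 1" for s i
    define G where "G s j = F s (p + j)" for s j
    have F: "F = (\<lambda>s. \<mu> (\<epsilon> * s))" and G: "G = (\<lambda>s j. \<mu> (\<epsilon> * s) (p + j))"
      by (auto simp: F_def G_def fun_eq_iff)
    have mem: "\<epsilon> * s \<in> {-\<epsilon>..\<epsilon>}" if "s \<in> {-1..1}" for s
      using that \<epsilon>(1) mult_left_mono[of s 1 \<epsilon>] mult_left_mono[of "-1" s \<epsilon>] by auto
    have "sorted_roots n F" unfolding F_def using so \<epsilon> by (intro sorted_roots_scale) auto
    then have sF: "sorted_roots p F" and sG: "sorted_roots q G"
      using q p by (auto simp: sorted_roots_def G_def)
    have "separated p q B (g / 3) F G"
      unfolding separated_def
    proof (intro conjI ballI allI impI)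
      fix t i assume "t \<in> {-1..1::real}" "i < p"
      then show "\<bar>F t i\<bar> \<le> B" using B mem[of t] sub p by (auto simp: F_def)
    next
      fix t j assume "t \<in> {-1..1::real}" "j < q"
      then show "\<bar>G t j\<bar> \<le> B" using B mem[of t] sub q by (auto simp: F_def G_def)
    next
      fix s t i j assume *: "s \<in> {-1..1::real}" "t \<in> {-1..1::real}" "i < p" "j < q"
      then have "i \<le> p - 1" "p - 1 < n" "p \<le> p + j" "p + j < n" using q p by linarith+
      then have "F s i \<le> F s (p - 1)" "G t j \<ge> F t p"
        using * q p \<open>sorted_roots n F\<close>[unfolded sorted_roots_def, THEN conjunct1, rule_format, of s i "p - 1"]
          \<open>sorted_roots n F\<close>[unfolded sorted_roots_def, THEN conjunct1, rule_format, of t p "p + j"]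
        by (auto simp: G_def)
      moreover have "F s (p - 1) < w1" "w2 < F t p"
        using low[OF mem[OF *(1)]] high[OF mem[OF *(2)]] by (auto simp: F_def)
      ultimately show "g / 3 \<le> \<bar>F s i - G t j\<bar>" using w12 by linarith
    qed
    moreover have "\<forall>m. dd_bounded n A (\<lambda>t. coeff (roots_poly p (F t) * roots_poly q (G t)) m)"
    proof
      fix m
      have eq: "roots_poly p (F t) * roots_poly q (G t) = roots_poly n (\<mu> (\<epsilon> * t))" for t
        using roots_poly_add[of p q "F t"] q(2) by (simp add: G F)
      have "dd_bounded n A (\<lambda>t. coeff (roots_poly n (\<mu> t)) m)" using A by (simp add: coeffs_bounded_def)
      then show "dd_bounded n A (\<lambda>t. coeff (roots_poly p (F t) * roots_poly q (G t)) m)"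
        unfolding eq using dd_bounded_scale[of n A "\<lambda>t. coeff (roots_poly n (\<mu> t)) m" \<epsilon>] \<epsilon> by simp
    qed
    ultimately have bd: "\<And>m. dd_bounded n C (\<lambda>t. coeff (roots_poly p (F t)) m)"
        "\<And>m. dd_bounded n C (\<lambda>t. coeff (roots_poly q (G t)) m)"
      using C by blast+
    \<comment> \<open>The factors inherit order \<open>n\<close>, which includes the order equal to
      their own degree.\<close>
    then have "coeffs_bounded p C F" "coeffs_bounded q C G"
      unfolding coeffs_bounded_def using p q by (auto intro: dd_bounded_mono[of n C])
    then have sl: "slope_le p L1 F" "slope_le q L2 G" using L1 L2 sF sG by blast+
    have "slope_le p (L1 * 1 / \<epsilon>) \<mu>"
      using sl(1) \<epsilon> by (intro slope_le_rescale[of p L1 \<mu> \<epsilon> 0 1]) (auto simp: F)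
    moreover have "slope_le q (L2 * 1 / \<epsilon>) (\<lambda>t j. \<mu> t (p + j))"
      using sl(2) \<epsilon> by (intro slope_le_rescale[of q L2 _ \<epsilon> 0 1]) (auto simp: G)
    ultimately have fin: "slope_le p (max (L1 / \<epsilon>) (L2 / \<epsilon>)) \<mu>"
        "slope_le q (max (L1 / \<epsilon>) (L2 / \<epsilon>)) (\<lambda>t j. \<mu> t (p + j))"
      using slope_le_mono[OF _ max.cobounded1] slope_le_mono[OF _ max.cobounded2] by simp_all
    show "slope_le n (max (L1 / \<epsilon>) (L2 / \<epsilon>)) \<mu>"
      unfolding slope_le_def
    proof (intro allI impI)
      fix i assume i: "i < n"
      show "\<forall>\<^sub>F t in at 0. \<bar>\<mu> t i - \<mu> 0 i\<bar> \<le> max (L1 / \<epsilon>) (L2 / \<epsilon>) * \<bar>t\<bar>"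
      proof (cases "i < p")
        case True
        then show ?thesis using fin(1) by (simp add: slope_le_def)
      next
        case False
        then have "i - p < q" "p + (i - p) = i" using i q by auto
        then show ?thesis using fin(2) unfolding slope_le_def by metis
      qed
    qed
  qed
qed


text \<open>At the nodes 0, t, -t the divided difference is the symmetric second difference over 2
  t^2. Nonnegativity permits dropping the value at -t, so a small value at 0 forces quadratic
  smallness nearby.\<close>

lemma second_difference:
  assumes "dd_bounded K A s" "2 \<le> K" "\<And>t. t \<in> {-1..1} \<Longrightarrow> 0 \<le> s t" "t \<in> {-1..1}"
  shows "s t \<le> 2 * s 0 + 2 * A * t\<^sup>2"
proof (cases "t = 0")
  case True
  then show ?thesis using assms(3)[of 0] by simp
next
  case False
  have "(0 - t) * dd s (insert 0 (insert t {- t})) = dd s {0, - t} - dd s {t, - t}"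
    by (rule dd_step) (use False in auto)
  also have "\<dots> = (s 0 - s (- t)) / t - (s t - s (- t)) / (2 * t)"
    using False by (simp add: dd_pair)
  finally have "(2 * t) * (t * dd s {0, t, - t}) = (2 * t) * ((s t - s (- t)) / (2 * t) - (s 0 - s (- t)) / t)"
    by simp
  also have "\<dots> = s t + s (- t) - 2 * s 0" using False by (simp add: field_simps)
  finally have "dd s {0, t, - t} = (s t + s (- t) - 2 * s 0) / (2 * t\<^sup>2)"
    using False by (simp add: eq_divide_eq power2_eq_square mult_ac)
  moreover have "\<bar>dd s {0, t, - t}\<bar> \<le> A"
    using assms False by (intro dd_boundedD[of K]) (auto simp: card_insert_if)
  ultimately have "(s t + s (- t) - 2 * s 0) / (2 * t\<^sup>2) \<le> A" by linarith
  then have "s t + s (- t) - 2 * s 0 \<le> A * (2 * t\<^sup>2)"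
    using False by (simp add: divide_le_eq)
  moreover have "0 \<le> s (- t)" using assms(3)[of "- t"] assms(4) by simp
  ultimately show ?thesis by simp
qed

lemma deviation_eq:
  fixes x :: "nat \<Rightarrow> real"
  shows "(\<Sum>i<n. (x i - c)\<^sup>2) = (\<Sum>i<n. (x i)\<^sup>2) - 2 * c * (\<Sum>i<n. x i) + n * c\<^sup>2"
  by (simp add: power2_diff sum.distrib sum_subtractf sum_distrib_left algebra_simps)

text \<open>Bronshtein's theorem.\<close>

theorem slope_bound:
  "\<exists>L. \<forall>\<rho>. sorted_roots n \<rho> \<and> coeffs_bounded n A \<rho> \<longrightarrow> slope_le n L \<rho>"
proof (induction n arbitrary: A rule: less_induct)
  case (less n)
  consider "n = 0" | "n = 1" | k where "n = Suc (Suc k)" by (metis One_nat_def not0_implies_Suc)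
  then show ?case
  proof cases
    case 1
    then show ?thesis by (simp add: slope_le_def)
  next
    case 2
    show ?thesis
    proof (intro exI[of _ A] allI impI, elim conjE)
      fix \<rho> assume "coeffs_bounded n A \<rho>"
      then have bd: "dd_bounded 1 A (\<lambda>t. - \<rho> t 0)"
        unfolding coeffs_bounded_def 2 by (auto simp: roots_poly_def dest: spec[of _ 0])
      show "slope_le n A \<rho>"
        unfolding slope_le_def eventually_at
      proof (intro allI impI exI[of _ 1] conjI ballI)
        fix i and t :: real assume "i < n" "t \<noteq> 0 \<and> dist t 0 < (1::real)"
        then show "\<bar>\<rho> t i - \<rho> 0 i\<bar> \<le> A * \<bar>t\<bar>"
          using dd_bounded_Lipschitz[OF bd, of t 0] 2 by (auto simp: dist_real_def abs_minus_commute abs_less_iff)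
      qed simp
    qed
  next
    case 3
    \<comment> \<open>Bounds the sum \<open>s\<close> of squared deviations of the roots from their
      mean, with all its differences, by way of the formula \<open>s_eq\<close>.\<close>
    define A2 where "A2 = \<bar>1 - 1 / real n\<bar> * (real (Suc n) * (A * A)) + \<bar>-2\<bar> * A"
    \<comment> \<open>Since r is at most 1 + A2, the time scale \<open>\<eta> * r\<close> stays at
      most 1.\<close>
    define \<eta> where "\<eta> = 1 / (1 + A2)"
    define B where "B = sqrt (2 + 2 * A2) + A"
    define g where "g = 1 / (real n)\<^sup>2"
    obtain D where D: "\<forall>p c r. degree p \<le> n \<and> coeffs_le A p \<and> \<bar>c\<bar> \<le> 1 + A + A2 \<and> \<bar>r\<bar> \<le> 1 + A + A2 \<longrightarrow>
        coeffs_le D (pcompose p [:c, r:])"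
      by (rule exE[OF coeffs_le_pcompose])
    obtain C where C: "\<forall>u. (\<forall>t\<in>{-1..1}. \<bar>u t\<bar> \<le> (1 + B) ^ n) \<and>
       (\<forall>S. finite S \<and> S \<subseteq> {-1..1} \<and> card S = Suc n \<longrightarrow> \<bar>dd u S\<bar> \<le> D) \<longrightarrow> dd_bounded n C u"
      by (rule exE[OF dd_interpolate])
    have n0: "0 < n" using 3 by simp
    have g0: "0 < g" using n0 by (simp add: g_def)
    have "\<exists>L. \<forall>\<mu>. sorted_roots n \<mu> \<and> (\<forall>t\<in>{-1..1}. \<forall>i<n. \<bar>\<mu> t i\<bar> \<le> B) \<and> coeffs_bounded n C \<mu> \<and>
       g \<le> \<mu> 0 p - \<mu> 0 (p - 1) \<longrightarrow> slope_le n L \<mu>" if "p \<in> {0<..<n}" for p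
      using less.IH that g0 by (intro slope_bound_split) auto
    then obtain L where L: "\<forall>\<mu>. sorted_roots n \<mu> \<and> (\<forall>t\<in>{-1..1}. \<forall>i<n. \<bar>\<mu> t i\<bar> \<le> B) \<and> coeffs_bounded n C \<mu> \<and>
       g \<le> \<mu> 0 p - \<mu> 0 (p - 1) \<longrightarrow> slope_le n (L p) \<mu>" if "p \<in> {0<..<n}" for p
      by metis
    \<comment> \<open>The position of the gap depends on the roots, so the constants of all
      positions are added up.\<close>
    define L0 where "L0 = (\<Sum>p\<in>{0<..<n}. \<bar>L p\<bar>)"
    show ?thesis
    proof (intro exI[of _ "max (sqrt (2 * A2) + A) (L0 / \<eta>)"] allI impI, elim conjE)
      fix \<rho> assume so: "sorted_roots n \<rho>" and cb: "coeffs_bounded n A \<rho>"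
      have A: "0 \<le> A" using cb dd_bounded_nonneg by (auto simp: coeffs_bounded_def)
      then have A2: "0 \<le> A2" by (simp add: A2_def)
      define e where "e t = (\<Sum>i<n. \<rho> t i)" for t
      define s where "s t = (\<Sum>i<n. (\<rho> t i - e t / n)\<^sup>2)" for t
      have e: "dd_bounded n A e"
      proof -
        have "e = (\<lambda>t. - 1 * coeff (roots_poly n (\<rho> t)) (Suc k))"
          by (rule ext) (simp only: e_def 3 coeff_roots_poly_top(1) mult_minus1 minus_minus)
        then show ?thesis
          using dd_bounded_cmult[of n A "\<lambda>t. coeff (roots_poly n (\<rho> t)) (Suc k)" "- 1"] cb
          by (simp add: coeffs_bounded_def)
      qed
      have s_eq: "s t = (1 - 1 / n) * (e t * e t) + (-2) * coeff (roots_poly n (\<rho> t)) k" for t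
      proof -
        have "(\<Sum>i<n. (\<rho> t i)\<^sup>2) = (e t)\<^sup>2 - 2 * coeff (roots_poly n (\<rho> t)) k"
          using coeff_roots_poly_top(2)[of "\<rho> t" k] unfolding 3 e_def .
        moreover have "n * (e t / n)\<^sup>2 = e t * e t / n" using n0 by (simp add: power2_eq_square)
        ultimately show ?thesis
          unfolding s_def deviation_eq e_def[symmetric]
          by (simp add: power2_eq_square left_diff_distrib)
      qed
      have s: "dd_bounded n A2 s"
        unfolding s_eq[abs_def] A2_def using cb
        by (intro dd_bounded_add dd_bounded_cmult dd_bounded_mult e) (simp add: coeffs_bounded_def)
      have s_nonneg: "0 \<le> s t" for t by (simp add: s_def sum_nonneg)
      define c where "c = e 0 / n"
      have c: "\<bar>c\<bar> \<le> A"
      proof -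
        have "\<bar>e 0\<bar> \<le> A" using dd_bounded_value[OF e, of 0] by simp
        also have "A \<le> A * n" using A n0 by (simp add: mult_le_cancel_left1)
        finally show ?thesis using n0 by (simp add: c_def divide_le_eq)
      qed
      \<comment> \<open>The distance to the mean at time \<open>t\<close> is controlled by the
        square root of \<open>s\<close>, hence by the second difference estimate; the last term is
        the movement of the mean.\<close>
      have dev: "\<bar>\<rho> t i - c\<bar> \<le> sqrt (2 * s 0 + 2 * A2 * t\<^sup>2) + A * \<bar>t\<bar>" if "t \<in> {-1..1}" "i < n" for t i
      proof -
        have "(\<rho> t i - e t / n)\<^sup>2 \<le> s t"
          unfolding s_def using that by (intro member_le_sum) auto
        also have "\<dots> \<le> 2 * s 0 + 2 * A2 * t\<^sup>2"
          using second_difference[OF s _ _ that(1)] s_nonneg 3 by simp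
        finally have "\<bar>\<rho> t i - e t / n\<bar> \<le> sqrt (2 * s 0 + 2 * A2 * t\<^sup>2)" by (simp add: real_le_rsqrt)
        moreover have "\<bar>e t / n - c\<bar> \<le> A * \<bar>t\<bar>"
        proof -
          have "\<bar>e t - e 0\<bar> \<le> A * \<bar>t\<bar>" using dd_bounded_Lipschitz[OF e, of t 0] that 3 by simp
          also have "\<dots> \<le> A * \<bar>t\<bar> * n"
            using mult_nonneg_nonneg[OF A abs_ge_zero[of t]] n0 by (simp add: mult_le_cancel_left1)
          finally show ?thesis using n0 by (simp add: c_def diff_divide_distrib[symmetric] divide_le_eq)
        qed
        ultimately show ?thesis by linarith
      qed
      show "slope_le n (max (sqrt (2 * A2) + A) (L0 / \<eta>)) \<rho>"
      proof (cases "s 0 = 0")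
        case True
        \<comment> \<open>All roots coincide with \<open>c\<close> at time 0, and the square root in
          \<open>dev\<close> becomes linear in the elapsed time.\<close>
        have "slope_le n (sqrt (2 * A2) + A) \<rho>"
          unfolding slope_le_def eventually_at
        proof (intro allI impI exI[of _ 1] conjI ballI)
          fix i and t :: real assume i: "i < n" and t: "t \<noteq> 0 \<and> dist t 0 < (1::real)"
          then have t1: "t \<in> {-1..1}" by (auto simp: dist_real_def)
          have "\<rho> 0 i = c" using dev[of 0 i] i True by simp
          then show "\<bar>\<rho> t i - \<rho> 0 i\<bar> \<le> (sqrt (2 * A2) + A) * \<bar>t\<bar>"
            using dev[OF t1 i] True by (simp add: real_sqrt_mult distrib_right)
        qed simp
        then show ?thesis by (rule slope_le_mono) simp
      next
        case False
        define r where "r = sqrt (s 0)"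
        have r: "0 < r" "r\<^sup>2 = s 0" using False s_nonneg[of 0] by (auto simp: r_def)
        have "s 0 \<le> A2" using dd_bounded_value[OF s, of 0] by simp
        moreover have "r \<le> 1 + r\<^sup>2"
        proof -
          have "0 \<le> (r - 1)\<^sup>2" by simp
          then show ?thesis using r(1) unfolding power2_diff by simp
        qed
        ultimately have r1: "r \<le> 1 + A2" using r by simp
        have \<eta>: "0 < \<eta>" "\<eta> \<le> 1" "\<eta> * r \<le> 1" using A2 r1 by (auto simp: \<eta>_def)
        \<comment> \<open>With a time scale proportional to \<open>r\<close>, the term with
          \<open>A2\<close> in \<open>dev\<close> is comparable to \<open>s 0\<close>, so the
          normalized roots stay bounded by \<open>B\<close>.\<close>
        define \<theta> where "\<theta> = \<eta> * r"
        have \<theta>: "0 < \<theta>" "\<theta> \<le> 1" using \<eta> r by (auto simp: \<theta>_def)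
        define \<mu> where "\<mu> t i = (\<rho> (\<theta> * t) i - c) / r" for t i
        have mem: "\<theta> * t \<in> {-1..1}" if "t \<in> {-1..1}" for t
          using less_imp_le[OF \<theta>(1)] \<theta>(2) that by (rule scale_mem_symmetric_interval)
        have bound: "\<bar>\<mu> t i\<bar> \<le> B" if "t \<in> {-1..1}" "i < n" for t i
        proof -
          have t1: "\<bar>t\<bar> \<le> 1" using that by (auto simp: abs_le_iff)
          have "\<bar>\<eta> * t\<bar> \<le> 1" using \<eta> t1 by (simp add: abs_mult mult_le_one)
          then have sq: "(\<eta> * t)\<^sup>2 \<le> 1" by (simp add: abs_square_le_1)
          have "2 * s 0 + 2 * A2 * (\<theta> * t)\<^sup>2 = (2 + 2 * A2 * (\<eta> * t)\<^sup>2) * r\<^sup>2"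
            by (simp add: \<theta>_def r(2)[symmetric] power_mult_distrib algebra_simps)
          also have "\<dots> \<le> (2 + 2 * A2) * r\<^sup>2"
            using sq A2 by (intro mult_right_mono) (auto simp: mult_le_cancel_left2)
          finally have "sqrt (2 * s 0 + 2 * A2 * (\<theta> * t)\<^sup>2) \<le> sqrt ((2 + 2 * A2) * r\<^sup>2)" by simp
          also have "\<dots> = sqrt (2 + 2 * A2) * r" using r(1) by (simp add: real_sqrt_mult)
          finally have "\<bar>\<rho> (\<theta> * t) i - c\<bar> \<le> sqrt (2 + 2 * A2) * r + A * \<bar>\<theta> * t\<bar>"
            using dev[OF mem[OF that(1)] that(2)] by linarith
          also have "A * \<bar>\<theta> * t\<bar> \<le> A * r"
          proof (rule mult_left_mono[OF _ A])
            have "\<bar>\<theta> * t\<bar> = \<bar>\<eta> * t\<bar> * r" using r by (simp add: \<theta>_def abs_mult)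
            also have "\<dots> \<le> 1 * r" using \<open>\<bar>\<eta> * t\<bar> \<le> 1\<close> r by (intro mult_right_mono) auto
            finally show "\<bar>\<theta> * t\<bar> \<le> r" by simp
          qed
          finally have "\<bar>\<rho> (\<theta> * t) i - c\<bar> \<le> B * r" by (simp add: B_def distrib_right)
          then show ?thesis using r by (simp add: \<mu>_def divide_le_eq)
        qed
        \<comment> \<open>Only the sup norm and the top order are estimated. In top order \<theta>^n
          from the nodes meets 1/r^n from the roots and leaves \<eta>^n; a lower order would leave a
          negative power of \<open>r\<close>.\<close>
        have "coeffs_bounded n C \<mu>"
          unfolding coeffs_bounded_def
        proof (intro allI C[rule_format] conjI ballI impI)
          fix m t assume "t \<in> {-1..1::real}"
          then show "\<bar>coeff (roots_poly n (\<mu> t)) m\<bar> \<le> (1 + B) ^ n"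
            using coeffs_le_roots_poly[of n "\<mu> t" B] bound by (auto simp: coeffs_le_def)
        next
          fix m S assume S: "finite S \<and> S \<subseteq> {-1..1::real} \<and> card S = Suc n"
          let ?P = "\<lambda>t. roots_poly n (\<rho> t)" and ?S = "(\<lambda>t. \<theta> * t) ` S"
          have "roots_poly n (\<mu> t) = smult (1 / r ^ n) (pcompose (?P (\<theta> * t)) [:c, r:])" for t
            unfolding \<mu>_def using r by (intro roots_poly_affine) auto
          then have "ddp (\<lambda>t. roots_poly n (\<mu> t)) S =
              smult (1 / r ^ n) (pcompose (ddp (\<lambda>t. ?P (\<theta> * t)) S) [:c, r:])"
            by (simp add: ddp_smult ddp_pcompose)
          also have "ddp (\<lambda>t. ?P (\<theta> * t)) S = smult (\<theta> ^ n) (ddp ?P ?S)"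
            using S \<theta> by (subst ddp_scale) auto
          finally have "ddp (\<lambda>t. roots_poly n (\<mu> t)) S = smult (\<eta> ^ n) (pcompose (ddp ?P ?S) [:c, r:])"
            using r(1) by (simp add: pcompose_smult \<theta>_def power_mult_distrib)
          moreover have "coeffs_le D (pcompose (ddp ?P ?S) [:c, r:])"
          proof (intro D[rule_format] conjI degree_ddp_roots)
            have inj: "inj_on (\<lambda>t. \<theta> * t) S" using \<theta> by (auto simp: inj_on_def)
            show "coeffs_le A (ddp ?P ?S)"
              unfolding coeffs_le_def coeff_ddp
            proof
              fix m
              show "\<bar>dd (\<lambda>t. coeff (?P t) m) ?S\<bar> \<le> A"
                using cb mem S card_image[OF inj]
                by (intro dd_boundedD[of n]) (auto simp: coeffs_bounded_def)
            qed
            show "\<bar>c\<bar> \<le> 1 + A + A2" "\<bar>r\<bar> \<le> 1 + A + A2" using c r r1 A A2 by auto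
          qed
          ultimately have "coeffs_le (\<bar>\<eta> ^ n\<bar> * D) (ddp (\<lambda>t. roots_poly n (\<mu> t)) S)"
            and D0: "0 \<le> D"
            using coeffs_le_smult coeffs_le_nonneg by auto
          moreover have "\<bar>\<eta> ^ n\<bar> * D \<le> D"
            using \<eta> D0 by (simp add: mult_left_le_one_le power_le_one)
          ultimately have "coeffs_le D (ddp (\<lambda>t. roots_poly n (\<mu> t)) S)" by (elim coeffs_le_mono)
          then show "\<bar>dd (\<lambda>t. coeff (roots_poly n (\<mu> t)) m) S\<bar> \<le> D"
            by (simp add: coeffs_le_def coeff_ddp)
        qed
        moreover have so': "sorted_roots n \<mu>"
          unfolding \<mu>_def using so \<theta> r by (intro sorted_roots_scale) auto
        moreover obtain p where p: "0 < p" "p < n" "g \<le> \<mu> 0 p - \<mu> 0 (p - 1)"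
        proof -
          have "(\<Sum>i<n. \<mu> 0 i) = ((\<Sum>i<n. \<rho> 0 i) - n * c) / r"
            by (simp add: \<mu>_def sum_divide_distrib[symmetric] sum_subtractf)
          also have "\<dots> = 0" using n0 by (simp add: c_def e_def)
          finally have s0: "(\<Sum>i<n. \<mu> 0 i) = 0" .
          have "(\<Sum>i<n. (\<mu> 0 i)\<^sup>2) = (\<Sum>i<n. (\<rho> 0 i - c)\<^sup>2) / r\<^sup>2"
            by (simp add: \<mu>_def power_divide sum_divide_distrib[symmetric])
          also have "\<dots> = 1" using r False by (simp add: c_def s_def)
          finally have s1: "(\<Sum>i<n. (\<mu> 0 i)\<^sup>2) = 1" .
          have "\<exists>p. 0 < p \<and> p < n \<and> 1 / (real n)\<^sup>2 \<le> \<mu> 0 p - \<mu> 0 (p - 1)"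
            using so' s0 s1 by (intro sorted_gap) (auto simp: sorted_roots_def)
          then show ?thesis using that by (auto simp: g_def)
        qed
        ultimately have "slope_le n (L p) \<mu>"
          using L[of p, THEN spec, THEN mp, of \<mu>] bound by simp
        moreover have "L p \<le> L0"
        proof -
          have "\<bar>L p\<bar> \<le> L0" unfolding L0_def using p by (intro member_le_sum) auto
          then show ?thesis by simp
        qed
        ultimately have "slope_le n L0 \<mu>" by (rule slope_le_mono)
        then have "slope_le n (L0 * r / \<theta>) \<rho>"
          using \<theta> r unfolding \<mu>_def by (intro slope_le_rescale) auto
        \<comment> \<open>The spread cancels, which makes the slope bound uniform.\<close>
        moreover have "L0 * r / \<theta> = L0 / \<eta>" using r by (simp add: \<theta>_def)
        ultimately have "slope_le n (L0 / \<eta>) \<rho>" by simp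
        then show ?thesis by (rule slope_le_mono) simp
      qed
    qed
  qed
qed

section \<open>Weak limits of bounded sequences\<close>

text \<open>Midpoints are all that the parallelogram law asks for, and every property stable under
  them passes from the tail to the hull by induction.\<close>

inductive_set midpoint_hull :: "(nat \<Rightarrow> 'a \<Rightarrow> real) \<Rightarrow> nat \<Rightarrow> ('a \<Rightarrow> real) set" for f N where
  base: "N \<le> k \<Longrightarrow> f k \<in> midpoint_hull f N"
| midpoint: "g \<in> midpoint_hull f N \<Longrightarrow> h \<in> midpoint_hull f N \<Longrightarrow> (\<lambda>x. (g x + h x) / 2) \<in> midpoint_hull f N"

lemma midpoint_hull_antimono: "g \<in> midpoint_hull f M \<Longrightarrow> N \<le> M \<Longrightarrow> g \<in> midpoint_hull f N"
  by (induction rule: midpoint_hull.induct) (auto intro: midpoint_hull.intros)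

lemma midpoint_hull_measurable:
  "g \<in> midpoint_hull f N \<Longrightarrow> (\<And>k. f k \<in> borel_measurable M) \<Longrightarrow> g \<in> borel_measurable M"
  by (induction rule: midpoint_hull.induct) auto

lemma midpoint_hull_bounded:
  "g \<in> midpoint_hull f N \<Longrightarrow> (\<And>k. \<bar>f k x\<bar> \<le> L) \<Longrightarrow> \<bar>g x\<bar> \<le> L"
proof (induction rule: midpoint_hull.induct)
  case (midpoint g h)
  then have "\<bar>g x\<bar> \<le> L" "\<bar>h x\<bar> \<le> L" by auto
  then show ?case by (simp add: abs_le_iff)
qed auto

text \<open>The sum of the increments has finite integral, so almost everywhere the increments are
  absolutely summable and the sequence telescopes.\<close>

lemma AE_convergent_of_summable:
  fixes g :: "nat \<Rightarrow> 'a \<Rightarrow> real"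
  assumes meas: "\<And>i. g i \<in> borel_measurable M" and int: "\<And>i. integrable M (\<lambda>x. \<bar>g (Suc i) x - g i x\<bar>)"
    and sm: "summable (\<lambda>i. \<integral>x. \<bar>g (Suc i) x - g i x\<bar> \<partial>M)"
  shows "AE x in M. convergent (\<lambda>i. g i x)"
proof -
  note [measurable] = meas
  have "(\<integral>\<^sup>+x. (\<Sum>i. ennreal \<bar>g (Suc i) x - g i x\<bar>) \<partial>M) = (\<Sum>i. \<integral>\<^sup>+x. ennreal \<bar>g (Suc i) x - g i x\<bar> \<partial>M)"
    by (rule nn_integral_suminf) measurable
  also have "\<dots> = (\<Sum>i. ennreal (\<integral>x. \<bar>g (Suc i) x - g i x\<bar> \<partial>M))"
    using int by (intro suminf_cong nn_integral_eq_integral) auto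
  also have "\<dots> = ennreal (\<Sum>i. \<integral>x. \<bar>g (Suc i) x - g i x\<bar> \<partial>M)"
    using sm by (intro suminf_ennreal2) auto
  finally have "(\<integral>\<^sup>+x. (\<Sum>i. ennreal \<bar>g (Suc i) x - g i x\<bar>) \<partial>M) \<noteq> \<infinity>" by simp
  then have "AE x in M. (\<Sum>i. ennreal \<bar>g (Suc i) x - g i x\<bar>) \<noteq> \<infinity>"
    by (intro nn_integral_noteq_infinite) measurable
  then show ?thesis
  proof eventually_elim
    case (elim x)
    then have "summable (\<lambda>i. \<bar>g (Suc i) x - g i x\<bar>)"
      by (intro summable_suminf_not_top) (auto simp: infinity_ennreal_def)
    then have "summable (\<lambda>i. g (Suc i) x - g i x)" by (rule summable_rabs_cancel)
    then have "convergent (\<lambda>n. \<Sum>i<n. g (Suc i) x - g i x)" by (simp add: summable_iff_convergent)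
    then have "convergent (\<lambda>n. g n x - g 0 x)"
      using sum_lessThan_telescope[of "\<lambda>i. g i x"] by simp
    then have "convergent (\<lambda>n. (g n x - g 0 x) + g 0 x)"
      by (intro convergent_add convergent_const)
    then show ?case by simp
  qed
qed

text \<open>By the parallelogram law, almost minimizers of the \<open>L\<^sup>2\<close> norm over the hulls of the tails form a
  Cauchy sequence. This replaces weak compactness of balls in \<open>L\<^sup>\<infinity>\<close>.\<close>

lemma bounded_sequence_weak_limit:
  fixes f :: "nat \<Rightarrow> 'a \<Rightarrow> real"
  assumes fin: "finite_measure M" and meas: "\<And>k. f k \<in> borel_measurable M" and bd: "\<And>k x. \<bar>f k x\<bar> \<le> L"
  shows "\<exists>v\<in>borel_measurable M. (\<forall>x. \<bar>v x\<bar> \<le> L) \<and>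
    (\<forall>\<psi> l. integrable M \<psi> \<longrightarrow> (\<lambda>k. \<integral>x. f k x * \<psi> x \<partial>M) \<longlonglongrightarrow> l \<longrightarrow> (\<integral>x. v x * \<psi> x \<partial>M) = l)"
proof -
  interpret finite_measure M by fact
  have L: "0 \<le> L" using bd[of 0 undefined] by (meson abs_ge_zero order.trans)
  define q where "q g = (\<integral>x. (g x)\<^sup>2 \<partial>M)" for g :: "'a \<Rightarrow> real"
  define H :: "nat \<Rightarrow> ('a \<Rightarrow> real) set" where "H = midpoint_hull f"
  have Hm [measurable]: "g \<in> borel_measurable M" and Hb: "\<bar>g x\<bar> \<le> L" if "g \<in> H N" for g N x
    using that midpoint_hull_measurable[of g f N M] meas midpoint_hull_bounded[of g f N x L] bd by (auto simp: H_def)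
  have int_bd: "integrable M g" if "g \<in> borel_measurable M" "\<And>x. \<bar>g x\<bar> \<le> K" for g :: "'a \<Rightarrow> real" and K
    using that by (intro integrable_const_bound[of _ K]) auto
  have sq: "integrable M (\<lambda>x. (a * g x + b * h x)\<^sup>2)" if "g \<in> H N" "h \<in> H N'" for g h N N' a b
  proof (rule int_bd)
    note [measurable] = Hm[OF that(1)] Hm[OF that(2)]
    show "(\<lambda>x. (a * g x + b * h x)\<^sup>2) \<in> borel_measurable M" by measurable
    fix x
    have "\<bar>a * g x + b * h x\<bar> \<le> \<bar>a\<bar> * \<bar>g x\<bar> + \<bar>b\<bar> * \<bar>h x\<bar>" by (simp add: abs_mult[symmetric] abs_triangle_ineq)
    also have "\<dots> \<le> \<bar>a\<bar> * L + \<bar>b\<bar> * L" using Hb that by (intro add_mono mult_left_mono) auto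
    finally show "\<bar>(a * g x + b * h x)\<^sup>2\<bar> \<le> (\<bar>a\<bar> * L + \<bar>b\<bar> * L)\<^sup>2"
      using power_mono[of "\<bar>a * g x + b * h x\<bar>" "\<bar>a\<bar> * L + \<bar>b\<bar> * L" 2] by simp
  qed
  have sq1: "integrable M (\<lambda>x. (g x)\<^sup>2)" if "g \<in> H N" for g N
    using sq[OF that that, of 1 0] by simp
  define K where "K = L\<^sup>2 * measure M (space M)"
  have qK: "0 \<le> q g" "q g \<le> K" if "g \<in> H N" for g N
  proof -
    show "0 \<le> q g" by (simp add: q_def)
    have "q g \<le> (\<integral>x. L\<^sup>2 \<partial>M)"
      unfolding q_def using Hb[OF that] sq1[OF that] L
      by (intro integral_mono) (auto simp: abs_le_square_iff[symmetric])
    then show "q g \<le> K" by (simp add: K_def mult.commute)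
  qed
  \<comment> \<open>The hulls shrink, so these infima increase to a limit. Members of late hulls
    that nearly attain it have midpoints of almost minimal norm as well.\<close>
  define d where "d N = Inf (q ` H N)" for N
  have ne: "q ` H N \<noteq> {}" and bdd: "bdd_below (q ` H N)" for N
    using qK(1) midpoint_hull.base[of N N f] by (auto simp: H_def intro!: bdd_belowI[of _ 0])
  have d_le: "d N \<le> q g" if "g \<in> H N" for g N
    unfolding d_def using bdd that by (intro cInf_lower) auto
  have "incseq d"
    unfolding incseq_def d_def
    by (intro allI impI cInf_superset_mono ne bdd image_mono subsetI) (auto simp: H_def intro: midpoint_hull_antimono)
  moreover have "d N \<le> K" for N
    using d_le[of "f N" N] qK(2)[of "f N" N] midpoint_hull.base[of N N f] by (simp add: H_def)
  ultimately obtain D where D: "d \<longlonglongrightarrow> D" "\<And>N. d N \<le> D"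
    using incseq_convergent[of d K] by blast
  have "\<exists>g N. i \<le> N \<and> g \<in> H N \<and> q g < D + (1/4) ^ i \<and> D - (1/4) ^ i < d N" for i
  proof -
    have "\<forall>\<^sub>F N in sequentially. D - (1/4) ^ i < d N"
      using D(1) by (rule order_tendstoD) simp
    then obtain N where N: "i \<le> N" "D - (1/4) ^ i < d N"
      by (metis eventually_at_top_linorder nle_le)
    have "Inf (q ` H N) < D + (1/4) ^ i"
      using D(2)[of N] by (simp add: d_def add_strict_increasing2 le_less_trans)
    then obtain g where "g \<in> H N" "q g < D + (1/4) ^ i"
      using cInf_lessD[OF ne] by blast
    then show ?thesis using N by blast
  qed
  then obtain g N where gN: "\<And>i. i \<le> N i" "\<And>i. g i \<in> H (N i)" "\<And>i. q (g i) < D + (1/4) ^ i"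
      "\<And>i. D - (1/4) ^ i < d (N i)" by metis
  note [measurable] = Hm[OF gN(2)]
  have gH: "g i \<in> H j" if "j \<le> i" for i j
    using midpoint_hull_antimono[of "g i" f "N i" j] gN(1)[of i] gN(2)[of i] that by (auto simp: H_def)
  have dist: "(\<integral>x. (g (Suc i) x - g i x)\<^sup>2 \<partial>M) \<le> 8 * (1/4) ^ i" for i
  proof -
    \<comment> \<open>The chosen tail indices need not be monotone; the smaller of the two gives a
      hull that contains both functions and their midpoint.\<close>
    define n where "n = min (N i) (N (Suc i))"
    have n: "g i \<in> H n" "g (Suc i) \<in> H n"
      using gN(2)[of i] gN(2)[of "Suc i"] midpoint_hull_antimono unfolding H_def n_def by (metis min.cobounded1 min.cobounded2)+
    have dn: "D - (1/4) ^ i < d n"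
    proof -
      have "(1/4) ^ Suc i \<le> ((1/4) ^ i :: real)" by simp
      then have "D - (1/4) ^ i < d (N (Suc i))" using gN(4)[of "Suc i"] by linarith
      then show ?thesis using gN(4)[of i] by (simp add: n_def min_def)
    qed
    have "(\<lambda>x. (g (Suc i) x + g i x) / 2) \<in> H n" using n by (auto simp: H_def intro: midpoint_hull.midpoint)
    then have "d n \<le> q (\<lambda>x. (g (Suc i) x + g i x) / 2)" by (rule d_le)
    moreover have "(\<integral>x. (g (Suc i) x - g i x)\<^sup>2 \<partial>M) =
        2 * q (g (Suc i)) + 2 * q (g i) - 4 * q (\<lambda>x. (g (Suc i) x + g i x) / 2)"
    proof -
      have "(\<integral>x. (g (Suc i) x - g i x)\<^sup>2 \<partial>M) =
         (\<integral>x. 2 * (g (Suc i) x)\<^sup>2 + 2 * (g i x)\<^sup>2 - 4 * ((1/2) * g (Suc i) x + (1/2) * g i x)\<^sup>2 \<partial>M)"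
        by (intro Bochner_Integration.integral_cong) (auto simp: power2_eq_square algebra_simps)
      also have "\<dots> = 2 * q (g (Suc i)) + 2 * q (g i) - 4 * (\<integral>x. ((1/2) * g (Suc i) x + (1/2) * g i x)\<^sup>2 \<partial>M)"
        using sq[OF n(2,1), of "1/2" "1/2"] sq1[OF n(1)] sq1[OF n(2)] by (simp add: q_def)
      also have "(\<lambda>x. ((1/2) * g (Suc i) x + (1/2) * g i x)\<^sup>2) = (\<lambda>x. ((g (Suc i) x + g i x) / 2)\<^sup>2)"
        by (auto simp: add_divide_distrib)
      finally show ?thesis by (simp add: q_def)
    qed
    moreover have "(1/4) ^ Suc i \<le> ((1/4) ^ i :: real)" by simp
    ultimately show ?thesis using dn gN(3)[of i] gN(3)[of "Suc i"] by linarith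
  qed
  have sqi: "integrable M (\<lambda>x. (g (Suc i) x - g i x)\<^sup>2)" for i
    using sq[OF gN(2) gN(2), of 1 "Suc i" "-1" i] by simp
  have absi: "integrable M (\<lambda>x. \<bar>g (Suc i) x - g i x\<bar>)" for i
  proof (rule int_bd)
    fix x
    have "\<bar>g (Suc i) x\<bar> \<le> L" "\<bar>g i x\<bar> \<le> L" using Hb gN(2) by auto
    then show "\<bar>\<bar>g (Suc i) x - g i x\<bar>\<bar> \<le> 2 * L" by linarith
  qed measurable
  have l1: "(\<integral>x. \<bar>g (Suc i) x - g i x\<bar> \<partial>M) \<le> (8 + measure M (space M)) * (1/2) ^ i" for i
  proof -
    \<comment> \<open>Passes from squares to absolute values without Cauchy-Schwarz: the weight 2^i
      against the bound 8 (1/4)^i leaves a summable term of order (1/2)^i.\<close>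
    have "\<bar>a\<bar> \<le> 2 ^ i * a\<^sup>2 + (1/2) ^ i" for a :: real
    proof -
      have "0 \<le> (2 ^ i * \<bar>a\<bar> - 1)\<^sup>2" by simp
      then have "2 * (2 ^ i * \<bar>a\<bar>) \<le> (2 ^ i)\<^sup>2 * a\<^sup>2 + 1"
        by (simp add: power2_diff power_mult_distrib)
      moreover have "0 \<le> 2 ^ i * \<bar>a\<bar>" by simp
      ultimately have "2 ^ i * \<bar>a\<bar> \<le> (2 ^ i)\<^sup>2 * a\<^sup>2 + 1" by linarith
      then have "2 ^ i * \<bar>a\<bar> \<le> 2 ^ i * (2 ^ i * a\<^sup>2 + (1/2) ^ i)"
        by (simp add: power2_eq_square algebra_simps power_one_over)
      then show ?thesis by simp
    qed
    then have "(\<integral>x. \<bar>g (Suc i) x - g i x\<bar> \<partial>M) \<le> (\<integral>x. 2 ^ i * (g (Suc i) x - g i x)\<^sup>2 + (1/2) ^ i \<partial>M)"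
      using absi sqi by (intro integral_mono) auto
    also have "\<dots> = 2 ^ i * (\<integral>x. (g (Suc i) x - g i x)\<^sup>2 \<partial>M) + measure M (space M) * (1/2) ^ i"
      using sqi by simp
    also have "\<dots> \<le> 2 ^ i * (8 * (1/4) ^ i) + measure M (space M) * (1/2) ^ i"
      using dist[of i] by simp
    also have "2 ^ i * (8 * (1/4) ^ i) = 8 * (1/2 :: real) ^ i"
      by (simp add: power_mult_distrib[symmetric])
    finally show ?thesis by (simp add: distrib_right)
  qed
  have "summable (\<lambda>i. \<integral>x. \<bar>g (Suc i) x - g i x\<bar> \<partial>M)"
    by (rule summable_comparison_test'[of "\<lambda>i. (8 + measure M (space M)) * (1/2) ^ i" 0])
      (use l1 in \<open>auto intro: summable_mult summable_geometric\<close>)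
  then have conv: "AE x in M. convergent (\<lambda>i. g i x)"
    using absi by (intro AE_convergent_of_summable) auto
  \<comment> \<open>The truncation gives the bound also at the points where the sequence does not
    converge.\<close>
  define v where "v x = max (- L) (min L (lim (\<lambda>i. g i x)))" for x
  have v_meas [measurable]: "v \<in> borel_measurable M" unfolding v_def by measurable
  have lim: "AE x in M. (\<lambda>i. g i x) \<longlonglongrightarrow> v x"
    using conv
  proof eventually_elim
    case (elim x)
    then have *: "(\<lambda>i. g i x) \<longlonglongrightarrow> lim (\<lambda>i. g i x)" by (simp add: convergent_LIMSEQ_iff)
    have "g i x \<le> L" "- L \<le> g i x" for i using Hb[OF gN(2), of i x] by auto
    then have "lim (\<lambda>i. g i x) \<le> L" "- L \<le> lim (\<lambda>i. g i x)"
      using LIMSEQ_le_const2[OF *] LIMSEQ_le_const[OF *] by auto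
    then show ?case using * by (simp add: v_def)
  qed
  have "(\<integral>x. v x * \<psi> x \<partial>M) = l"
    if \<psi>: "integrable M \<psi>" and l: "(\<lambda>k. \<integral>x. f k x * \<psi> x \<partial>M) \<longlonglongrightarrow> l" for \<psi> l
  proof -
    have [measurable]: "\<psi> \<in> borel_measurable M" using \<psi> by simp
    have intH: "integrable M (\<lambda>x. h x * \<psi> x)" if "h \<in> H n" for h n
    proof (rule Bochner_Integration.integrable_bound[of M "\<lambda>x. L * \<psi> x"])
      note [measurable] = Hm[OF that]
      show "(\<lambda>x. h x * \<psi> x) \<in> borel_measurable M" by measurable
      show "AE x in M. norm (h x * \<psi> x) \<le> norm (L * \<psi> x)"
        using Hb[OF that] L by (auto simp: abs_mult intro!: mult_right_mono)
    qed (use \<psi> in simp)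
    have "(\<lambda>i. \<integral>x. g i x * \<psi> x \<partial>M) \<longlonglongrightarrow> (\<integral>x. v x * \<psi> x \<partial>M)"
    proof (rule integral_dominated_convergence[where w = "\<lambda>x. L * \<bar>\<psi> x\<bar>"])
      show "AE x in M. (\<lambda>i. g i x * \<psi> x) \<longlonglongrightarrow> v x * \<psi> x"
        using lim by eventually_elim (intro tendsto_mult tendsto_const)
      show "AE x in M. norm (g i x * \<psi> x) \<le> L * \<bar>\<psi> x\<bar>" for i
        using Hb[OF gN(2)] by (auto simp: abs_mult intro!: mult_right_mono)
    qed (use \<psi> in auto)
    moreover have "(\<lambda>i. \<integral>x. g i x * \<psi> x \<partial>M) \<longlonglongrightarrow> l"
    proof (rule LIMSEQ_I)
      fix e :: real assume e: "0 < e"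
      then obtain n where n: "\<And>k. n \<le> k \<Longrightarrow> \<bar>(\<integral>x. f k x * \<psi> x \<partial>M) - l\<bar> < e"
        using LIMSEQ_D[OF l e] by auto
      \<comment> \<open>An interval around \<open>l\<close> is closed under midpoints, so
        convergence along \<open>f\<close> passes to the hulls of its tails.\<close>
      have "\<bar>(\<integral>x. h x * \<psi> x \<partial>M) - l\<bar> < e" if "h \<in> midpoint_hull f n" for h
        using that
      proof (induction rule: midpoint_hull.induct)
        case (base k)
        then show ?case using n by simp
      next
        case (midpoint h1 h2)
        have "(\<integral>x. (h1 x + h2 x) / 2 * \<psi> x \<partial>M) = ((\<integral>x. h1 x * \<psi> x \<partial>M) + (\<integral>x. h2 x * \<psi> x \<partial>M)) / 2"
          using intH[of h1 n] intH[of h2 n] midpoint by (simp add: H_def add_divide_distrib distrib_right)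
        then show ?case using midpoint.IH by (simp add: abs_less_iff field_simps)
      qed
      then show "\<exists>no. \<forall>i\<ge>no. norm ((\<integral>x. g i x * \<psi> x \<partial>M) - l) < e"
        using gH by (auto simp: H_def)
    qed
    ultimately show ?thesis by (rule LIMSEQ_unique)
  qed
  moreover have "\<bar>v x\<bar> \<le> L" for x using L by (auto simp: v_def)
  ultimately show ?thesis by (intro bexI[OF _ v_meas] conjI allI impI)
qed

section \<open>Test functions and the fundamental lemma\<close>

text \<open>The functions \<open>flat p\<close> are closed under differentiation, and \<open>flat 1\<close> is the standard
  smooth function that is flat at \<open>0\<close>.\<close>

definition flat :: "real poly \<Rightarrow> real \<Rightarrow> real" where
  "flat p t = (if 0 < t then poly p (1 / t) * exp (- (1 / t)) else 0)"

text \<open>With y = 1/t the chain rule gives y^2 (p(y) - p'(y)) exp(-y), again a polynomial in y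
  times exp(-y).\<close>

definition flat_deriv :: "real poly \<Rightarrow> real poly" where
  "flat_deriv p = [:0, 0, 1:] * (p - pderiv p)"

lemma poly_exp_tendsto_0:
  fixes p :: "real poly"
  shows "((\<lambda>y. poly p y * exp (- y)) \<longlongrightarrow> 0) at_top"
proof -
  have "((\<lambda>y. \<Sum>i\<le>degree p. coeff p i * (y ^ i / exp y)) \<longlongrightarrow> (\<Sum>i\<le>degree p. coeff p i * 0)) at_top"
    by (intro tendsto_sum tendsto_mult tendsto_const tendsto_power_div_exp_0)
  then show ?thesis
    by (simp add: poly_altdef exp_minus divide_inverse sum_distrib_right mult.assoc)
qed

lemma flat_has_derivative: "(flat p has_real_derivative flat (flat_deriv p) t) (at t)"
proof -
  consider "0 < t" | "t < 0" | "t = 0" by linarith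
  then show ?thesis
  proof cases
    case 1
    have "((\<lambda>t. poly p (1 / t) * exp (- (1 / t))) has_real_derivative
        poly (pderiv p) (1 / t) * (- (1 / t\<^sup>2)) * exp (- (1 / t)) + poly p (1 / t) * (exp (- (1 / t)) * (1 / t\<^sup>2))) (at t)"
    proof -
      have d: "((\<lambda>t. 1 / t) has_real_derivative - (1 / t\<^sup>2)) (at t)"
        using 1 by (auto intro!: derivative_eq_intros simp: power2_eq_square)
      have "((\<lambda>t. poly p (1 / t)) has_real_derivative poly (pderiv p) (1 / t) * (- (1 / t\<^sup>2))) (at t)"
        by (rule DERIV_chain'[OF d poly_DERIV, THEN DERIV_cong]) simp
      moreover have "((\<lambda>t. exp (- (1 / t))) has_real_derivative exp (- (1 / t)) * (1 / t\<^sup>2)) (at t)"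
        by (rule DERIV_cong[OF DERIV_fun_exp[OF DERIV_minus[OF d]]]) simp
      ultimately show ?thesis
        by (rule DERIV_cong[OF DERIV_mult]) simp
    qed
    moreover have "poly (pderiv p) (1 / t) * (- (1 / t\<^sup>2)) * exp (- (1 / t)) + poly p (1 / t) * (exp (- (1 / t)) * (1 / t\<^sup>2))
        = flat (flat_deriv p) t"
      using 1 by (simp add: flat_def flat_deriv_def power2_eq_square field_simps)
    moreover have "\<forall>\<^sub>F x in nhds t. flat p x = poly p (1 / x) * exp (- (1 / x))"
      using eventually_nhds_in_open[of "{0<..}" t] 1 by (auto elim!: eventually_mono simp: flat_def)
    ultimately show ?thesis by (subst DERIV_cong_ev[OF refl _ refl]) auto
  next
    case 2
    have "\<forall>\<^sub>F x in nhds t. flat p x = 0"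
      using eventually_nhds_in_open[of "{..<0}" t] 2 by (auto elim!: eventually_mono simp: flat_def)
    then show ?thesis using 2 by (subst DERIV_cong_ev[OF refl _ refl, of _ "\<lambda>_. 0"]) (auto simp: flat_def)
  next
    case 3
    \<comment> \<open>The difference quotient at 0 is again of the flat form, with one more power of
      1/h.\<close>
    have *: "flat p h / h = poly (pCons 0 p) (inverse h) * exp (- inverse h)" if "0 < h" for h
      using that by (simp add: flat_def divide_inverse)
    have "((\<lambda>h. flat p h / h) \<longlongrightarrow> 0) (at_right 0)"
    proof (rule Lim_transform_eventually)
      show "((\<lambda>h. poly (pCons 0 p) (inverse h) * exp (- inverse h)) \<longlongrightarrow> 0) (at_right 0)"
        using filterlim_compose[OF poly_exp_tendsto_0[of "pCons 0 p"] filterlim_inverse_at_top_right] by simp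
      show "\<forall>\<^sub>F h in at_right 0. poly (pCons 0 p) (inverse h) * exp (- inverse h) = flat p h / h"
        using eventually_at_right_less[of 0] by eventually_elim (simp add: *)
    qed
    moreover have "((\<lambda>h. flat p h / h) \<longlongrightarrow> 0) (at_left 0)"
    proof (rule Lim_transform_eventually)
      show "((\<lambda>h. 0 :: real) \<longlongrightarrow> 0) (at_left 0)" by simp
      show "\<forall>\<^sub>F h in at_left 0. 0 = flat p h / h"
        unfolding eventually_at by (auto simp: flat_def intro!: exI[of _ 1])
    qed
    ultimately have "((\<lambda>h. flat p h / h) \<longlongrightarrow> 0) (at 0)" by (simp add: filterlim_split_at)
    then show ?thesis unfolding 3 by (simp add: DERIV_def flat_def)
  qed
qed

text \<open>A class that contains the bumps and is closed under partial derivatives, so that all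
  orders of smoothness follow at once without computing iterated derivatives.\<close>

inductive_set smooth_algebra :: "(real ^ 'm::finite \<Rightarrow> real) set" where
  flat: "(\<lambda>x. flat p (c + a * x $ i)) \<in> smooth_algebra"
| const: "(\<lambda>_. c) \<in> smooth_algebra"
| add: "\<phi> \<in> smooth_algebra \<Longrightarrow> \<psi> \<in> smooth_algebra \<Longrightarrow> (\<lambda>x. \<phi> x + \<psi> x) \<in> smooth_algebra"
| mult: "\<phi> \<in> smooth_algebra \<Longrightarrow> \<psi> \<in> smooth_algebra \<Longrightarrow> (\<lambda>x. \<phi> x * \<psi> x) \<in> smooth_algebra"

lemma smooth_algebra_continuous: "\<phi> \<in> smooth_algebra \<Longrightarrow> continuous_on UNIV \<phi>"
proof (induction rule: smooth_algebra.induct)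
  case (flat p c a i)
  have "continuous_on UNIV (flat p)"
    using DERIV_isCont[OF flat_has_derivative] by (simp add: continuous_at_imp_continuous_on)
  then show ?case
    by (rule continuous_on_compose2) (auto intro!: continuous_intros)
qed (auto intro!: continuous_intros)

lemma smooth_algebra_partial:
  "\<phi> \<in> smooth_algebra \<Longrightarrow>
    \<exists>\<psi>\<in>smooth_algebra. \<forall>x. ((\<lambda>t. \<phi> (x + t *\<^sub>R axis j 1)) has_real_derivative \<psi> x) (at 0)"
proof (induction rule: smooth_algebra.induct)
  case (flat p c a i)
  define b :: real where "b = a * axis j 1 $ i"
  have "((\<lambda>t. flat p (c + a * (x + t *\<^sub>R axis j 1) $ i)) has_real_derivative
      b * flat (flat_deriv p) (c + a * x $ i)) (at 0)" for x
  proof -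
    have "((\<lambda>t. (c + a * x $ i) + b * t) has_real_derivative b) (at 0)"
      by (auto intro!: derivative_eq_intros)
    from DERIV_chain'[OF this flat_has_derivative[of p "(c + a * x $ i) + b * 0"]]
    show ?thesis by (simp add: b_def algebra_simps)
  qed
  moreover have "(\<lambda>x. b * flat (flat_deriv p) (c + a * x $ i)) \<in> smooth_algebra"
    by (intro smooth_algebra.intros)
  ultimately show ?case
    by (intro bexI[of _ "\<lambda>x. b * flat (flat_deriv p) (c + a * x $ i)"] allI)
next
  case (const c)
  show ?case by (rule bexI[of _ "\<lambda>_. 0"]) (auto intro: smooth_algebra.const)
next
  case (add \<phi> \<psi>)
  then obtain \<phi>' \<psi>' where d: "\<phi>' \<in> smooth_algebra" "\<psi>' \<in> smooth_algebra"
    "\<And>x. ((\<lambda>t. \<phi> (x + t *\<^sub>R axis j 1)) has_real_derivative \<phi>' x) (at 0)"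
    "\<And>x. ((\<lambda>t. \<psi> (x + t *\<^sub>R axis j 1)) has_real_derivative \<psi>' x) (at 0)" by blast
  show ?case
    by (rule bexI[of _ "\<lambda>x. \<phi>' x + \<psi>' x"]) (auto intro!: derivative_intros smooth_algebra.intros d)
next
  case (mult \<phi> \<psi>)
  then obtain \<phi>' \<psi>' where d: "\<phi>' \<in> smooth_algebra" "\<psi>' \<in> smooth_algebra"
    "\<And>x. ((\<lambda>t. \<phi> (x + t *\<^sub>R axis j 1)) has_real_derivative \<phi>' x) (at 0)"
    "\<And>x. ((\<lambda>t. \<psi> (x + t *\<^sub>R axis j 1)) has_real_derivative \<psi>' x) (at 0)" by blast
  show ?case
  proof (rule bexI[of _ "\<lambda>x. \<phi>' x * \<psi> x + \<psi>' x * \<phi> x"], rule allI)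
    fix x
    show "((\<lambda>t. \<phi> (x + t *\<^sub>R axis j 1) * \<psi> (x + t *\<^sub>R axis j 1)) has_real_derivative
        \<phi>' x * \<psi> x + \<psi>' x * \<phi> x) (at 0)"
      using DERIV_mult[OF d(3,4), of x] by simp
  qed (intro smooth_algebra.intros d mult.hyps)
qed

lemma smooth_algebra_partials:
  assumes "\<phi> \<in> smooth_algebra" shows "partials js \<phi> \<in> smooth_algebra"
proof (induction js)
  case (Cons j js)
  then obtain \<psi> where \<psi>: "\<psi> \<in> smooth_algebra"
    "\<And>x. ((\<lambda>t. partials js \<phi> (x + t *\<^sub>R axis j 1)) has_real_derivative \<psi> x) (at 0)"
    using smooth_algebra_partial by blast
  have "partials (j # js) \<phi> = \<psi>"
    using DERIV_imp_deriv[OF \<psi>(2)] by (auto simp: partials_def partial_def)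
  then show ?case using \<psi>(1) by simp
qed (use assms in \<open>simp add: partials_def\<close>)

lemma smooth_algebra_Ck:
  assumes "\<phi> \<in> smooth_algebra" shows "Ck_on k UNIV \<phi>"
  unfolding Ck_on_def
proof (intro conjI allI impI ballI)
  fix js :: "'a list" and j x
  show "(\<lambda>t. partials js \<phi> (x + t *\<^sub>R axis j 1)) differentiable at 0"
    using smooth_algebra_partial[OF smooth_algebra_partials[OF assms]] real_differentiable_def by blast
  show "continuous_on UNIV (partials js \<phi>)"
    by (intro smooth_algebra_continuous smooth_algebra_partials assms)
qed

section \<open>Bumps on boxes and functions that annihilate all test functions\<close>

definition box_bump :: "real ^ 'm \<Rightarrow> real ^ 'm \<Rightarrow> nat \<Rightarrow> real ^ 'm::finite \<Rightarrow> real" where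
  "box_bump a b k x = (\<Prod>i\<in>UNIV. flat 1 (Suc k * (x $ i - a $ i)) * flat 1 (Suc k * (b $ i - x $ i)))"

lemma box_bump_smooth: "box_bump a b k \<in> smooth_algebra"
proof -
  have "(\<lambda>x. \<Prod>i\<in>I. flat 1 (Suc k * (x $ i - a $ i)) * flat 1 (Suc k * (b $ i - x $ i))) \<in> smooth_algebra"
    if "finite I" for I
    using that
  proof induction
    case (insert i I)
    have "(\<lambda>x. flat 1 (K * (x $ i - a $ i))) \<in> smooth_algebra"
      "(\<lambda>x. flat 1 (K * (b $ i - x $ i))) \<in> smooth_algebra" for K
      using smooth_algebra.flat[of 1 "- K * a $ i" K i] smooth_algebra.flat[of 1 "K * b $ i" "- K" i]
      by (simp_all add: right_diff_distrib)
    then have "(\<lambda>x. flat 1 (Suc k * (x $ i - a $ i)) * flat 1 (Suc k * (b $ i - x $ i))) \<in> smooth_algebra"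
      by (intro smooth_algebra.mult)
    then show ?case using insert by (simp add: smooth_algebra.mult)
  qed (simp add: smooth_algebra.const)
  then show ?thesis unfolding box_bump_def[abs_def] by simp
qed

lemma flat_1: "0 \<le> flat 1 t" "flat 1 t \<le> 1" "flat 1 t \<noteq> 0 \<longleftrightarrow> 0 < t"
  by (auto simp: flat_def)

lemma box_bump_bounds: "0 \<le> box_bump a b k x" "box_bump a b k x \<le> 1"
  unfolding box_bump_def by (intro prod_nonneg prod_le_1 conjI ballI mult_le_one mult_nonneg_nonneg flat_1)+

lemma box_bump_nonzero: "box_bump a b k x \<noteq> 0 \<longleftrightarrow> x \<in> box a b"
  unfolding box_bump_def by (auto simp: flat_1(3) mem_box_cart zero_less_mult_iff)

text \<open>Inside the box all arguments are positive and are stretched to infinity, where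
  \<open>flat 1\<close> tends to 1; outside some factor is 0 for every \<open>k\<close>.\<close>

lemma box_bump_tendsto: "(\<lambda>k. box_bump a b k x) \<longlonglongrightarrow> indicator (box a b) x"
proof (cases "x \<in> box a b")
  case True
  have "(\<lambda>k. flat 1 (Suc k * t)) \<longlonglongrightarrow> 1" if t: "0 < t" for t :: real
  proof -
    have "(\<lambda>k. exp (- (1 / t * inverse (real (Suc k))))) \<longlonglongrightarrow> exp (- (1 / t * 0))"
      by (intro tendsto_intros LIMSEQ_inverse_real_of_nat)
    moreover have "flat 1 (Suc k * t) = exp (- (1 / t * inverse (real (Suc k))))" for k
      using t by (simp add: flat_def divide_inverse)
    ultimately show ?thesis by simp
  qed
  note flat = this
  have "(\<lambda>k. box_bump a b k x) \<longlonglongrightarrow> (\<Prod>i\<in>(UNIV :: 'a set). 1 * 1)"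
    unfolding box_bump_def
  proof (rule tendsto_prod, rule tendsto_mult)
    fix i
    show "(\<lambda>k. flat 1 (Suc k * (x $ i - a $ i))) \<longlonglongrightarrow> 1" "(\<lambda>k. flat 1 (Suc k * (b $ i - x $ i))) \<longlonglongrightarrow> 1"
      using True flat[of "x $ i - a $ i"] flat[of "b $ i - x $ i"] by (simp_all add: mem_box_cart)
  qed
  then show ?thesis using True by simp
next
  case False
  then have "box_bump a b k x = 0" for k using box_bump_nonzero by blast
  then show ?thesis using False by simp
qed

lemma test_function_box_bump:
  assumes "cbox a b \<subseteq> U" shows "test_function U (box_bump a b k)"
proof -
  have "{x. box_bump a b k x \<noteq> 0} = box a b" by (auto simp: box_bump_nonzero)
  moreover have "closure (box a b) \<subseteq> cbox a b"
    by (intro closure_minimal box_subset_cbox closed_cbox)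
  moreover have "compact (closure (box a b))" by (simp add: bounded_box)
  ultimately show ?thesis
    using assms by (auto simp: test_function_def smooth_algebra_Ck[OF box_bump_smooth])
qed

text \<open>Boxes are an intersection stable generator of the Borel sets, so the integral over every
  Borel set vanishes; the sets where the function is positive or negative then conclude.\<close>

lemma AE_zero_of_box_integrals:
  fixes W :: "real ^ 'm::finite \<Rightarrow> real"
  assumes W: "integrable lebesgue W" and box: "\<And>a b. (\<integral>x. indicator (box a b) x * W x \<partial>lebesgue) = 0"
  shows "AE x in lebesgue. W x = 0"
proof -
  have int: "integrable lebesgue (\<lambda>x. indicator A x * W x)" if "A \<in> sets lebesgue" for A
    using integrable_mult_indicator[OF that W] by simp
  \<comment> \<open>Complements need the integral over the whole space, which is exhausted by
    boxes.\<close>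
  have total: "(\<integral>x. W x \<partial>lebesgue) = 0"
  proof -
    have "(\<lambda>k. \<integral>x. indicator (box (\<chi> i. - real k) (\<chi> i. real k)) x * W x \<partial>lebesgue) \<longlonglongrightarrow> (\<integral>x. W x \<partial>lebesgue)"
    proof (rule integral_dominated_convergence[where w = "\<lambda>x. \<bar>W x\<bar>"])
      have "(\<lambda>k. indicator (box (\<chi> i. - real k) (\<chi> i. real k)) x * W x) \<longlonglongrightarrow> W x" for x
      proof (rule tendsto_eventually)
        obtain n where n: "norm x < real n" using reals_Archimedean2 by blast
        have "x \<in> box (\<chi> i. - real k) (\<chi> i. real k)" if "n \<le> k" for k
        proof -
          have "\<bar>x $ i\<bar> < real k" for i using component_le_norm_cart[of x i] n that by (smt (verit) of_nat_mono)
          then show ?thesis by (simp add: mem_box_cart abs_less_iff minus_less_iff)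
        qed
        then show "\<forall>\<^sub>F k in sequentially. indicator (box (\<chi> i. - real k) (\<chi> i. real k)) x * W x = W x"
          by (intro eventually_sequentiallyI[of n]) simp
      qed
      then show "AE x in lebesgue. (\<lambda>k. indicator (box (\<chi> i. - real k) (\<chi> i. real k)) x * W x) \<longlonglongrightarrow> W x" by simp
      show "(\<lambda>x. indicator (box (\<chi> i. - real k) (\<chi> i. real k)) x * W x) \<in> borel_measurable lebesgue" for k
        by (intro borel_measurable_integrable int) simp
    qed (use W in \<open>auto simp: indicator_def\<close>)
    then show ?thesis using box by (simp add: LIMSEQ_const_iff)
  qed
  have zero: "(\<integral>x. indicator A x * W x \<partial>lebesgue) = 0" if "A \<in> sets borel" for A
  proof -
    have G: "Int_stable (range (\<lambda>(a, b). box a b :: (real ^ 'm) set))" "range (\<lambda>(a, b). box a b :: (real ^ 'm) set) \<subseteq> Pow UNIV"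
      by (auto simp: Int_stable_def box_Int_box)
    have "A \<in> sigma_sets UNIV (range (\<lambda>(a, b). box a b))"
      using that by (simp add: borel_eq_box)
    from G this show ?thesis
    proof (induction rule: sigma_sets_induct_disjoint)
      case (basic A)
      then show ?case using box by auto
    next
      case empty
      show ?case by simp
    next
      case (compl A)
      then have A: "A \<in> sets lebesgue" by (simp add: borel_eq_box)
      have "(\<integral>x. indicator (UNIV - A) x * W x \<partial>lebesgue) = (\<integral>x. W x - indicator A x * W x \<partial>lebesgue)"
        by (intro Bochner_Integration.integral_cong) (auto simp: indicator_def)
      also have "\<dots> = 0" using compl int[OF A] W total by simp
      finally show ?case .
    next
      case (union A)
      have A: "A i \<in> sets lebesgue" for i
      proof -
        have "A i \<in> sets borel" using union.hyps(2) by (auto simp: borel_eq_box)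
        then show ?thesis by simp
      qed
      have "set_integrable lebesgue (\<Union>i. A i) W"
        using int[of "\<Union>i. A i"] A by (simp add: set_integrable_def)
      then have "(LINT x:(\<Union>i. A i)|lebesgue. W x) = (\<Sum>i. (LINT x:(A i)|lebesgue. W x))"
        using union A by (intro lebesgue_integral_countable_add) (auto simp: disjoint_family_on_def)
      then show ?case using union by (simp add: set_lebesgue_integral_def)
    qed
  qed
  \<comment> \<open>The previous step covers Borel sets, so the sign sets are taken from a Borel
    function equal to \<open>W\<close> almost everywhere.\<close>
  have "W \<in> borel_measurable (completion lborel)" using W by auto
  then obtain V where V [measurable]: "V \<in> borel_measurable lborel" and WV: "AE x in lborel. W x = V x"
    using completion_ex_borel_measurable_real by blast
  have WV': "AE x in lebesgue. W x = V x" using WV by (rule AE_completion)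
  have VI: "integrable lebesgue V"
    by (rule integrable_cong_AE_imp[OF W]) (use WV' in \<open>auto intro: measurable_completion elim: eventually_mono\<close>)
  have Vzero: "AE x in lebesgue. indicator A x * V x = 0"
    if A: "A \<in> sets borel" and sgn: "(\<forall>x. 0 \<le> indicator A x * (s * V x))" "s \<noteq> 0" for A s
  proof -
    have A': "A \<in> sets lebesgue" using A by simp
    have VA: "integrable lebesgue (\<lambda>x. indicator A x * V x)"
      using integrable_mult_indicator[OF A' VI] by simp
    have "(\<integral>x. indicator A x * V x \<partial>lebesgue) = (\<integral>x. indicator A x * W x \<partial>lebesgue)"
      using WV' VA int[OF A'] by (intro integral_cong_AE) auto
    then have "(\<integral>x. s * (indicator A x * V x) \<partial>lebesgue) = 0" using zero[OF A] by simp
    then have "AE x in lebesgue. s * (indicator A x * V x) = 0"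
      using integral_nonneg_eq_0_iff_AE[of lebesgue "\<lambda>x. s * (indicator A x * V x)"] VA sgn
      by (simp add: mult.left_commute)
    then show ?thesis using sgn(2) by simp
  qed
  have "AE x in lebesgue. indicator {x. 0 < V x} x * V x = 0" "AE x in lebesgue. indicator {x. V x < 0} x * V x = 0"
    by (rule Vzero[where s = 1]; auto simp: indicator_def) (rule Vzero[where s = "-1"]; auto simp: indicator_def)
  then show ?thesis
    using WV' by eventually_elim (auto simp: indicator_def split: if_splits)
qed

text \<open>Bumps converge boundedly to indicators of boxes, so the integrals over boxes with
  closure in \<open>U\<close> vanish. Cutting off to one such box gives an integrable function on
  the whole space, and countably many boxes cover \<open>U\<close>.\<close>

lemma fundamental_lemma:
  fixes w :: "real ^ 'm::finite \<Rightarrow> real"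
  assumes U: "open U" and w: "locally_integrable U w"
    and zero: "\<And>\<phi>. test_function U \<phi> \<Longrightarrow> (LINT x|lebesgue_on U. w x * \<phi> x) = 0"
  shows "AE x in lebesgue_on U. w x = 0"
proof -
  have intc: "integrable lebesgue (\<lambda>x. indicator (cbox c d) x * w x)" if "cbox c d \<subseteq> U" for c d
  proof -
    have "integrable (lebesgue_on (cbox c d)) w" using w that by (simp add: locally_integrable_def)
    then show ?thesis by (subst (asm) integrable_restrict_space) auto
  qed
  have box0: "(\<integral>x. indicator (box a b) x * w x \<partial>lebesgue) = 0" if ab: "cbox a b \<subseteq> U" for a b
  proof -
    have "(\<lambda>k. \<integral>x. box_bump a b k x * (indicator (cbox a b) x * w x) \<partial>lebesgue) \<longlonglongrightarrow>
       (\<integral>x. indicator (box a b) x * (indicator (cbox a b) x * w x) \<partial>lebesgue)"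
    proof (rule integral_dominated_convergence[where w = "\<lambda>x. \<bar>indicator (cbox a b) x * w x\<bar>"])
      have m: "(\<lambda>x. indicator (cbox a b) x * w x) \<in> borel_measurable lebesgue" using intc[OF ab] by auto
      have "box_bump a b k \<in> borel_measurable lebesgue" for k
        using borel_measurable_continuous_onI[OF smooth_algebra_continuous[OF box_bump_smooth]]
        by (intro measurable_completion) simp
      then show "(\<lambda>x. box_bump a b k x * (indicator (cbox a b) x * w x)) \<in> borel_measurable lebesgue" for k
        using m by (rule borel_measurable_times)
      show "(\<lambda>x. indicator (box a b) x * (indicator (cbox a b) x * w x)) \<in> borel_measurable lebesgue"
        by (intro borel_measurable_times[OF borel_measurable_indicator m]) simp
      show "AE x in lebesgue. norm (box_bump a b k x * (indicator (cbox a b) x * w x)) \<le> \<bar>indicator (cbox a b) x * w x\<bar>" for k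
        using box_bump_bounds[of a b k] by (auto simp: abs_mult intro!: mult_left_le_one_le)
      show "AE x in lebesgue. (\<lambda>k. box_bump a b k x * (indicator (cbox a b) x * w x)) \<longlonglongrightarrow>
          indicator (box a b) x * (indicator (cbox a b) x * w x)"
        by (intro AE_I2 tendsto_mult tendsto_const box_bump_tendsto)
    qed (use intc[OF ab] in auto)
    moreover have "(\<integral>x. box_bump a b k x * (indicator (cbox a b) x * w x) \<partial>lebesgue) = 0" for k
    proof -
      have "(\<integral>x. box_bump a b k x * (indicator (cbox a b) x * w x) \<partial>lebesgue) =
          (\<integral>x. indicator U x *\<^sub>R (w x * box_bump a b k x) \<partial>lebesgue)"
      proof (intro Bochner_Integration.integral_cong refl)
        fix x
        have "box_bump a b k x = 0" if "x \<notin> cbox a b"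
          using that box_bump_nonzero[of a b k x] box_subset_cbox[of a b] by blast
        then show "box_bump a b k x * (indicator (cbox a b) x * w x) = indicator U x *\<^sub>R (w x * box_bump a b k x)"
          using ab by (auto simp: indicator_def)
      qed
      also have "\<dots> = (LINT x|lebesgue_on U. w x * box_bump a b k x)"
        using U by (subst integral_restrict_space) auto
      also have "\<dots> = 0" by (intro zero test_function_box_bump ab)
      finally show ?thesis .
    qed
    ultimately have "(\<integral>x. indicator (box a b) x * (indicator (cbox a b) x * w x) \<partial>lebesgue) = 0"
      by (simp add: LIMSEQ_const_iff)
    moreover have "indicator (box a b) x * (indicator (cbox a b) x * w x) = indicator (box a b) x * w x" for x
      using box_subset_cbox[of a b] by (auto simp: indicator_def)
    ultimately show ?thesis by simp
  qed
  have cb: "AE x in lebesgue. x \<in> cbox c d \<longrightarrow> w x = 0" if cd: "cbox c d \<subseteq> U" for c d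
  proof -
    have "AE x in lebesgue. indicator (box c d) x * w x = 0"
    proof (rule AE_zero_of_box_integrals)
      have "integrable lebesgue (\<lambda>x. indicator (box c d) x *\<^sub>R (indicator (cbox c d) x * w x))"
        by (intro integrable_mult_indicator intc cd) auto
      moreover have "(\<lambda>x. indicator (box c d) x *\<^sub>R (indicator (cbox c d) x * w x)) = (\<lambda>x. indicator (box c d) x * w x)"
        using box_subset_cbox[of c d] by (auto simp: indicator_def fun_eq_iff)
      ultimately show "integrable lebesgue (\<lambda>x. indicator (box c d) x * w x)" by (simp only:)
      fix a b :: "real ^ 'm"
      obtain a' b' where ab': "box a b \<inter> box c d = box a' b'" using box_Int_box by blast
      have "(\<integral>x. indicator (box a b) x * (indicator (box c d) x * w x) \<partial>lebesgue) =
          (\<integral>x. indicator (box a' b') x * w x \<partial>lebesgue)"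
        using ab' by (intro Bochner_Integration.integral_cong refl) (auto simp: indicator_def set_eq_iff)
      also have "\<dots> = 0"
      \<comment> \<open>A nonempty intersection has its closed box inside \<open>cbox c d\<close>;
        for an empty one that may fail, but the integrand is 0.\<close>
      proof (cases "box a' b' = {}")
        case False
        have "cbox a' b' = closure (box a' b')" using closure_box[OF False] by simp
        also have "\<dots> \<subseteq> cbox c d"
          using ab' box_subset_cbox[of c d] by (intro closure_minimal closed_cbox) auto
        finally show ?thesis using cd by (intro box0) auto
      qed simp
      finally show "(\<integral>x. indicator (box a b) x * (indicator (box c d) x * w x) \<partial>lebesgue) = 0" .
    qed
    moreover have "AE x in lebesgue. x \<notin> cbox c d - box c d"
      using negligible_frontier_interval[of c d] by (intro AE_not_in) (simp add: negligible_iff_null_sets)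
    ultimately show ?thesis by eventually_elim (auto simp: indicator_def split: if_splits)
  qed
  obtain \<D> where D: "countable \<D>" "\<D> \<subseteq> Pow U" "\<And>X. X \<in> \<D> \<Longrightarrow> \<exists>a b. X = cbox a b" "\<Union>\<D> = U"
    using open_countable_Union_open_cbox[OF U] by metis
  have "AE x in lebesgue. \<forall>X\<in>\<D>. x \<in> X \<longrightarrow> w x = 0"
  proof (subst AE_ball_countable[OF D(1)], intro ballI)
    fix X assume "X \<in> \<D>"
    then obtain a b where "X = cbox a b" "cbox a b \<subseteq> U" using D(2,3) by blast
    then show "AE x in lebesgue. x \<in> X \<longrightarrow> w x = 0" using cb by simp
  qed
  then have "AE x in lebesgue. x \<in> U \<longrightarrow> w x = 0" using D(4) by (auto elim!: eventually_mono)
  then show ?thesis using U by (subst AE_restrict_space_iff) auto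
qed

section \<open>Weak derivatives of directionally Lipschitz functions\<close>

lemma integrable_lebesgue_on_bounded:
  fixes g :: "'a::euclidean_space \<Rightarrow> real"
  assumes "S \<in> lmeasurable" "g \<in> borel_measurable (lebesgue_on S)" "\<And>x. x \<in> S \<Longrightarrow> \<bar>g x\<bar> \<le> K"
  shows "integrable (lebesgue_on S) g"
proof -
  interpret finite_measure "lebesgue_on S" using assms(1) by (rule finite_measure_lebesgue_on)
  show ?thesis
  proof (rule integrable_const_bound)
    show "AE x in lebesgue_on S. norm (g x) \<le> K"
      by (rule AE_I2) (simp add: assms(3))
  qed (rule assms(2))
qed

lemma test_function_continuous:
  assumes "test_function U \<phi>"
  shows "continuous_on A \<phi>" "continuous_on A (partial j \<phi>)"
proof -
  have "continuous_on UNIV (partials [] \<phi>)" "continuous_on UNIV (partials [j] \<phi>)"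
    using assms unfolding test_function_def Ck_on_def by (metis le_refl list.size(3) , metis le_refl)
  then show "continuous_on A \<phi>" "continuous_on A (partial j \<phi>)"
    by (auto simp: partials_def intro: continuous_on_subset)
qed

lemma DERIV_line:
  assumes "(\<lambda>t. u (x + s *\<^sub>R axis j 1 + t *\<^sub>R axis j 1)) differentiable at 0"
  shows "((\<lambda>t. u (x + t *\<^sub>R axis j 1)) has_real_derivative partial j u (x + s *\<^sub>R axis j 1)) (at s)"
proof -
  have "((\<lambda>t. u (x + s *\<^sub>R axis j 1 + t *\<^sub>R axis j 1)) has_real_derivative partial j u (x + s *\<^sub>R axis j 1)) (at 0)"
    using assms unfolding partial_def by (metis DERIV_deriv_iff_real_differentiable)
  then show ?thesis
    using DERIV_shift[of "\<lambda>t. u (x + t *\<^sub>R axis j 1)" "partial j u (x + s *\<^sub>R axis j 1)" 0 s]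
    by (simp add: scaleR_add_left add_ac)
qed

lemma test_function_DERIV:
  assumes "test_function U \<phi>"
  shows "((\<lambda>t. \<phi> (x + t *\<^sub>R axis j 1)) has_real_derivative partial j \<phi> (x + s *\<^sub>R axis j 1)) (at s)"
proof -
  have "Ck_on 1 UNIV \<phi>" using assms by (simp add: test_function_def)
  then have "(\<lambda>t. partials [] \<phi> (x + s *\<^sub>R axis j 1 + t *\<^sub>R axis j 1)) differentiable at 0"
    unfolding Ck_on_def by (metis UNIV_I less_one list.size(3))
  then show ?thesis by (intro DERIV_line) (simp add: partials_def)
qed

lemma integrable_mult_test_function:
  assumes U: "open U" and w: "locally_integrable U w" and \<phi>: "test_function U \<phi>"
  shows "integrable (lebesgue_on U) (\<lambda>x. w x * \<phi> x)"
proof -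
  define K where "K = closure {x. \<phi> x \<noteq> 0}"
  have K: "compact K" "K \<subseteq> U" using \<phi> by (auto simp: test_function_def K_def)
  have zero: "\<phi> x = 0" if "x \<notin> K" for x using that closure_subset[of "{x. \<phi> x \<noteq> 0}"] by (auto simp: K_def)
  have "bounded (\<phi> ` K)"
    by (intro compact_imp_bounded compact_continuous_image test_function_continuous[OF \<phi>] K)
  then obtain C where C: "\<And>x. x \<in> K \<Longrightarrow> \<bar>\<phi> x\<bar> \<le> C" by (auto simp: bounded_iff)
 have sK: "K \<in> sets lebesgue" using K by (simp add: lmeasurable_compact fmeasurableD)
  have sU: "U \<in> sets lebesgue" using U by simp
  have wK: "integrable (lebesgue_on K) w" using w K by (simp add: locally_integrable_def)
  have "integrable (lebesgue_on K) (\<lambda>x. w x * \<phi> x)"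
  proof (rule Bochner_Integration.integrable_bound[of _ "\<lambda>x. C * w x"])
    show "(\<lambda>x. w x * \<phi> x) \<in> borel_measurable (lebesgue_on K)"
      using sK by (intro borel_measurable_times[OF borel_measurable_integrable[OF wK]]
          continuous_imp_measurable_on_sets_lebesgue test_function_continuous[OF \<phi>])
    show "AE x in lebesgue_on K. norm (w x * \<phi> x) \<le> norm (C * w x)"
    proof (rule AE_I2)
      fix x assume "x \<in> space (lebesgue_on K)"
      then have "\<bar>\<phi> x\<bar> \<le> \<bar>C\<bar>" using C[of x] by auto
      then show "norm (w x * \<phi> x) \<le> norm (C * w x)"
        unfolding real_norm_def abs_mult mult.commute[of "\<bar>w x\<bar>"] by (rule mult_right_mono) simp
    qed
  qed (use wK in simp)
  moreover have "(\<lambda>x. indicator K x *\<^sub>R (w x * \<phi> x)) = (\<lambda>x. indicator U x *\<^sub>R (w x * \<phi> x))"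
    using zero K(2) by (auto simp: indicator_def fun_eq_iff)
  ultimately show ?thesis
    using sU sK integrable_restrict_space[of K lebesgue "\<lambda>x. w x * \<phi> x"]
      integrable_restrict_space[of U lebesgue "\<lambda>x. w x * \<phi> x"] by simp
qed

lemma weak_partial_unique:
  assumes U: "open U" and v: "weak_partial U j u v" and w: "weak_partial U j u w"
  shows "AE x in lebesgue_on U. v x = w x"
proof -
  have li: "locally_integrable U v" "locally_integrable U w" using v w by (auto simp: weak_partial_def)
  have "AE x in lebesgue_on U. v x - w x = 0"
  proof (rule fundamental_lemma[OF U])
    show "locally_integrable U (\<lambda>x. v x - w x)"
      using li by (auto simp: locally_integrable_def)
    fix \<phi> assume \<phi>: "test_function U \<phi>"
    have "(LINT x|lebesgue_on U. v x * \<phi> x) = (LINT x|lebesgue_on U. w x * \<phi> x)"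
      using v w \<phi> by (auto simp: weak_partial_def)
    then show "(LINT x|lebesgue_on U. (v x - w x) * \<phi> x) = 0"
      using integrable_mult_test_function[OF U li(1) \<phi>] integrable_mult_test_function[OF U li(2) \<phi>]
      by (simp add: left_diff_distrib)
  qed
  then show ?thesis by simp
qed

text \<open>The derivative is a weak limit of forward difference quotients in direction
  \<open>j\<close>, all bounded by \<open>L\<close>. Translation invariance moves the quotient onto
  the test function, where it converges classically; no differentiability of \<open>u\<close> is
  used.\<close>

lemma weak_partial_exists:
  fixes u :: "real ^ 'm::finite \<Rightarrow> real"
  assumes U: "open U" "bounded U" "closure U \<subseteq> V" and cont: "continuous_on V u" and \<delta>: "0 < \<delta>"
    and shift: "\<And>x t. x \<in> U \<Longrightarrow> 0 < t \<Longrightarrow> t \<le> \<delta> \<Longrightarrow> x + t *\<^sub>R axis j 1 \<in> V"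
    and Lip: "\<And>x t. x \<in> U \<Longrightarrow> 0 < t \<Longrightarrow> t \<le> \<delta> \<Longrightarrow> \<bar>u (x + t *\<^sub>R axis j 1) - u x\<bar> \<le> L * t"
    and L: "0 \<le> L"
  obtains v where "v \<in> borel_measurable (lebesgue_on U)" "\<And>x. \<bar>v x\<bar> \<le> L" "weak_partial U j u v"
proof -
  define e :: "real ^ 'm" where "e = axis j 1"
  have norm_e: "norm e = 1" by (simp add: e_def)
  let ?M = "lebesgue_on U"
  have lm: "U \<in> lmeasurable" using U by (simp add: lmeasurable_open)
  have sU: "U \<in> sets lebesgue" "U \<in> sets borel" using U by auto
  have UV: "U \<subseteq> V" using U closure_subset by blast
  have contU: "continuous_on U u" using cont UV by (rule continuous_on_subset)
  have meas_u: "u \<in> borel_measurable ?M" using contU sU by (intro continuous_imp_measurable_on_sets_lebesgue)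
  have "bounded (u ` closure U)"
    using U by (intro compact_imp_bounded compact_continuous_image continuous_on_subset[OF cont]) auto
  then obtain Cu where Cu: "\<And>x. x \<in> closure U \<Longrightarrow> \<bar>u x\<bar> \<le> Cu" by (auto simp: bounded_iff)
  then have Cu: "\<bar>u x\<bar> \<le> Cu" if "x \<in> U" for x using that closure_subset by blast
  define h where "h k = \<delta> / real (Suc k)" for k
  have h: "0 < h k" "h k \<le> \<delta>" for k using \<delta> by (auto simp: h_def divide_le_eq mult_le_cancel_left1)
  have h0: "h \<longlonglongrightarrow> 0"
    unfolding h_def by (rule LIMSEQ_Suc[OF lim_const_over_n])
  \<comment> \<open>The value 0 outside \<open>U\<close> provides the bound at every point that the
    weak limit lemma asks for.\<close>
  define f where "f k x = (if x \<in> U then (u (x + h k *\<^sub>R e) - u x) / h k else 0)" for k x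
  have shift_cont: "continuous_on U (\<lambda>x. u (x + h k *\<^sub>R e))" for k
    using shift h by (intro continuous_on_compose2[OF cont] continuous_intros) (auto simp: e_def)
  have meas_f: "f k \<in> borel_measurable ?M" for k
  proof -
    have "(\<lambda>x. (u (x + h k *\<^sub>R e) - u x) / h k) \<in> borel_measurable ?M"
      using h[of k] sU by (intro continuous_imp_measurable_on_sets_lebesgue continuous_intros shift_cont contU) auto
    then show ?thesis by (rule measurable_cong[THEN iffD1, rotated]) (simp add: f_def)
  qed
  have bd_f: "\<bar>f k x\<bar> \<le> L" for k x
    using Lip[of x "h k"] h[of k] L by (auto simp: f_def e_def divide_le_eq)
  obtain v where v: "v \<in> borel_measurable ?M" "\<forall>x. \<bar>v x\<bar> \<le> L"
    "\<forall>\<psi> l. integrable ?M \<psi> \<longrightarrow> (\<lambda>k. \<integral>x. f k x * \<psi> x \<partial>?M) \<longlonglongrightarrow> l \<longrightarrow> (\<integral>x. v x * \<psi> x \<partial>?M) = l"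
    using bounded_sequence_weak_limit[of ?M f L, OF finite_measure_lebesgue_on[OF lm] meas_f bd_f]
    by (elim bexE conjE)
  have "weak_partial U j u v"
    unfolding weak_partial_def
  proof (intro conjI allI impI)
    show "locally_integrable U u"
      unfolding locally_integrable_def
    proof (intro allI impI, elim conjE)
      fix K assume K: "compact K" "K \<subseteq> U"
      then show "integrable (lebesgue_on K) u"
        by (intro integrable_lebesgue_on_bounded[of K u Cu] continuous_imp_measurable_on_sets_lebesgue
            continuous_on_subset[OF contU] Cu) (auto simp: lmeasurable_compact fmeasurableD)
    qed
    show "locally_integrable U v"
      unfolding locally_integrable_def
    proof (intro allI impI, elim conjE)
      fix K assume K: "compact K" "K \<subseteq> U"
      then show "integrable (lebesgue_on K) v"
        using v by (intro integrable_lebesgue_on_bounded[of K v L] measurable_restrict_mono[OF v(1)])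
          (auto simp: lmeasurable_compact fmeasurableD)
    qed
    fix \<phi> assume \<phi>: "test_function U \<phi>"
    note cont\<phi> = test_function_continuous[OF \<phi>]
    define K where "K = closure {x. \<phi> x \<noteq> 0}"
    have K: "compact K" "K \<subseteq> U" using \<phi> by (auto simp: test_function_def K_def)
    have zero: "\<phi> x = 0" if "x \<notin> K" for x using that closure_subset[of "{x. \<phi> x \<noteq> 0}"] by (auto simp: K_def)
    \<comment> \<open>A margin around the support of the test function: steps up to
      \<open>\<eta>\<close> keep the shifted support in \<open>U\<close>, so no boundary term
      arises.\<close>
    obtain \<eta> where \<eta>: "0 < \<eta>" "(\<Union>x\<in>K. cball x \<eta>) \<subseteq> U"
      using compact_subset_open_imp_cball_epsilon_subset[OF K(1) U(1) K(2)] .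
    obtain R where R: "\<And>x. x \<in> U \<Longrightarrow> norm x \<le> R" using U(2) by (auto simp: bounded_iff)
    have "bounded (partial j \<phi> ` cball 0 (R + \<delta>))" "bounded (\<phi> ` cball 0 (R + \<delta>))"
      by (intro compact_imp_bounded compact_continuous_image cont\<phi> compact_cball)+
    then obtain C C' where "\<forall>x\<in>cball 0 (R + \<delta>). \<bar>partial j \<phi> x\<bar> \<le> C" "\<forall>x\<in>cball 0 (R + \<delta>). \<bar>\<phi> x\<bar> \<le> C'"
      by (auto simp: bounded_iff)
    then have C: "\<bar>partial j \<phi> x\<bar> \<le> C" and C': "\<bar>\<phi> x\<bar> \<le> C'" if "norm x \<le> R + \<delta>" for x
      using that by simp_all
    have meas\<phi>: "(\<lambda>x. \<phi> (x - c)) \<in> borel_measurable ?M" for c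
      using sU by (intro continuous_imp_measurable_on_sets_lebesgue continuous_on_compose2[OF cont\<phi>(1)[of UNIV]] continuous_intros) auto
    have norm_shift: "norm (x + t *\<^sub>R e) \<le> R + \<delta>" if "x \<in> U" "\<bar>t\<bar> \<le> \<delta>" for x t
      using R[OF that(1)] that(2) norm_triangle_ineq[of x "t *\<^sub>R e"] by (simp add: norm_e)
    \<comment> \<open>A backward quotient, because the translation changes sign when it moves from
      \<open>u\<close> to \<phi>. Its limit is minus the partial derivative.\<close>
    define q where "q k x = (\<phi> (x - h k *\<^sub>R e) - \<phi> x) / h k" for k x
    have q_bound: "\<bar>q k x\<bar> \<le> C" if x: "x \<in> U" for k x
    proof -
      have "\<exists>z. - h k < z \<and> z < 0 \<and> \<phi> (x + 0 *\<^sub>R axis j 1) - \<phi> (x + (- h k) *\<^sub>R axis j 1) =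
          (0 - - h k) * partial j \<phi> (x + z *\<^sub>R axis j 1)"
        using h[of k] by (intro MVT2 test_function_DERIV[OF \<phi>]) auto
      then obtain z where z: "- h k < z" "z < 0" "\<phi> x - \<phi> (x - h k *\<^sub>R e) = h k * partial j \<phi> (x + z *\<^sub>R e)"
        by (auto simp: e_def)
      then have "\<bar>partial j \<phi> (x + z *\<^sub>R e)\<bar> \<le> C"
        using h[of k] x by (intro C norm_shift) auto
      moreover have "q k x = - partial j \<phi> (x + z *\<^sub>R e)"
        using z(3) h[of k] by (simp add: q_def field_simps)
      ultimately show ?thesis by simp
    qed
    have q_lim: "(\<lambda>k. q k x) \<longlonglongrightarrow> - partial j \<phi> x" for x
    proof -
      have "((\<lambda>t. (\<phi> (x + t *\<^sub>R axis j 1) - \<phi> x) / t) \<longlongrightarrow> partial j \<phi> x) (at 0)"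
        using test_function_DERIV[OF \<phi>, of x j 0] by (simp add: DERIV_def)
      moreover have "filterlim (\<lambda>k. - h k) (at 0) sequentially"
        unfolding filterlim_at using tendsto_minus[OF h0] h(1) by (simp add: order_less_imp_not_eq2)
      ultimately have "(\<lambda>k. (\<phi> (x + (- h k) *\<^sub>R axis j 1) - \<phi> x) / (- h k)) \<longlonglongrightarrow> partial j \<phi> x"
        by (rule filterlim_compose)
      from tendsto_minus[OF this] show ?thesis by (simp add: q_def e_def)
    qed
    have parts: "(\<integral>x. f k x * \<phi> x \<partial>?M) = (\<integral>x. u x * q k x \<partial>?M)" if k: "h k \<le> \<eta>" for k
    proof -
      have i1: "integrable ?M (\<lambda>x. u (x + h k *\<^sub>R e) * \<phi> x)"
      proof (rule integrable_lebesgue_on_bounded[OF lm])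
        show "(\<lambda>x. u (x + h k *\<^sub>R e) * \<phi> x) \<in> borel_measurable ?M"
          using sU by (intro continuous_imp_measurable_on_sets_lebesgue continuous_intros shift_cont cont\<phi>)
        fix x assume x: "x \<in> U"
        have "\<bar>u (x + h k *\<^sub>R e)\<bar> \<le> Cu + L * \<delta>"
        proof -
          have "\<bar>u (x + h k *\<^sub>R e) - u x\<bar> \<le> L * h k" using Lip[OF x h] by (simp add: e_def)
          also have "\<dots> \<le> L * \<delta>" using L h by (intro mult_left_mono)
          finally show ?thesis using Cu[OF x] by linarith
        qed
        moreover have "\<bar>\<phi> x\<bar> \<le> C'" using C' norm_shift[OF x, of 0] \<delta> by simp
        ultimately show "\<bar>u (x + h k *\<^sub>R e) * \<phi> x\<bar> \<le> (Cu + L * \<delta>) * C'"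
          unfolding abs_mult by (intro mult_mono) auto
      qed
      have i2: "integrable ?M (\<lambda>x. u x * \<phi> (x - t *\<^sub>R e))" if "\<bar>t\<bar> \<le> \<delta>" for t
      proof (rule integrable_lebesgue_on_bounded[OF lm])
        show "(\<lambda>x. u x * \<phi> (x - t *\<^sub>R e)) \<in> borel_measurable ?M"
          using meas_u meas\<phi> by (rule borel_measurable_times)
        fix x assume x: "x \<in> U"
        have "\<bar>\<phi> (x - t *\<^sub>R e)\<bar> \<le> C'" using C' norm_shift[OF x, of "- t"] that by simp
        then show "\<bar>u x * \<phi> (x - t *\<^sub>R e)\<bar> \<le> Cu * C'"
          unfolding abs_mult using Cu[OF x] by (intro mult_mono) auto
      qed
      define W where "W y = indicator U y *\<^sub>R (u y * \<phi> (y - h k *\<^sub>R e))" for y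
      have W: "W \<in> borel_measurable borel"
        unfolding W_def using sU
        by (intro borel_measurable_continuous_on_indicator continuous_intros contU continuous_on_compose2[OF cont\<phi>(1)[of UNIV]]) auto
      have WW: "indicator U x *\<^sub>R (u (x + h k *\<^sub>R e) * \<phi> x) = W (h k *\<^sub>R e + x)" for x
      proof (cases "\<phi> x = 0")
        case False
        then have x: "x \<in> K" using zero by blast
        then have "x + h k *\<^sub>R e \<in> cball x \<eta>" using k h[of k] by (simp add: dist_norm norm_e)
        then have "x + h k *\<^sub>R e \<in> U" using x \<eta>(2) by blast
        moreover have "x \<in> U" using x K(2) by blast
        ultimately show ?thesis by (simp add: W_def add.commute)
      qed (simp add: W_def)
      have "(\<integral>x. u (x + h k *\<^sub>R e) * \<phi> x \<partial>?M) = (\<integral>x. indicator U x *\<^sub>R (u (x + h k *\<^sub>R e) * \<phi> x) \<partial>lebesgue)"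
        using sU by (intro integral_restrict_space) simp
      also have "\<dots> = (\<integral>x. W (h k *\<^sub>R e + x) \<partial>lebesgue)" by (simp only: WW)
      also have "\<dots> = (\<integral>x. W (h k *\<^sub>R e + x) \<partial>lborel)"
        by (intro integral_completion measurable_compose[OF _ W]) simp
      also have "\<dots> = (\<integral>x. W x \<partial>distr lborel borel ((+) (h k *\<^sub>R e)))"
        using W by (intro integral_distr[symmetric]) auto
      also have "\<dots> = (\<integral>x. W x \<partial>lebesgue)"
        using W by (simp add: lborel_distr_plus integral_completion)
      also have "\<dots> = (\<integral>x. u x * \<phi> (x - h k *\<^sub>R e) \<partial>?M)"
        unfolding W_def using sU by (subst integral_restrict_space) auto
      finally have eq: "(\<integral>x. u (x + h k *\<^sub>R e) * \<phi> x \<partial>?M) = (\<integral>x. u x * \<phi> (x - h k *\<^sub>R e) \<partial>?M)" .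
      have "(\<integral>x. f k x * \<phi> x \<partial>?M) = (\<integral>x. (u (x + h k *\<^sub>R e) * \<phi> x - u x * \<phi> x) / h k \<partial>?M)"
        by (intro Bochner_Integration.integral_cong) (auto simp: f_def field_simps)
      also have "\<dots> = ((\<integral>x. u x * \<phi> (x - h k *\<^sub>R e) \<partial>?M) - (\<integral>x. u x * \<phi> x \<partial>?M)) / h k"
        using i1 i2[of 0] \<delta> eq by simp
      also have "\<dots> = (\<integral>x. (u x * \<phi> (x - h k *\<^sub>R e) - u x * \<phi> x) / h k \<partial>?M)"
        using i2[of "h k"] i2[of 0] \<delta> h[of k] by simp
      also have "\<dots> = (\<integral>x. u x * q k x \<partial>?M)"
        by (intro Bochner_Integration.integral_cong) (auto simp: q_def right_diff_distrib diff_divide_distrib)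
      finally show ?thesis .
    qed
    have "(\<lambda>k. \<integral>x. u x * q k x \<partial>?M) \<longlonglongrightarrow> (\<integral>x. u x * - partial j \<phi> x \<partial>?M)"
    proof (rule integral_dominated_convergence[where w = "\<lambda>_. Cu * C"])
      show "(\<lambda>x. u x * - partial j \<phi> x) \<in> borel_measurable ?M"
        using sU by (intro borel_measurable_times borel_measurable_uminus meas_u continuous_imp_measurable_on_sets_lebesgue cont\<phi>)
      show "(\<lambda>x. u x * q k x) \<in> borel_measurable ?M" for k
        unfolding q_def using meas_u meas\<phi>[of "h k *\<^sub>R e"] meas\<phi>[of 0] by simp
      show "integrable ?M (\<lambda>_. Cu * C)"
        using finite_measure_lebesgue_on[OF lm] by (rule finite_measure.integrable_const)
      show "AE x in ?M. (\<lambda>k. u x * q k x) \<longlonglongrightarrow> u x * - partial j \<phi> x"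
        by (intro AE_I2 tendsto_mult tendsto_const q_lim)
      show "AE x in ?M. norm (u x * q k x) \<le> Cu * C" for k
      proof (rule AE_I2)
        fix x assume "x \<in> space ?M"
        then have "\<bar>u x\<bar> \<le> Cu" "\<bar>q k x\<bar> \<le> C" using Cu q_bound by auto
        then show "norm (u x * q k x) \<le> Cu * C" unfolding real_norm_def abs_mult by (intro mult_mono) auto
      qed
    qed
    moreover have "\<forall>\<^sub>F k in sequentially. (\<integral>x. u x * q k x \<partial>?M) = (\<integral>x. f k x * \<phi> x \<partial>?M)"
    proof -
      have "\<forall>\<^sub>F k in sequentially. h k < \<eta>" using h0 \<eta>(1) by (rule order_tendstoD(2))
      then show ?thesis by eventually_elim (simp add: parts)
    qed
    ultimately have "(\<lambda>k. \<integral>x. f k x * \<phi> x \<partial>?M) \<longlonglongrightarrow> (\<integral>x. u x * - partial j \<phi> x \<partial>?M)"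
      by (rule Lim_transform_eventually)
    moreover have "integrable ?M \<phi>"
      using sU C' norm_shift[of _ 0] \<delta>
      by (intro integrable_lebesgue_on_bounded[OF lm, of _ C'] continuous_imp_measurable_on_sets_lebesgue cont\<phi>) auto
    ultimately have "(\<integral>x. v x * \<phi> x \<partial>?M) = (\<integral>x. u x * - partial j \<phi> x \<partial>?M)" by (intro v(3)[rule_format])
    then show "(\<integral>x. u x * partial j \<phi> x \<partial>?M) = - (\<integral>x. v x * \<phi> x \<partial>?M)" by simp
  qed
  then show ?thesis by (rule that[OF v(1) v(2)[rule_format]])
qed

section \<open>Essential bounds and the minimal gradient of a metric-valued map\<close>

lemma Linf_bounded:
  assumes "g \<in> borel_measurable (lebesgue_on U)" "\<And>x. x \<in> U \<Longrightarrow> \<bar>g x\<bar> \<le> K"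
  shows "g \<in> Linf U"
proof -
  have "AE x in lebesgue_on U. ennreal \<bar>g x\<bar> \<le> ennreal K"
    by (intro AE_I2 ennreal_leI) (simp add: assms(2))
  then have "Linf_norm U g \<le> ennreal K"
    unfolding Linf_norm_def using assms(1) by (intro esssup_I) auto
  then show ?thesis using assms(1) by (auto simp: Linf_def intro: le_less_trans)
qed

lemma Linf_AE_bound:
  assumes "g \<in> Linf U"
  obtains K where "AE x in lebesgue_on U. \<bar>g x\<bar> \<le> K"
proof -
  have "Linf_norm U g < top" using assms by (simp add: Linf_def infinity_ennreal_def)
  then obtain K where K: "0 \<le> K" "Linf_norm U g = ennreal K" by (cases "Linf_norm U g") auto
  have "AE x in lebesgue_on U. ennreal \<bar>g x\<bar> \<le> Linf_norm U g"
    unfolding Linf_norm_def by (rule esssup_AE)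
  then have "AE x in lebesgue_on U. \<bar>g x\<bar> \<le> K" by eventually_elim (simp add: K)
  then show ?thesis by (rule that)
qed

text \<open>The essential infimum of all bounds, obtained by minimizing the integral.\<close>

lemma metric_partial_minimal:
  assumes lm: "U \<in> lmeasurable" and ex: "partial_bound U j f \<phi>0"
  shows "partial_bound U j f (metric_partial U j f)"
    "partial_bound U j f \<psi> \<Longrightarrow> AE x in lebesgue_on U. metric_partial U j f x \<le> \<psi> x"
proof -
  let ?M = "lebesgue_on U"
  interpret finite_measure ?M using lm by (rule finite_measure_lebesgue_on)
  define I where "I \<psi> = (\<integral>x. \<psi> x \<partial>?M)" for \<psi> :: "_ \<Rightarrow> real"
  define S where "S = {\<psi>. partial_bound U j f \<psi>}"
  have meas: "\<psi> \<in> borel_measurable ?M" if "\<psi> \<in> S" for \<psi>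
    using that by (simp add: S_def partial_bound_def Linf_def)
  have nonneg: "0 \<le> \<psi> x" if "\<psi> \<in> S" "x \<in> U" for \<psi> x
    using that by (simp add: S_def partial_bound_def)
  have int: "integrable ?M \<psi>" if S: "\<psi> \<in> S" for \<psi>
  proof -
    have "\<psi> \<in> Linf U" using S by (simp add: S_def partial_bound_def)
    then obtain K where "AE x in ?M. \<bar>\<psi> x\<bar> \<le> K" by (rule Linf_AE_bound)
    then show ?thesis using meas[OF S] by (intro integrable_const_bound[of _ K]) auto
  qed
  have smaller: "\<psi> \<in> S"
    if "\<psi> \<in> borel_measurable ?M" "\<And>x. x \<in> U \<Longrightarrow> 0 \<le> \<psi> x" "\<theta> \<in> S" "\<And>x. x \<in> U \<Longrightarrow> \<psi> x \<le> \<theta> x"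
      "\<And>P v. weak_partial U j (\<lambda>x. dist (f x) P) v \<Longrightarrow> AE x in ?M. \<bar>v x\<bar> \<le> \<psi> x" for \<psi> \<theta>
  proof -
    have "Linf_norm U \<psi> \<le> Linf_norm U \<theta>"
      unfolding Linf_norm_def using that meas[OF that(3)] by (intro esssup_AE_mono AE_I2 ennreal_leI) force+
    moreover have "Linf_norm U \<theta> < \<infinity>" using that(3) by (simp add: S_def partial_bound_def Linf_def)
    ultimately have "\<psi> \<in> Linf U" using that(1) by (auto simp: Linf_def intro: le_less_trans)
    then show ?thesis using that by (simp add: S_def partial_bound_def)
  qed
  have ne: "I ` S \<noteq> {}" using ex by (auto simp: S_def)
  have bdd: "bdd_below (I ` S)"
  proof (rule bdd_belowI2[of _ 0])
    fix \<psi> assume "\<psi> \<in> S"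
    then show "0 \<le> I \<psi>" unfolding I_def using nonneg by (intro integral_nonneg_AE AE_I2) auto
  qed
  have "\<exists>\<psi>\<in>S. I \<psi> < Inf (I ` S) + inverse (real (Suc k))" for k
  proof -
    have "Inf (I ` S) < Inf (I ` S) + inverse (real (Suc k))" by simp
    then show ?thesis using cInf_lessD[OF ne] by blast
  qed
  then obtain \<zeta> where \<zeta>: "\<And>k. \<zeta> k \<in> S" "\<And>k. I (\<zeta> k) < Inf (I ` S) + inverse (real (Suc k))"
    by metis
  \<comment> \<open>An infimum over countably many bounds is again a bound, as the exceptional null
    sets are countably many.\<close>
  define \<phi> where "\<phi> x = (INF k. \<zeta> k x)" for x
  have bddx: "bdd_below (range (\<lambda>k. \<zeta> k x))" if "x \<in> U" for x
    using nonneg[OF \<zeta>(1) that] by (intro bdd_belowI2[of _ 0]) auto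
  have \<phi>_le: "\<phi> x \<le> \<zeta> k x" if "x \<in> U" for x k
    unfolding \<phi>_def using bddx[OF that] by (intro cINF_lower) auto
  have \<phi>S: "\<phi> \<in> S"
  proof (rule smaller[OF _ _ \<zeta>(1) \<phi>_le])
    show "\<phi> \<in> borel_measurable ?M"
      unfolding \<phi>_def using meas[OF \<zeta>(1)] by (intro borel_measurable_cINF_real) auto
    show "0 \<le> \<phi> x" if "x \<in> U" for x
      unfolding \<phi>_def using nonneg[OF \<zeta>(1) that] by (intro cINF_greatest) auto
    fix P v assume "weak_partial U j (\<lambda>x. dist (f x) P) v"
    then have "AE x in ?M. \<bar>v x\<bar> \<le> \<zeta> k x" for k using \<zeta>(1)[of k] by (simp add: S_def partial_bound_def)
    then have "AE x in ?M. \<forall>k. \<bar>v x\<bar> \<le> \<zeta> k x" by (simp add: AE_all_countable)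
    then show "AE x in ?M. \<bar>v x\<bar> \<le> \<phi> x"
      unfolding \<phi>_def by eventually_elim (auto intro!: cINF_greatest)
  qed
  have "I \<phi> \<le> Inf (I ` S)"
  proof (rule field_le_epsilon)
    fix \<epsilon> :: real assume "0 < \<epsilon>"
    then obtain k where k: "inverse (real (Suc k)) < \<epsilon>" using reals_Archimedean by blast
    have "I \<phi> \<le> I (\<zeta> k)"
      unfolding I_def using \<phi>_le int[OF \<phi>S] int[OF \<zeta>(1)] by (intro integral_mono) auto
    then show "I \<phi> \<le> Inf (I ` S) + \<epsilon>" using \<zeta>(2)[of k] k by linarith
  qed
  have min: "AE x in ?M. \<phi> x \<le> \<theta> x" if \<theta>: "\<theta> \<in> S" for \<theta>
  proof -
    \<comment> \<open>The minimum with another bound is still a bound. Its integral cannot lie below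
      the infimum, so it agrees with \<phi> almost everywhere.\<close>
    define \<mu> where "\<mu> x = min (\<phi> x) (\<theta> x)" for x
    have \<mu>: "\<mu> \<in> S"
    proof (rule smaller[OF _ _ \<phi>S])
      show "\<mu> \<in> borel_measurable ?M"
        unfolding \<mu>_def using meas[OF \<phi>S] meas[OF \<theta>] by simp
      show "0 \<le> \<mu> x" if "x \<in> U" for x using nonneg[OF \<phi>S that] nonneg[OF \<theta> that] by (simp add: \<mu>_def)
      fix P v assume "weak_partial U j (\<lambda>x. dist (f x) P) v"
      then have "AE x in ?M. \<bar>v x\<bar> \<le> \<phi> x" "AE x in ?M. \<bar>v x\<bar> \<le> \<theta> x"
        using \<phi>S \<theta> by (auto simp: S_def partial_bound_def)
      then show "AE x in ?M. \<bar>v x\<bar> \<le> \<mu> x" unfolding \<mu>_def by eventually_elim simp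
    qed (simp add: \<mu>_def)
    have "Inf (I ` S) \<le> I \<mu>" using bdd \<mu> by (intro cInf_lower) auto
    then have "(\<integral>x. \<phi> x - \<mu> x \<partial>?M) \<le> 0"
      using \<open>I \<phi> \<le> Inf (I ` S)\<close> int[OF \<phi>S] int[OF \<mu>] by (simp add: I_def)
    moreover have "0 \<le> (\<integral>x. \<phi> x - \<mu> x \<partial>?M)"
      by (intro integral_nonneg_AE AE_I2) (simp add: \<mu>_def)
    ultimately have "(\<integral>x. \<phi> x - \<mu> x \<partial>?M) = 0" by simp
    moreover have "integrable ?M (\<lambda>x. \<phi> x - \<mu> x)" using int[OF \<phi>S] int[OF \<mu>] by simp
    moreover have "AE x in ?M. 0 \<le> \<phi> x - \<mu> x" by (simp add: \<mu>_def)
    ultimately have "AE x in ?M. \<phi> x - \<mu> x = 0" using integral_nonneg_eq_0_iff_AE by blast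
    then show ?thesis by eventually_elim (simp add: \<mu>_def min_def split: if_splits)
  qed
  have "\<exists>\<phi>. partial_bound U j f \<phi> \<and> (\<forall>\<psi>. partial_bound U j f \<psi> \<longrightarrow> (AE x in ?M. \<phi> x \<le> \<psi> x))"
    using \<phi>S min by (auto simp: S_def)
  from someI_ex[OF this] show "partial_bound U j f (metric_partial U j f)"
    "partial_bound U j f \<psi> \<Longrightarrow> AE x in lebesgue_on U. metric_partial U j f x \<le> \<psi> x"
    unfolding metric_partial_def by auto
qed

text \<open>The distance to any \<open>P\<close> inherits the Lipschitz constant of
  \<open>f\<close>, so one constant bounds the weak derivatives for all \<open>P\<close>; uniqueness
  covers every choice of them. The factor \<open>CARD('m)\<close> comes from estimating the
  Euclidean norm of the gradient by the sum of its components.\<close>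

lemma W1inf_directionally_Lipschitz:
  fixes f :: "real ^ 'm::finite \<Rightarrow> 'a::metric_space" and L :: real
  assumes U: "open U" "bounded U" "closure U \<subseteq> V" and cont: "continuous_on V f" and \<delta>: "0 < \<delta>" and L: "0 \<le> L"
    and shift: "\<And>j x t. x \<in> U \<Longrightarrow> 0 < t \<Longrightarrow> t \<le> \<delta> \<Longrightarrow> x + t *\<^sub>R axis j 1 \<in> V"
    and Lip: "\<And>j x t. x \<in> U \<Longrightarrow> 0 < t \<Longrightarrow> t \<le> \<delta> \<Longrightarrow> dist (f (x + t *\<^sub>R axis j 1)) (f x) \<le> L * t"
  shows "f \<in> W1inf U" "Linf_norm U (metric_gradient U f) \<le> ennreal (CARD('m) * L)"
proof -
  let ?M = "lebesgue_on U"
  have lm: "U \<in> lmeasurable" using U by (simp add: lmeasurable_open)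
  have UV: "U \<subseteq> V" using U closure_subset by blast
  have dist_cont: "continuous_on V (\<lambda>x. dist (f x) P)" for P by (intro continuous_intros cont)
  have weak: "\<exists>v. v \<in> borel_measurable ?M \<and> (\<forall>x. \<bar>v x\<bar> \<le> L) \<and> weak_partial U j (\<lambda>x. dist (f x) P) v" for j P
  proof (rule weak_partial_exists[OF U dist_cont \<delta> shift _ L])
    fix x t assume "x \<in> U" "0 < t" "t \<le> \<delta>"
    then have "dist (f (x + t *\<^sub>R axis j 1)) (f x) \<le> L * t" by (rule Lip)
    moreover have "\<bar>dist (f (x + t *\<^sub>R axis j 1)) P - dist (f x) P\<bar> \<le> dist (f (x + t *\<^sub>R axis j 1)) (f x)"
      using abs_dist_diff_le[of "f (x + t *\<^sub>R axis j 1)" P "f x"] by (simp add: dist_commute[of P])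
    ultimately show "\<bar>dist (f (x + t *\<^sub>R axis j 1)) P - dist (f x) P\<bar> \<le> L * t" by (rule order.trans[rotated])
  qed blast+
  have pb: "partial_bound U j f (\<lambda>_. L)" for j
    unfolding partial_bound_def
  proof (intro conjI allI impI ballI)
    show "(\<lambda>_. L) \<in> Linf U" using L by (intro Linf_bounded[of _ _ L]) auto
    fix P w assume w: "weak_partial U j (\<lambda>x. dist (f x) P) w"
    obtain v where v: "\<And>x. \<bar>v x\<bar> \<le> L" "weak_partial U j (\<lambda>x. dist (f x) P) v" using weak by blast
    from weak_partial_unique[OF U(1) v(2) w] show "AE x in ?M. \<bar>w x\<bar> \<le> L"
      by eventually_elim (use v(1) in metis)
  qed (use L in auto)
  show "f \<in> W1inf U"
    unfolding W1inf_def W1inf_real_def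
  proof (intro CollectI conjI allI)
    show "f \<in> borel_measurable ?M"
      using continuous_on_subset[OF cont UV] U(1) by (intro continuous_imp_measurable_on_sets_lebesgue) auto
    show "\<exists>\<phi>. partial_bound U j f \<phi>" for j using pb by blast
    show "\<exists>v\<in>Linf U. weak_partial U j (\<lambda>x. dist (f x) P) v" for P j
      using weak[of j P] Linf_bounded by blast
    fix P
    have "bounded ((\<lambda>x. dist (f x) P) ` closure U)"
      using U by (intro compact_imp_bounded compact_continuous_image continuous_on_subset[OF dist_cont]) auto
    then obtain K where "\<And>x. x \<in> closure U \<Longrightarrow> \<bar>dist (f x) P\<bar> \<le> K" by (auto simp: bounded_iff)
    then show "(\<lambda>x. dist (f x) P) \<in> Linf U"
      using continuous_on_subset[OF dist_cont UV] U(1) closure_subset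
      by (intro Linf_bounded[of _ _ K] continuous_imp_measurable_on_sets_lebesgue) auto
  qed
  have mp: "partial_bound U j f (metric_partial U j f)" "AE x in ?M. metric_partial U j f x \<le> L" for j
    using metric_partial_minimal[OF lm pb] pb by auto
  have "AE x in ?M. \<forall>j. metric_partial U j f x \<le> L" using mp(2) by (simp add: AE_all_countable)
  moreover have "AE x in ?M. x \<in> U" by (rule AE_I2) simp
  ultimately have "AE x in ?M. ennreal \<bar>metric_gradient U f x\<bar> \<le> ennreal (CARD('m) * L)"
  proof eventually_elim
    case (elim x)
    have "0 \<le> metric_partial U j f x" for j using mp(1)[of j] elim by (simp add: partial_bound_def)
    then have "metric_gradient U f x \<le> (\<Sum>j\<in>UNIV. metric_partial U j f x)"
      unfolding metric_gradient_def L2_set_def[symmetric] by (intro L2_set_le_sum)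
    also have "\<dots> \<le> CARD('m) * L" using elim by (intro sum_bounded_above) auto
    finally have "metric_gradient U f x \<le> CARD('m) * L" .
    moreover have "0 \<le> metric_gradient U f x" by (simp add: metric_gradient_def sum_nonneg)
    ultimately show ?case by (intro ennreal_leI) simp
  qed
  moreover have "metric_gradient U f \<in> borel_measurable ?M"
  proof -
    have [measurable]: "metric_partial U j f \<in> borel_measurable ?M" for j
      using mp(1)[of j] by (simp add: partial_bound_def Linf_def)
    show ?thesis unfolding metric_gradient_def[abs_def] by measurable
  qed
  ultimately show "Linf_norm U (metric_gradient U f) \<le> ennreal (CARD('m) * L)"
    unfolding Linf_norm_def by (intro esssup_I measurable_compose[OF _ measurable_ennreal] borel_measurable_abs)
qed

section \<open>Sorted coordinates of unordered tuples\<close>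

text \<open>Sorting depends on the tuple alone, so no continuous choice of representatives is
  involved. Only indices below \<open>CARD('q)\<close> are meaningful.\<close>

definition sorted_coord :: "'n \<Rightarrow> (real ^ 'n::finite, 'q::finite) unordered_tuple \<Rightarrow> nat \<Rightarrow> real" where
  "sorted_coord l S i = sorted_list_of_multiset (image_mset (\<lambda>p. p $ l) (Rep_unordered_tuple S)) ! i"

lemma image_sorted_coord:
  fixes w :: "real ^ 'n::finite ^ 'q::finite"
  shows "image_mset (sorted_coord l (unordered w)) (mset_set {..<CARD('q)}) = image_mset (\<lambda>i. w $ i $ l) (mset_set UNIV)"
proof -
  define xs where "xs = sorted_list_of_multiset (image_mset (\<lambda>p. p $ l) (Rep_unordered_tuple (unordered w)))"
  have m: "mset xs = image_mset (\<lambda>i. w $ i $ l) (mset_set UNIV)"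
    by (simp add: xs_def Rep_unordered multiset.map_comp comp_def)
  then have "length xs = CARD('q)" by (metis size_image_mset size_mset size_mset_set)
  moreover have "image_mset ((!) xs) (mset_set {0..<length xs}) = mset xs"
    by (metis map_nth mset_map mset_upt)
  moreover have "sorted_coord l (unordered w) = (!) xs" by (simp add: sorted_coord_def xs_def fun_eq_iff)
  ultimately show ?thesis using m by (simp add: lessThan_atLeast0)
qed

lemma sorted_coord_mono:
  fixes S :: "(real ^ 'n::finite, 'q::finite) unordered_tuple"
  assumes "i \<le> j" "j < CARD('q)"
  shows "sorted_coord l S i \<le> sorted_coord l S j"
proof -
  have "size (image_mset (\<lambda>p. p $ l) (Rep_unordered_tuple S)) = CARD('q)"
    using Rep_unordered_tuple[of S] by simp
  then have "length (sorted_list_of_multiset (image_mset (\<lambda>p. p $ l) (Rep_unordered_tuple S))) = CARD('q)"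
    by (metis mset_sorted_list_of_multiset size_mset)
  then show ?thesis
    unfolding sorted_coord_def using assms by (intro sorted_nth_mono) auto
qed

lemma sorted_coord_image:
  fixes w :: "real ^ 'n::finite ^ 'q::finite"
  obtains k where "k < CARD('q)" "sorted_coord l (unordered w) k = w $ i $ l"
proof -
  have "w $ i $ l \<in># image_mset (\<lambda>i. w $ i $ l) (mset_set UNIV)" by simp
  then have "w $ i $ l \<in> sorted_coord l (unordered w) ` {..<CARD('q)}"
    unfolding image_sorted_coord[symmetric] by simp
  then show ?thesis using that by auto
qed

lemma card_image_mset_eq:
  assumes "image_mset x (mset_set I) = image_mset y (mset_set J)" "finite I" "finite J"
  shows "card {i \<in> I. P (x i)} = card {j \<in> J. P (y j)}"
proof -
  have "card {i \<in> I. P (x i)} = size (filter_mset P (image_mset x (mset_set I)))"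
    using assms(2) by (simp add: filter_mset_image_mset)
  also have "\<dots> = card {j \<in> J. P (y j)}"
    unfolding assms(1) using assms(3) by (simp add: filter_mset_image_mset)
  finally show ?thesis .
qed

text \<open>By counting: at least i + 1 coordinates of \<open>q\<close> are at most its i-th sorted
  one, so at least i + 1 coordinates of \<open>p\<close> are at most that value plus \<epsilon>. If
  the i-th of \<open>p\<close> were larger, at most i of them could be.\<close>

lemma sorted_coord_le:
  fixes p q :: "real ^ 'n::finite ^ 'q::finite"
  assumes i: "i < CARD('q)" and close: "\<And>j. \<bar>p $ j $ l - q $ j $ l\<bar> \<le> \<epsilon>"
  shows "sorted_coord l (unordered p) i \<le> sorted_coord l (unordered q) i + \<epsilon>"
proof (rule ccontr)
  let ?x = "sorted_coord l (unordered p)" and ?y = "sorted_coord l (unordered q)" and ?N = "CARD('q)"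
  assume "\<not> ?x i \<le> ?y i + \<epsilon>"
  then have less: "?y i + \<epsilon> < ?x i" by simp
  have "{..i} \<subseteq> {k \<in> {..<?N}. ?y k \<le> ?y i}" using i sorted_coord_mono[of _ i l "unordered q"] by auto
  then have "card {..i} \<le> card {k \<in> {..<?N}. ?y k \<le> ?y i}" by (intro card_mono) auto
  also have "\<dots> = card {j \<in> UNIV. q $ j $ l \<le> ?y i}"
    by (rule card_image_mset_eq[OF image_sorted_coord]) auto
  also have "\<dots> \<le> card {j \<in> UNIV. p $ j $ l \<le> ?y i + \<epsilon>}"
  proof (intro card_mono subsetI)
    fix j assume "j \<in> {j \<in> UNIV. q $ j $ l \<le> ?y i}"
    then show "j \<in> {j \<in> UNIV. p $ j $ l \<le> ?y i + \<epsilon>}" using close[of j] by (simp add: abs_le_iff)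
  qed simp
  also have "\<dots> = card {k \<in> {..<?N}. ?x k \<le> ?y i + \<epsilon>}"
    by (rule card_image_mset_eq[OF image_sorted_coord, symmetric]) auto
  also have "\<dots> \<le> card {..<i}"
  proof (intro card_mono subsetI)
    fix k assume k: "k \<in> {k \<in> {..<?N}. ?x k \<le> ?y i + \<epsilon>}"
    show "k \<in> {..<i}"
    proof (rule ccontr)
      assume "k \<notin> {..<i}"
      then have "?x i \<le> ?x k" using k by (intro sorted_coord_mono) auto
      then show False using k less by simp
    qed
  qed simp
  finally show False by simp
qed

lemma component_dist_le: "\<bar>p $ j $ l - q $ j $ l\<bar> \<le> dist p q"
  for p q :: "real ^ 'n::finite ^ 'q::finite"
  using component_le_norm_cart[of "p $ j - q $ j" l] Finite_Cartesian_Product.norm_nth_le[of "p - q" j]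
  by (simp add: dist_norm)

text \<open>An optimal matching moves no coordinate by more than the distance, and sorting preserves
  this. It is the source of continuity of the sorted coordinates.\<close>

lemma sorted_coord_dist:
  fixes S T :: "(real ^ 'n::finite, 'q::finite) unordered_tuple"
  assumes "i < CARD('q)"
  shows "\<bar>sorted_coord l S i - sorted_coord l T i\<bar> \<le> dist S T"
proof -
  obtain p q0 where pq0: "S = unordered p" "T = unordered q0" using unordered_surj by metis
  obtain s where s: "s permutes UNIV" "dist S T = dist p (permute_rows s q0)"
    using dist_unordered_attained[of p q0] pq0 by metis
  define q where "q = permute_rows s q0"
  have q: "T = unordered q" unfolding pq0 q_def using s(1) unordered_eq_iff by metis
  have "\<bar>p $ j $ l - q $ j $ l\<bar> \<le> dist S T" "\<bar>q $ j $ l - p $ j $ l\<bar> \<le> dist S T" for j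
    using component_dist_le[of p j l q] s(2) by (simp_all add: q_def abs_minus_commute)
  then have "sorted_coord l S i \<le> sorted_coord l T i + dist S T" "sorted_coord l T i \<le> sorted_coord l S i + dist S T"
    unfolding pq0(1) q by (intro sorted_coord_le assms; simp add: pq0(1) q)+
  then show ?thesis by (simp add: abs_le_iff)
qed

text \<open>The product ignores the order of its factors, so the sorted values may be replaced by
  the rows of any representative, on which the invariant polynomials are evaluated.\<close>

lemma roots_poly_sorted_coord:
  fixes w :: "real ^ 'n::finite ^ 'q::finite"
  shows "roots_poly CARD('q) (\<lambda>i. sorted_coord l (unordered w) i / c) = (\<Prod>i\<in>UNIV. [:- ((1 / c) *\<^sub>R w) $ i $ l, 1:])"
proof -
  have "roots_poly CARD('q) (\<lambda>i. sorted_coord l (unordered w) i / c) =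
      prod_mset (image_mset (\<lambda>z. [:- (z / c), 1:]) (image_mset (sorted_coord l (unordered w)) (mset_set {..<CARD('q)})))"
    by (simp add: roots_poly_def prod_unfold_prod_mset multiset.map_comp comp_def)
  also have "\<dots> = (\<Prod>i\<in>UNIV. [:- ((1 / c) *\<^sub>R w) $ i $ l, 1:])"
    unfolding image_sorted_coord by (simp add: prod_unfold_prod_mset multiset.map_comp comp_def)
  finally show ?thesis .
qed

text \<open>A value \<open>q $ i $ l\<close> close to \<open>p $ i $ l\<close> is a sorted coordinate whose base value equals \<open>p $ i $ l\<close>,
  because distinct coordinate values at the base point are separated.\<close>

lemma unordered_slope:
  fixes g :: "real \<Rightarrow> (real ^ 'n::finite, 'q::finite) unordered_tuple" and \<Lambda> :: real
  assumes cont: "(g \<longlongrightarrow> g 0) (at 0)" and \<Lambda>: "0 \<le> \<Lambda>"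
    and slope: "\<And>l. slope_le CARD('q) \<Lambda> (\<lambda>t. sorted_coord l (g t))"
  shows "\<forall>\<^sub>F t in at 0. dist (g t) (g 0) \<le> CARD('q) * (CARD('n) * \<Lambda>) * \<bar>t\<bar>"
proof -
  define R where "R = (\<Union>l. sorted_coord l (g 0) ` {..<CARD('q)})"
  have "finite R" by (auto simp: R_def)
  \<comment> \<open>The distances between distinct coordinate values at the base point; the element
    1 only keeps the set nonempty.\<close>
  define D where "D = insert 1 ((\<lambda>(a, b). \<bar>a - b\<bar>) ` {(a, b) \<in> R \<times> R. a \<noteq> b})"
  have "finite {(a, b) \<in> R \<times> R. a \<noteq> b}"
    by (rule finite_subset[of _ "R \<times> R"]) (use \<open>finite R\<close> in auto)
  then have D: "finite D" "D \<noteq> {}" by (auto simp: D_def)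
  define \<epsilon> where "\<epsilon> = Min D"
  have \<epsilon>: "0 < \<epsilon>" unfolding \<epsilon>_def using D by (subst Min_gr_iff) (auto simp: D_def)
  have sep: "a = b" if "a \<in> R" "b \<in> R" "\<bar>a - b\<bar> < \<epsilon>" for a b
  proof (rule ccontr)
    assume "a \<noteq> b"
    then have "\<bar>a - b\<bar> \<in> D" unfolding D_def using that(1,2) by force
    then have "\<epsilon> \<le> \<bar>a - b\<bar>" unfolding \<epsilon>_def using D by simp
    then show False using that(3) by simp
  qed
  have "\<forall>\<^sub>F t in at 0. dist (g t) (g 0) < \<epsilon> / 2" using cont \<epsilon> by (intro tendstoD) auto
  moreover have "\<forall>\<^sub>F t in at 0. \<Lambda> * \<bar>t\<bar> < \<epsilon> / 2"
  proof -
    have "((\<lambda>t. \<Lambda> * \<bar>t\<bar>) \<longlongrightarrow> \<Lambda> * \<bar>0\<bar>) (at 0)" by (intro tendsto_intros)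
    then show ?thesis using \<epsilon> by (intro order_tendstoD) auto
  qed
  moreover have "\<forall>\<^sub>F t in at 0. \<forall>l. \<forall>k\<in>{..<CARD('q)}. \<bar>sorted_coord l (g t) k - sorted_coord l (g 0) k\<bar> \<le> \<Lambda> * \<bar>t\<bar>"
    using slope unfolding slope_le_def by (intro eventually_all_finite eventually_ball_finite) auto
  ultimately show ?thesis
  proof eventually_elim
    case (elim t)
    \<comment> \<open>The points are matched optimally as a whole, not coordinate by coordinate.
      Each matched coordinate is within \<epsilon>/2 of its partner and is a sorted coordinate that
      moved by less than \<epsilon>/2, so it started at its partner's value.\<close>
    obtain p q0 where pq0: "g 0 = unordered p" "g t = unordered q0" using unordered_surj by metis
    obtain s where s: "s permutes UNIV" "dist (g 0) (g t) = dist p (permute_rows s q0)"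
      using dist_unordered_attained[of p q0] pq0 by metis
    define q where "q = permute_rows s q0"
    have q: "g t = unordered q" unfolding pq0 q_def using s(1) unordered_eq_iff by metis
    have coord: "\<bar>p $ i $ l - q $ i $ l\<bar> \<le> \<Lambda> * \<bar>t\<bar>" for i l
    proof -
      obtain k where k: "k < CARD('q)" "sorted_coord l (g t) k = q $ i $ l"
        using sorted_coord_image[of l q i] unfolding q by metis
      obtain k' where k': "k' < CARD('q)" "sorted_coord l (g 0) k' = p $ i $ l"
        using sorted_coord_image[of l p i] unfolding pq0(1) by metis
      have kt: "\<bar>sorted_coord l (g t) k - sorted_coord l (g 0) k\<bar> \<le> \<Lambda> * \<bar>t\<bar>" using elim(3) k(1) by auto
      have "\<bar>p $ i $ l - q $ i $ l\<bar> < \<epsilon> / 2"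
        using component_dist_le[of p i l q] s(2) elim(1) by (simp add: q_def dist_commute)
      then have "\<bar>sorted_coord l (g 0) k - p $ i $ l\<bar> < \<epsilon>" using kt k(2) elim(2) by linarith
      moreover have "sorted_coord l (g 0) k \<in> R" "p $ i $ l \<in> R"
        unfolding k'(2)[symmetric] using k(1) k'(1) by (auto simp: R_def)
      ultimately have "sorted_coord l (g 0) k = p $ i $ l" by (intro sep)
      then show ?thesis using kt k(2) by (simp add: abs_minus_commute)
    qed
    have "dist (g t) (g 0) = norm (p - q)" using s(2) by (simp add: dist_norm q_def dist_commute[of "g t"])
    also have "\<dots> \<le> (\<Sum>i\<in>UNIV. norm (p $ i - q $ i))"
      unfolding norm_vec_def by (intro order.trans[OF L2_set_le_sum]) auto
    also have "\<dots> \<le> (\<Sum>i\<in>(UNIV :: 'q set). CARD('n) * (\<Lambda> * \<bar>t\<bar>))"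
    proof (rule sum_mono)
      fix i
      have "norm (p $ i - q $ i) \<le> (\<Sum>l\<in>UNIV. \<bar>p $ i $ l - q $ i $ l\<bar>)"
        using norm_le_l1_cart[of "p $ i - q $ i"] by simp
      also have "\<dots> \<le> (\<Sum>l\<in>(UNIV :: 'n set). \<Lambda> * \<bar>t\<bar>)" by (intro sum_mono coord)
      finally show "norm (p $ i - q $ i) \<le> CARD('n) * (\<Lambda> * \<bar>t\<bar>)" by simp
    qed
    finally show ?case by (simp add: mult.assoc)
  qed
qed

text \<open>The estimate is additive over adjacent intervals, and for short intervals around a point
  it follows by comparing both ends with that point; bisection does the rest.\<close>

lemma Lipschitz_of_pointwise:
  fixes g :: "real \<Rightarrow> 'a::metric_space" and L :: real
  assumes ab: "a \<le> b" and loc: "\<And>s. a \<le> s \<Longrightarrow> s \<le> b \<Longrightarrow> \<forall>\<^sub>F h in at 0. dist (g (s + h)) (g s) \<le> L * \<bar>h\<bar>"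
  shows "dist (g b) (g a) \<le> L * (b - a)"
  using ab
proof (rule Bolzano)
  fix x y z assume "dist (g y) (g x) \<le> L * (y - x)" "dist (g z) (g y) \<le> L * (z - y)"
  then show "dist (g z) (g x) \<le> L * (z - x)"
    using dist_triangle[of "g z" "g x" "g y"] by (simp add: right_diff_distrib)
next
  fix x assume "a \<le> x" "x \<le> b"
  then obtain d where d: "0 < d" "\<And>h. h \<noteq> 0 \<Longrightarrow> \<bar>h\<bar> < d \<Longrightarrow> dist (g (x + h)) (g x) \<le> L * \<bar>h\<bar>"
    using loc[of x] unfolding eventually_at by (auto simp: dist_real_def)
  have near: "dist (g y) (g x) \<le> L * \<bar>y - x\<bar>" if "\<bar>y - x\<bar> < d" for y
    using d(2)[of "y - x"] that by (cases "y = x") auto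
  show "\<exists>d>0. \<forall>y z. y \<le> x \<and> x \<le> z \<and> z - y < d \<longrightarrow> dist (g z) (g y) \<le> L * (z - y)"
  proof (intro exI[of _ d] conjI allI impI)
    fix y z assume yz: "y \<le> x \<and> x \<le> z \<and> z - y < d"
    have "dist (g z) (g y) \<le> dist (g z) (g x) + dist (g y) (g x)" by (rule dist_triangle2)
    also have "\<dots> \<le> L * \<bar>z - x\<bar> + L * \<bar>y - x\<bar>" using yz by (intro add_mono near) auto
    also have "\<dots> = L * (z - y)" using yz by (simp add: algebra_simps)
    finally show "dist (g z) (g y) \<le> L * (z - y)" .
  qed (rule d(1))
qed

section \<open>Invariants along lines\<close>

lemma coeff_prod_polynomial:
  fixes l :: "'n::finite"
  assumes "finite I"
  shows "real_polynomial_function (\<lambda>w :: real ^ 'n ^ 'q::finite. coeff (\<Prod>i\<in>I. [:- w $ i $ l, 1:]) m)"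
  using assms
proof (induction arbitrary: m)
  case empty
  show ?case unfolding prod.empty by (rule real_polynomial_function.intros(2))
next
  case (insert i I)
  have "bounded_linear (\<lambda>w :: real ^ 'n ^ 'q. w $ i $ l)"
    by (intro bounded_linear_compose[OF bounded_linear_vec_nth] bounded_linear_vec_nth)
  then have lin: "real_polynomial_function (\<lambda>w :: real ^ 'n ^ 'q. w $ i $ l)"
    by (rule real_polynomial_function.intros(1))
  have "real_polynomial_function (\<lambda>w :: real ^ 'n ^ 'q. - 1 * (w $ i $ l * coeff (\<Prod>i\<in>I. [:- w $ i $ l, 1:]) m) +
      (case m of 0 \<Rightarrow> 0 | Suc k \<Rightarrow> coeff (\<Prod>i\<in>I. [:- w $ i $ l, 1:]) k))"
  proof (rule real_polynomial_function.intros(3))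
    show "real_polynomial_function (\<lambda>w :: real ^ 'n ^ 'q. - 1 * (w $ i $ l * coeff (\<Prod>i\<in>I. [:- w $ i $ l, 1:]) m))"
      by (intro real_polynomial_function.intros(4)[OF real_polynomial_function.intros(2)]
          real_polynomial_function.intros(4)[OF lin] insert.IH)
    show "real_polynomial_function (\<lambda>w :: real ^ 'n ^ 'q. case m of 0 \<Rightarrow> 0 | Suc k \<Rightarrow> coeff (\<Prod>i\<in>I. [:- w $ i $ l, 1:]) k)"
      by (cases m) (simp_all only: nat.case insert.IH real_polynomial_function.intros(2))
  qed
  moreover have "coeff (\<Prod>i\<in>insert i I. [:- w $ i $ l, 1:]) m = - 1 * (w $ i $ l * coeff (\<Prod>i\<in>I. [:- w $ i $ l, 1:]) m) +
      (case m of 0 \<Rightarrow> 0 | Suc k \<Rightarrow> coeff (\<Prod>i\<in>I. [:- w $ i $ l, 1:]) k)" for w :: "real ^ 'n ^ 'q"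
    using insert.hyps by (simp add: coeff_pCons split: nat.split)
  ultimately show ?case by simp
qed

text \<open>Up to sign these are the elementary symmetric polynomials of column \<open>l\<close>.
  Being invariant, they lie in the algebra generated by the components of \<sigma>, which is how
  \<Sigma> controls the sorted coordinates.\<close>

lemma coeff_prod_invariant:
  "(\<lambda>w :: real ^ 'n::finite ^ 'q::finite. coeff (\<Prod>i\<in>UNIV. [:- w $ i $ l, 1:]) m) \<in> invariant_polynomials"
  unfolding invariant_polynomials_def
proof (intro CollectI conjI allI impI)
  show "real_polynomial_function (\<lambda>w :: real ^ 'n ^ 'q. coeff (\<Prod>i\<in>UNIV. [:- w $ i $ l, 1:]) m)"
    by (rule coeff_prod_polynomial) simp
  fix s and w :: "real ^ 'n ^ 'q" assume "s permutes (UNIV :: 'q set)"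
  then have "(\<Prod>i\<in>UNIV. [:- w $ s i $ l, 1:]) = (\<Prod>i\<in>UNIV. [:- w $ i $ l, 1:])"
    using prod.permute[of s UNIV "\<lambda>i. [:- w $ i $ l, 1:]"] by (simp add: comp_def)
  then show "coeff (\<Prod>i\<in>UNIV. [:- permute_rows s w $ i $ l, 1:]) m = coeff (\<Prod>i\<in>UNIV. [:- w $ i $ l, 1:]) m"
    by (simp add: permute_rows_def)
qed

text \<open>The bound \<open>B\<close> depends on how \<open>g\<close> is built from the generators,
  not on the path \<open>w\<close>; this keeps the final constant independent of
  \<open>f\<close>.\<close>

lemma generated_algebra_dd_bounded:
  assumes "g \<in> generated_algebra G"
  shows "\<exists>B. \<forall>w. (\<forall>h\<in>G. dd_bounded K A (\<lambda>t. h (w t))) \<longrightarrow> dd_bounded K B (\<lambda>t. g (w t))"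
  using assms
proof induction
  case (generator g)
  then show ?case by (intro exI[of _ A]) blast
next
  case (const c)
  show ?case using dd_bounded_const by blast
next
  case (add g h)
  then obtain B C where "\<forall>w. (\<forall>h\<in>G. dd_bounded K A (\<lambda>t. h (w t))) \<longrightarrow> dd_bounded K B (\<lambda>t. g (w t))"
    "\<forall>w. (\<forall>h\<in>G. dd_bounded K A (\<lambda>t. h (w t))) \<longrightarrow> dd_bounded K C (\<lambda>t. h (w t))" by (elim exE)
  then show ?case by (intro exI[of _ "B + C"]) (simp add: dd_bounded_add)
next
  case (mult g h)
  then obtain B C where "\<forall>w. (\<forall>h\<in>G. dd_bounded K A (\<lambda>t. h (w t))) \<longrightarrow> dd_bounded K B (\<lambda>t. g (w t))"
    "\<forall>w. (\<forall>h\<in>G. dd_bounded K A (\<lambda>t. h (w t))) \<longrightarrow> dd_bounded K C (\<lambda>t. h (w t))" by (elim exE)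
  then show ?case by (intro exI[of _ "real (Suc K) * (B * C)"] allI impI dd_bounded_mult) simp_all
qed

section \<open>From the C^(k,1) norm to divided differences and slopes on line segments\<close>

lemma finite_lists_le: "finite {js :: 'm::finite list. length js \<le> k}"
  using finite_lists_length_le[of "UNIV :: 'm set" k] by simp

text \<open>The suprema in the norm must first be seen to be finite: the continuous extension to the
  compact closure bounds the derivatives, and the Lipschitz condition bounds the quotients.\<close>

lemma Ck1_norm_bounds:
  fixes u :: "real ^ 'm::finite \<Rightarrow> real"
  assumes u: "Ck1_closure k \<Omega> u" and \<Omega>: "bounded \<Omega>"
  shows "x \<in> \<Omega> \<Longrightarrow> \<bar>u x\<bar> \<le> Ck1_norm k \<Omega> u"
    "x \<in> \<Omega> \<Longrightarrow> y \<in> \<Omega> \<Longrightarrow> length js = k \<Longrightarrow> \<bar>partials js u x - partials js u y\<bar> \<le> Ck1_norm k \<Omega> u * dist x y"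
proof -
  define A where "A = {sup_norm_on \<Omega> (partials js u) |js. length js \<le> k}"
  define B where "B = {Lip_on \<Omega> (partials js u) |js. length js = k}"
  have "A = (\<lambda>js. sup_norm_on \<Omega> (partials js u)) ` {js. length js \<le> k}" by (auto simp: A_def)
  then have finA: "finite A" by (simp only: finite_imageI finite_lists_le)
  have "B \<subseteq> (\<lambda>js. Lip_on \<Omega> (partials js u)) ` {js. length js \<le> k}" by (auto simp: B_def)
  then have finB: "finite B" using finite_lists_le finite_subset by blast
  have sup: "\<bar>partials js u x\<bar> \<le> sup_norm_on \<Omega> (partials js u)" "0 \<le> sup_norm_on \<Omega> (partials js u)"
    if "length js \<le> k" "x \<in> \<Omega>" for js x
  proof -
    note js = that(1)
    obtain v where v: "continuous_on (closure \<Omega>) v" "\<forall>x\<in>\<Omega>. v x = partials js u x"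
      using u js unfolding Ck1_closure_def by blast
    have "bounded (v ` closure \<Omega>)"
      using \<Omega> by (intro compact_imp_bounded compact_continuous_image v) auto
    then obtain M where M: "\<And>x. x \<in> closure \<Omega> \<Longrightarrow> \<bar>v x\<bar> \<le> M" by (auto simp: bounded_iff)
    have "bdd_above (insert 0 ((\<lambda>x. \<bar>partials js u x\<bar>) ` \<Omega>))"
    proof (rule bdd_aboveI[of _ "max 0 M"])
      fix z assume "z \<in> insert 0 ((\<lambda>x. \<bar>partials js u x\<bar>) ` \<Omega>)"
      then consider "z = 0" | y where "y \<in> \<Omega>" "z = \<bar>partials js u y\<bar>" by blast
      then show "z \<le> max 0 M"
      proof cases
        case 2
        then show ?thesis using M[of y] v(2) closure_subset[of \<Omega>] by (auto simp: le_max_iff_disj)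
      qed simp
    qed
    then show "\<bar>partials js u x\<bar> \<le> sup_norm_on \<Omega> (partials js u)" "0 \<le> sup_norm_on \<Omega> (partials js u)"
      unfolding sup_norm_on_def using that(2) by (auto intro!: cSup_upper)
  qed
  have lip: "\<bar>partials js u x - partials js u y\<bar> \<le> Lip_on \<Omega> (partials js u) * dist x y" "0 \<le> Lip_on \<Omega> (partials js u)"
    if "length js \<le> k" "x \<in> \<Omega>" "y \<in> \<Omega>" for js x y
  proof -
    note js = that(1)
    obtain L where L: "L-lipschitz_on \<Omega> (partials js u)" using u js unfolding Ck1_closure_def by blast
    let ?S = "insert 0 {dist (partials js u x) (partials js u y) / dist x y |x y. x \<in> \<Omega> \<and> y \<in> \<Omega> \<and> x \<noteq> y}"
    have bdd: "bdd_above ?S"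
    proof (rule bdd_aboveI[of _ L])
      fix z assume "z \<in> ?S"
      then show "z \<le> L"
        using lipschitz_onD[OF L] lipschitz_on_nonneg[OF L] by (auto simp: divide_le_eq)
    qed
    then show "0 \<le> Lip_on \<Omega> (partials js u)" unfolding Lip_on_def by (intro cSup_upper) auto
    show "\<bar>partials js u x - partials js u y\<bar> \<le> Lip_on \<Omega> (partials js u) * dist x y"
    proof (cases "x = y")
      case False
      then have "dist (partials js u x) (partials js u y) / dist x y \<le> Lip_on \<Omega> (partials js u)"
        unfolding Lip_on_def using that bdd by (intro cSup_upper) auto
      then show ?thesis using False by (simp add: divide_le_eq dist_real_def)
    qed simp
  qed
  have norm: "Ck1_norm k \<Omega> u = Max A + Max B" by (simp add: Ck1_norm_def A_def B_def)
  have inA: "sup_norm_on \<Omega> (partials js u) \<le> Max A" if "length js \<le> k" for js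
    using that finA by (intro Max_ge) (auto simp: A_def)
  have inB: "Lip_on \<Omega> (partials js u) \<le> Max B" if "length js = k" for js
    using that finB by (intro Max_ge) (auto simp: B_def)
  obtain js0 :: "'m list" where js0: "length js0 = k" using Ex_list_of_length by blast
  show "\<bar>u x\<bar> \<le> Ck1_norm k \<Omega> u" if "x \<in> \<Omega>"
    using sup(1)[of "[]" x] inA[of "[]"] lip(2)[of js0 x x] inB[OF js0] js0 that
    unfolding norm by (simp add: partials_def)
  show "\<bar>partials js u x - partials js u y\<bar> \<le> Ck1_norm k \<Omega> u * dist x y" if "x \<in> \<Omega>" "y \<in> \<Omega>" "length js = k"
  proof -
    have "Lip_on \<Omega> (partials js u) \<le> Ck1_norm k \<Omega> u"
      using inB[OF that(3)] sup(2)[of "[]" x] inA[of "[]"] that unfolding norm by simp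
    then have "Lip_on \<Omega> (partials js u) * dist x y \<le> Ck1_norm k \<Omega> u * dist x y" by (intro mult_right_mono) auto
    then show ?thesis using lip(1)[of js x y] that by simp
  qed
qed

text \<open>\<open>U i\<close> is the i-th derivative along the rescaled segment; its chain rule
  factor \<delta>^i is at most 1. For k = Q - 1 the k + 2 nodes give the order Q that
  \<open>coeffs_bounded\<close> demands.\<close>

lemma Ck1_dd_bound:
  fixes u :: "real ^ 'm::finite \<Rightarrow> real"
  assumes u: "Ck1_closure k \<Omega> u" and \<Omega>: "bounded \<Omega>" and \<delta>: "0 < \<delta>" "\<delta> \<le> 1"
    and seg: "\<And>s. s \<in> {-1..1} \<Longrightarrow> x + (\<delta> * s) *\<^sub>R axis j 1 \<in> \<Omega>"
    and S: "finite S" "S \<subseteq> {-1..1}" "card S = Suc (Suc k)"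
  shows "\<bar>dd (\<lambda>s. u (x + (\<delta> * s) *\<^sub>R axis j 1)) S\<bar> \<le> Ck1_norm k \<Omega> u"
proof -
  define U where "U i s = \<delta> ^ i * partials (replicate i j) u (x + (\<delta> * s) *\<^sub>R axis j 1)" for i s
  have N: "0 \<le> Ck1_norm k \<Omega> u"
    using Ck1_norm_bounds(1)[OF u \<Omega> seg[of 0]] by (simp add: order.trans[OF abs_ge_zero])
  have "\<bar>dd (U 0) S\<bar> \<le> Ck1_norm k \<Omega> u"
  proof (rule dd_bound_iterated_deriv[OF _ _ S])
    fix i s assume i: "i < k" and s: "s \<in> {-1..1::real}"
    have "Ck_on k \<Omega> u" using u by (simp add: Ck1_closure_def)
    then have "(\<lambda>t. partials (replicate i j) u (x + (\<delta> * s) *\<^sub>R axis j 1 + t *\<^sub>R axis j 1)) differentiable at 0"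
      using i seg[OF s] unfolding Ck_on_def by simp
    from DERIV_line[OF this]
    have line: "((\<lambda>t. partials (replicate i j) u (x + t *\<^sub>R axis j 1)) has_real_derivative
        partials (replicate (Suc i) j) u (x + (\<delta> * s) *\<^sub>R axis j 1)) (at (\<delta> * s))"
      by (simp add: partials_def)
    have scale: "((\<lambda>s. \<delta> * s) has_real_derivative \<delta>) (at s)" by (auto intro!: derivative_eq_intros)
    have "((\<lambda>s. partials (replicate i j) u (x + (\<delta> * s) *\<^sub>R axis j 1)) has_real_derivative
        \<delta> * partials (replicate (Suc i) j) u (x + (\<delta> * s) *\<^sub>R axis j 1)) (at s)"
      by (rule DERIV_cong[OF DERIV_chain'[OF scale line] mult.commute])
    from DERIV_cmult[OF this, of "\<delta> ^ i"]
    have "(U i has_real_derivative U (Suc i) s) (at s)" unfolding U_def by (simp add: mult_ac)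
    then show "(U i has_real_derivative U (Suc i) s) (at s within {-1..1})" by (rule has_field_derivative_at_within)
  next
    fix s t assume st: "s \<in> {-1..1::real}" "t \<in> {-1..1::real}"
    let ?v = "partials (replicate k j) u"
    have "\<bar>?v (x + (\<delta> * s) *\<^sub>R axis j 1) - ?v (x + (\<delta> * t) *\<^sub>R axis j 1)\<bar> \<le>
        Ck1_norm k \<Omega> u * dist (x + (\<delta> * s) *\<^sub>R axis j 1) (x + (\<delta> * t) *\<^sub>R axis j 1)"
      by (intro Ck1_norm_bounds(2)[OF u \<Omega>] seg st) simp
    also have "dist (x + (\<delta> * s) *\<^sub>R axis j 1) (x + (\<delta> * t) *\<^sub>R axis j 1) = \<delta> * \<bar>s - t\<bar>"
      using \<delta> by (simp add: dist_norm scaleR_diff_left[symmetric] right_diff_distrib[symmetric] abs_mult)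
    also have "Ck1_norm k \<Omega> u * (\<delta> * \<bar>s - t\<bar>) \<le> Ck1_norm k \<Omega> u * (1 * \<bar>s - t\<bar>)"
      using N \<delta> by (intro mult_left_mono mult_right_mono) auto
    finally have *: "\<bar>?v (x + (\<delta> * s) *\<^sub>R axis j 1) - ?v (x + (\<delta> * t) *\<^sub>R axis j 1)\<bar> \<le> Ck1_norm k \<Omega> u * \<bar>s - t\<bar>" by simp
    have "\<bar>U k s - U k t\<bar> = \<delta> ^ k * \<bar>?v (x + (\<delta> * s) *\<^sub>R axis j 1) - ?v (x + (\<delta> * t) *\<^sub>R axis j 1)\<bar>"
      using \<delta> by (simp add: U_def right_diff_distrib[symmetric] abs_mult)
    also have "\<dots> \<le> 1 * \<bar>?v (x + (\<delta> * s) *\<^sub>R axis j 1) - ?v (x + (\<delta> * t) *\<^sub>R axis j 1)\<bar>"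
      using \<delta> by (intro mult_right_mono power_le_one) auto
    finally show "\<bar>U k s - U k t\<bar> \<le> Ck1_norm k \<Omega> u * \<bar>s - t\<bar>" using * by simp
  qed
  moreover have "U 0 = (\<lambda>s. u (x + (\<delta> * s) *\<^sub>R axis j 1))" by (simp add: U_def[abs_def] partials_def)
  ultimately show ?thesis by simp
qed

text \<open>\<open>L\<close> is chosen before the map, the domain and the scales. Dividing the
  points by \<rho> divides the i-th generator by \<rho>^(d i), so its norm becomes at most 1, and
  the slope obtained for this bound is multiplied back by \<rho> / \<delta>.\<close>

lemma slope_along_line:
  fixes \<sigma> :: "real ^ 'n::finite ^ 'q::finite \<Rightarrow> real ^ 'r::finite" and d :: "'r \<Rightarrow> nat"
    and Sig :: "(real ^ 'n, 'q) unordered_tuple \<Rightarrow> real ^ 'r"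
  assumes gens: "homogeneous_generators \<sigma> d" and Sig: "\<sigma> = Sig \<circ> unordered"
  shows "\<exists>L\<ge>0. \<forall>(f :: real ^ 'm::finite \<Rightarrow> (real ^ 'n, 'q) unordered_tuple) \<Omega> \<delta> \<rho> y j l.
    bounded \<Omega> \<and> continuous_on \<Omega> f \<and> (\<forall>i. Ck1_closure (CARD('q) - 1) \<Omega> (\<lambda>x. Sig (f x) $ i)) \<and>
    0 < \<delta> \<and> \<delta> \<le> 1 \<and> cball y \<delta> \<subseteq> \<Omega> \<and> 0 < \<rho> \<and>
    (\<forall>i. Ck1_norm (CARD('q) - 1) \<Omega> (\<lambda>x. Sig (f x) $ i) \<le> \<rho> ^ d i) \<longrightarrow>
    slope_le CARD('q) (L * \<rho> / \<delta>) (\<lambda>t. sorted_coord l (f (y + t *\<^sub>R axis j 1)))"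
proof -
  let ?Q = "CARD('q)"
  define c where "c l m w = coeff (\<Prod>i\<in>UNIV. [:- w $ i $ l, 1:]) m" for l m and w :: "real ^ 'n ^ 'q"
  obtain A where A: "\<forall>u. (\<forall>t\<in>{-1..1}. \<bar>u t\<bar> \<le> 1) \<and>
     (\<forall>S. finite S \<and> S \<subseteq> {-1..1} \<and> card S = Suc ?Q \<longrightarrow> \<bar>dd u S\<bar> \<le> 1) \<longrightarrow> dd_bounded ?Q A u"
    by (rule exE[OF dd_interpolate])
  have "\<forall>l m. \<exists>B. \<forall>w. (\<forall>h\<in>range (\<lambda>j w. \<sigma> w $ j). dd_bounded ?Q A (\<lambda>t. h (w t))) \<longrightarrow> dd_bounded ?Q B (\<lambda>t. c l m (w t))"
    using gens coeff_prod_invariant unfolding c_def homogeneous_generators_def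
    by (intro allI generated_algebra_dd_bounded) auto
  then obtain B where B: "\<And>l m w. (\<forall>h\<in>range (\<lambda>j w. \<sigma> w $ j). dd_bounded ?Q A (\<lambda>t. h (w t))) \<longrightarrow>
      dd_bounded ?Q (B l m) (\<lambda>t. c l m (w t))" by metis
  \<comment> \<open>One bound for all coordinates \<open>l\<close> and all coefficients up to degree
    \<open>?Q\<close>; higher coefficients vanish.\<close>
  define B0 where "B0 = (\<Sum>l\<in>UNIV. \<Sum>m\<le>?Q. \<bar>B l m\<bar>)"
  have B0: "B l m \<le> B0" if "m \<le> ?Q" for l m
  proof -
    have "\<bar>B l m\<bar> \<le> (\<Sum>m\<le>?Q. \<bar>B l m\<bar>)" using that by (intro member_le_sum) auto
    also have "\<dots> \<le> B0" unfolding B0_def by (rule member_le_sum) (auto intro: sum_nonneg)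
    finally show ?thesis by simp
  qed
  have B0_nonneg: "0 \<le> B0" by (simp add: B0_def sum_nonneg)
  obtain L where L: "\<forall>\<rho>. sorted_roots ?Q \<rho> \<and> coeffs_bounded ?Q B0 \<rho> \<longrightarrow> slope_le ?Q L \<rho>"
    by (rule exE[OF slope_bound])
  show ?thesis
  proof (intro exI[of _ "\<bar>L\<bar>"] conjI allI impI, simp, elim conjE)
    fix f :: "real ^ 'm \<Rightarrow> (real ^ 'n, 'q) unordered_tuple" and \<Omega> \<delta> \<rho> y j l
    assume bdd: "bounded \<Omega>" and cont: "continuous_on \<Omega> f"
      and C: "\<forall>i. Ck1_closure (?Q - 1) \<Omega> (\<lambda>x. Sig (f x) $ i)"
      and \<delta>: "0 < \<delta>" "\<delta> \<le> 1" and ball: "cball y \<delta> \<subseteq> \<Omega>" and \<rho>: "0 < \<rho>"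
      and N: "\<forall>i. Ck1_norm (?Q - 1) \<Omega> (\<lambda>x. Sig (f x) $ i) \<le> \<rho> ^ d i"
    let ?p = "\<lambda>s. y + (\<delta> * s) *\<^sub>R axis j 1"
    have seg: "?p s \<in> \<Omega>" if "s \<in> {-1..1}" for s
    proof -
      have "\<bar>s\<bar> \<le> 1" using that by (auto simp: abs_le_iff)
      then have "\<delta> * \<bar>s\<bar> \<le> \<delta>" using \<delta> by (simp add: mult_left_le)
      then have "?p s \<in> cball y \<delta>" using \<delta> by (simp add: dist_norm abs_mult)
      then show ?thesis using ball by blast
    qed
    define \<mu> where "\<mu> s i = (sorted_coord l (f (?p s)) i - 0) / \<rho>" for s i
    \<comment> \<open>\<open>w\<close> need not be continuous in \<open>s\<close>, since only
      invariants of its values are considered.\<close>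
    define w where "w s = (1 / \<rho>) *\<^sub>R representative (f (?p s))" for s
    have sig: "dd_bounded ?Q A (\<lambda>s. \<sigma> (w s) $ i)" for i
    proof -
      let ?u = "\<lambda>x. Sig (f x) $ i"
      have eq: "\<sigma> (w s) $ i = (1 / \<rho>) ^ d i * ?u (?p s)" for s
      proof -
        have "homogeneous_polynomial (d i) (\<lambda>w. \<sigma> w $ i)" using gens by (simp add: homogeneous_generators_def)
        then show ?thesis by (simp add: homogeneous_polynomial_def w_def Sig)
      qed
      have pos: "0 < \<rho> ^ d i" using \<rho> by simp
      have scaled: "\<bar>(1 / \<rho>) ^ d i * z\<bar> \<le> 1" if "\<bar>z\<bar> \<le> Ck1_norm (?Q - 1) \<Omega> ?u" for z
      proof -
        have "\<bar>z\<bar> \<le> \<rho> ^ d i" using that N by (meson order.trans)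
        then show ?thesis using pos \<rho> by (simp add: abs_mult power_one_over divide_le_eq)
      qed
      have "\<bar>\<sigma> (w s) $ i\<bar> \<le> 1" if "s \<in> {-1..1}" for s
        unfolding eq using seg[OF that] C bdd by (intro scaled Ck1_norm_bounds(1)) auto
      moreover have "\<bar>dd (\<lambda>s. \<sigma> (w s) $ i) S\<bar> \<le> 1" if "finite S" "S \<subseteq> {-1..1}" "card S = Suc ?Q" for S
        unfolding eq dd_cmult using C that seg \<delta> bdd by (intro scaled Ck1_dd_bound) auto
      ultimately show ?thesis using A[THEN spec, THEN mp, of "\<lambda>s. \<sigma> (w s) $ i"] by simp
    qed
    have "coeffs_bounded ?Q B0 \<mu>"
      unfolding coeffs_bounded_def
    proof
      fix m
      have \<mu>: "roots_poly ?Q (\<mu> s) = (\<Prod>i\<in>UNIV. [:- w s $ i $ l, 1:])" for s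
        using roots_poly_sorted_coord[of l "representative (f (?p s))" \<rho>] by (simp add: \<mu>_def[abs_def] w_def)
      show "dd_bounded ?Q B0 (\<lambda>s. coeff (roots_poly ?Q (\<mu> s)) m)"
      proof (cases "m \<le> ?Q")
        case True
        have "dd_bounded ?Q (B l m) (\<lambda>s. c l m (w s))"
          by (rule B[THEN mp]) (auto simp: sig)
        then show ?thesis using B0[OF True] unfolding \<mu> c_def by (rule dd_bounded_bound)
      next
        case False
        then have "(\<lambda>s. coeff (roots_poly ?Q (\<mu> s)) m) = (\<lambda>s. 0)" by (simp add: coeff_eq_0)
        then show ?thesis using dd_bounded_bound[OF dd_bounded_const[of ?Q 0], of B0] B0_nonneg by simp
      qed
    qed
    moreover have "sorted_roots ?Q \<mu>"
      unfolding sorted_roots_def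
    proof (intro conjI ballI allI impI)
      fix s i k assume "i \<le> k \<and> k < ?Q"
      then show "\<mu> s i \<le> \<mu> s k" using \<rho> unfolding \<mu>_def by (intro divide_right_mono diff_right_mono sorted_coord_mono) auto
    next
      fix i assume i: "i < ?Q"
      have path: "continuous_on {-1..1} (\<lambda>s. f (?p s))"
        using seg by (intro continuous_on_compose2[OF cont] continuous_intros) auto
      have "continuous_on {-1..1} (\<lambda>s. sorted_coord l (f (?p s)) i)"
        unfolding continuous_on_iff
      proof (intro ballI allI impI)
        fix s e :: real assume "s \<in> {-1..1}" "0 < e"
        then obtain \<eta> where \<eta>: "0 < \<eta>" "\<And>t. t \<in> {-1..1} \<Longrightarrow> dist t s < \<eta> \<Longrightarrow> dist (f (?p t)) (f (?p s)) < e"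
          using path unfolding continuous_on_iff by metis
        show "\<exists>\<eta>>0. \<forall>t\<in>{-1..1}. dist t s < \<eta> \<longrightarrow> dist (sorted_coord l (f (?p t)) i) (sorted_coord l (f (?p s)) i) < e"
        proof (intro exI[of _ \<eta>] conjI ballI impI \<eta>(1))
          fix t assume "t \<in> {-1..1}" "dist t s < \<eta>"
          then have "dist (f (?p t)) (f (?p s)) < e" by (rule \<eta>(2))
          then show "dist (sorted_coord l (f (?p t)) i) (sorted_coord l (f (?p s)) i) < e"
            unfolding dist_real_def by (rule le_less_trans[OF sorted_coord_dist[OF i]])
        qed
      qed
      then show "continuous_on {-1..1} (\<lambda>s. \<mu> s i)"
        unfolding \<mu>_def using \<rho> by (intro continuous_intros) auto
    qed
    ultimately have "slope_le ?Q L \<mu>" using L[THEN spec, THEN mp, of \<mu>] by simp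
    then have "slope_le ?Q \<bar>L\<bar> (\<lambda>s i. (sorted_coord l (f (?p s)) i - 0) / \<rho>)"
      unfolding \<mu>_def[abs_def] by (rule slope_le_mono) simp
    then show "slope_le ?Q (\<bar>L\<bar> * \<rho> / \<delta>) (\<lambda>t. sorted_coord l (f (y + t *\<^sub>R axis j 1)))"
      by (intro slope_le_rescale[where \<rho> = "\<lambda>t. sorted_coord l (f (y + t *\<^sub>R axis j 1))"] \<delta> \<rho>)
  qed
qed

theorem theorem10p1:
  fixes \<Omega> \<Omega>' :: "(real ^ 'm::finite) set"
    and \<sigma> :: "real ^ 'n::finite ^ 'q::finite \<Rightarrow> real ^ 'r::finite"
    and d :: "'r \<Rightarrow> nat"
    and Sig :: "(real ^ 'n, 'q) unordered_tuple \<Rightarrow> real ^ 'r"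
  assumes "open \<Omega>" and "bounded \<Omega>"
    and "homogeneous_generators \<sigma> d"
    and "\<And>j. 1 \<le> d j \<and> d j \<le> CARD('q)"
    and "\<sigma> = Sig \<circ> unordered"
    and "open \<Omega>'" and "compact (closure \<Omega>')" and "closure \<Omega>' \<subseteq> \<Omega>"
  shows "\<exists>C::real. \<forall>f :: real ^ 'm \<Rightarrow> (real ^ 'n, 'q) unordered_tuple.
    continuous_on \<Omega> f \<longrightarrow>
    (\<forall>j. Ck1_closure (CARD('q) - 1) \<Omega> (\<lambda>x. Sig (f x) $ j)) \<longrightarrow>
    f \<in> W1inf \<Omega>' \<and>
    Linf_norm \<Omega>' (metric_gradient \<Omega>' f) \<le>
      ennreal (C * (1 + (MAX j. Ck1_norm (CARD('q) - 1) \<Omega> (\<lambda>x. Sig (f x) $ j) powr (1 / d j))))"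
proof -
  let ?Q = "CARD('q)"
  obtain L where "0 \<le> L" and L: "\<forall>(f :: real ^ 'm \<Rightarrow> (real ^ 'n, 'q) unordered_tuple) \<Omega> \<delta> \<rho> y j l.
    bounded \<Omega> \<and> continuous_on \<Omega> f \<and> (\<forall>i. Ck1_closure (?Q - 1) \<Omega> (\<lambda>x. Sig (f x) $ i)) \<and>
    0 < \<delta> \<and> \<delta> \<le> 1 \<and> cball y \<delta> \<subseteq> \<Omega> \<and> 0 < \<rho> \<and>
    (\<forall>i. Ck1_norm (?Q - 1) \<Omega> (\<lambda>x. Sig (f x) $ i) \<le> \<rho> ^ d i) \<longrightarrow>
    slope_le ?Q (L * \<rho> / \<delta>) (\<lambda>t. sorted_coord l (f (y + t *\<^sub>R axis j 1)))"
    using slope_along_line[OF assms(3,5)] by (elim exE conjE)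
  obtain \<delta>0 where \<delta>0: "0 < \<delta>0" "(\<Union>x\<in>closure \<Omega>'. cball x \<delta>0) \<subseteq> \<Omega>"
    using compact_subset_open_imp_cball_epsilon_subset[OF assms(7,1,8)] .
  \<comment> \<open>With half of the margin, points moved by at most \<open>\<delta>\<close> still
    have a ball of radius \<open>\<delta>\<close> in \<Omega>.\<close>
  define \<delta> where "\<delta> = min 1 (\<delta>0 / 2)"
  have \<delta>: "0 < \<delta>" "\<delta> \<le> 1" "2 * \<delta> \<le> \<delta>0" using \<delta>0(1) by (auto simp: \<delta>_def)
  have near: "cball (x + s *\<^sub>R axis j 1) \<delta> \<subseteq> \<Omega>" if "x \<in> \<Omega>'" "\<bar>s\<bar> \<le> \<delta>" for x s and j :: 'm
  proof -
    have "cball (x + s *\<^sub>R axis j 1) \<delta> \<subseteq> cball x \<delta>0"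
      using \<delta> that(2) by (simp add: cball_subset_cball_iff dist_norm)
    moreover have "x \<in> closure \<Omega>'" using that(1) closure_subset by blast
    ultimately show ?thesis using \<delta>0(2) by blast
  qed
  \<comment> \<open>Beyond the dimensions, \<Omega> and \<Omega>' enter only through
    \<open>\<delta>\<close> and the generators only through \<open>L\<close>.\<close>
  define C where "C = CARD('m) * (?Q * (CARD('n) * (L / \<delta>)))"
  show ?thesis
  proof (intro exI[of _ C] allI impI)
    fix f :: "real ^ 'm \<Rightarrow> (real ^ 'n, 'q) unordered_tuple"
    assume cont: "continuous_on \<Omega> f" and Ck: "\<forall>j. Ck1_closure (?Q - 1) \<Omega> (\<lambda>x. Sig (f x) $ j)"
    define N where "N j = Ck1_norm (?Q - 1) \<Omega> (\<lambda>x. Sig (f x) $ j)" for j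
    define M where "M = (MAX j. N j powr (1 / d j))"
    have M: "N j powr (1 / d j) \<le> M" for j unfolding M_def by (intro Max_ge) auto
    have M0: "0 \<le> M" using order.trans[OF powr_ge_zero M] .
    \<comment> \<open>The summand 1 keeps the scale positive when all norms vanish; it is the 1 of
      the final estimate.\<close>
    define \<rho> where "\<rho> = 1 + M"
    have \<rho>: "0 < \<rho>" using M0 by (simp add: \<rho>_def)
    have N: "N i \<le> \<rho> ^ d i" for i
    proof (cases "0 < N i")
      case True
      have "N i = (N i powr (1 / d i)) ^ d i"
        using True assms(4)[of i] by (simp add: powr_realpow[symmetric] powr_powr)
      also have "\<dots> \<le> \<rho> ^ d i" using M[of i] by (intro power_mono) (auto simp: \<rho>_def)
      finally show ?thesis .
    next
      case False
      then show ?thesis using zero_le_power[of \<rho> "d i"] \<rho> by linarith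
    qed
    define \<Lambda> where "\<Lambda> = L * \<rho> / \<delta>"
    have \<Lambda>: "0 \<le> \<Lambda>" using \<open>0 \<le> L\<close> \<rho> \<delta> by (simp add: \<Lambda>_def)
    have Lip: "dist (f (x + t *\<^sub>R axis j 1)) (f x) \<le> ?Q * (CARD('n) * \<Lambda>) * t"
      if x: "x \<in> \<Omega>'" and t: "0 < t" "t \<le> \<delta>" for x t j
    proof -
      \<comment> \<open>Every point of the segment is the centre of a ball of radius
        \<open>\<delta>\<close> in \<Omega>, so the slope bound holds at each of them with the same
        constant.\<close>
      have "dist (f (x + t *\<^sub>R axis j 1)) (f (x + 0 *\<^sub>R axis j 1)) \<le> ?Q * (CARD('n) * \<Lambda>) * (t - 0)"
      proof (rule Lipschitz_of_pointwise)
        fix s assume s: "0 \<le> s" "s \<le> t"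
        define y where "y = x + s *\<^sub>R axis j 1"
        have ball: "cball y \<delta> \<subseteq> \<Omega>" unfolding y_def using x s t by (intro near) auto
        then have "y \<in> \<Omega>" using \<delta> by auto
        then have isCont: "isCont f y" using cont assms(1) by (simp add: continuous_on_eq_continuous_at)
        have "((\<lambda>h. y + h *\<^sub>R axis j 1) \<longlongrightarrow> y + 0 *\<^sub>R axis j 1) (at 0)" by (intro tendsto_intros)
        then have "((\<lambda>h. f (y + h *\<^sub>R axis j 1)) \<longlongrightarrow> f (y + 0 *\<^sub>R axis j 1)) (at 0)"
          using isCont_tendsto_compose[OF isCont] by simp
        moreover have "slope_le ?Q \<Lambda> (\<lambda>h. sorted_coord l (f (y + h *\<^sub>R axis j 1)))" for l
          unfolding \<Lambda>_def using assms(2) cont Ck \<delta> ball \<rho> N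
          by (intro L[rule_format] conjI) (auto simp: N_def)
        ultimately have "\<forall>\<^sub>F h in at 0. dist (f (y + h *\<^sub>R axis j 1)) (f (y + 0 *\<^sub>R axis j 1)) \<le> ?Q * (CARD('n) * \<Lambda>) * \<bar>h\<bar>"
          by (intro unordered_slope \<Lambda>)
        then show "\<forall>\<^sub>F h in at 0. dist (f (x + (s + h) *\<^sub>R axis j 1)) (f (x + s *\<^sub>R axis j 1)) \<le> ?Q * (CARD('n) * \<Lambda>) * \<bar>h\<bar>"
          by (simp add: y_def scaleR_add_left add.assoc)
      qed (use t in simp)
      then show ?thesis by simp
    qed
    have bdd: "bounded \<Omega>'" using assms(7) compact_imp_bounded bounded_subset closure_subset by metis
    have shift: "x + t *\<^sub>R axis j 1 \<in> \<Omega>" if "x \<in> \<Omega>'" "0 < t" "t \<le> \<delta>" for x t and j :: 'm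
      using near[OF that(1), of t j] that \<delta> by auto
    have "f \<in> W1inf \<Omega>'" "Linf_norm \<Omega>' (metric_gradient \<Omega>' f) \<le> ennreal (CARD('m) * (?Q * (CARD('n) * \<Lambda>)))"
      using W1inf_directionally_Lipschitz[OF assms(6) bdd assms(8) cont \<delta>(1) _ shift Lip] \<Lambda> by simp_all
    moreover have "CARD('m) * (?Q * (CARD('n) * \<Lambda>)) = C * (1 + M)" by (simp add: C_def \<Lambda>_def \<rho>_def)
    ultimately show "f \<in> W1inf \<Omega>' \<and> Linf_norm \<Omega>' (metric_gradient \<Omega>' f) \<le>
        ennreal (C * (1 + (MAX j. Ck1_norm (?Q - 1) \<Omega> (\<lambda>x. Sig (f x) $ j) powr (1 / d j))))"
      by (simp add: M_def N_def)
  qed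
qed

end
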